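(* Let $N\in\mathbb N_+$, fix all quantum spins $j_n$ equal to the auxiliary spin $j$ and all $v_n=1$. For any $j\in\frac12\mathbb N_+$, any $h_z\in\mathbb C$ and $h_\pm\in\mathbb C^*$, the following commutation relations hold: $$\big[\mathcal H^{\text{spin }j}_{XXZ}(h_\pm,h_z,0,1),\ \mathcal W_0^{(N)}\big]=0,\qquad\big[\mathcal H^{\text{spin }j}_{XXZ}(h_\pm,h_z,0,-1),\ \mathcal W_1^{(N)}\big]=0,$$ and, with $\bar h_z=\frac{\bar\varepsilon_+-\bar\varepsilon_-}{\bar\varepsilon_++\bar\varepsilon_-}$, $$\big[\mathcal H^{\text{spin }j}_{XXZ}(h_\pm,h_z,0,\bar h_z),\ \bar\varepsilon_+\mathcal W_0^{(N)}+\bar\varepsilon_-\mathcal W_1^{(N)}\big]=0.$$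
   Context: **Conventions.** $q\in\mathbb C^*$ is not a root of unity, $[n]_q=\frac{q^n-q^{-n}}{q-q^{-1}}$, $c(u)=u-u^{-1}$, $X_1=X\otimes\mathbb I$, $X_2=\mathbb I\otimes X$. Boundary parameters: $k_\pm\in\mathbb C^*$, $\varepsilon_\pm,\bar\varepsilon_\pm,\bar k_\pm\in\mathbb C$. **Fusion.** $B_{j,j'}=\sqrt{[j+j']_q[j-j'+1]_q}$; spin-$j$ matrices $(S_+)_{mn}=B_{j,j+1-m}\delta_{m,n-1}$, $(S_-)_{mn}=B_{j,j+1-n}\delta_{m-1,n}$, $(S_3)_{mn}=2(j+1-n)\delta_{mn}$. $\mathcal E^{(j)}:\mathbb C^{2j+1}\to\mathbb C^2\otimes\mathbb C^{2j}$ has nonzero entries $\mathcal E_{1,1}=1$, $\mathcal E_{1+n,1+n}=\prod_{p=0}^{n-1}\frac{B_{j-1/2,j-p-1/2}}{B_{j,j-p}}$ ($1\le n\le2j-1$), $\mathcal E_{2j+m,1+m}=[m]_q\mathcal E_{m,m}/B_{j,j+1-m}$ ($1\le m\le2j$). $\mathcal F^{(j)}:\mathbb C^2\otimes\mathbb C^{2j}\to\mathbb C^{2j+1}$ has nonzero entries $\mathcal F_{1,1}=1$, $\mathcal F_{n,n+2j-1}=\frac{\mathcal E_{n+2j-1,n}}{\mathcal E_{n,n}^2+\mathcal E_{n+2j-1,n}^2}$, $\mathcal F_{n,n}=\frac{1-\mathcal F_{n,n+2j-1}\mathcal E_{n+2j-1,n}}{\mathcal E_{n,n}}$ ($2\le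 n\le2j$), $\mathcal F_{2j+1,4j}=\mathcal E_{4j,2j+1}^{-1}$. **R-matrices.** $R^{(\frac12,0)}=\mathbb I_2$, $R^{(0,j)}=\mathbb I$, $R^{(\frac12,j)}(u)=\prod_{k=0}^{2j-2}c(uq^{j-\frac12-k})\Big((q-q^{-1})(\sigma_+\otimes S_-+\sigma_-\otimes S_+)+uq^{\frac12(\mathbb I+\sigma_z\otimes S_3)}-u^{-1}q^{-\frac12(\mathbb I+\sigma_z\otimes S_3)}\Big)$, $R^{(j_1,j_2)}(u)=\mathcal F^{(j_1)}_{\langle12\rangle}R_{13}^{(\frac12,j_2)}(uq^{-j_1+\frac12})R_{23}^{(j_1-\frac12,j_2)}(uq^{\frac12})\mathcal E^{(j_1)}_{\langle12\rangle}$; $\tilde R^{(j_1,j_2)}(u)=\Big(\prod_{k=0}^{2j_1-1}\prod_{\ell=0}^{2j_2-1}c(uq^{j_1+j_2-k-\ell})\Big)^{-1}R^{(j_1,j_2)}(u)$ (no pole at $u=1$ for $j_1=j_2$). **K-matrices.** $K^{(0)}=1$, $K^{(\frac12)}(u)=\begin{pmatrix}u\varepsilon_++u^{-1}\varepsilon_-&k_+c(u^2)/(q-q^{-1})\\k_-c(u^2)/(q-q^{-1})&u\varepsilon_-+u^{-1}\varepsilon_+\end{pmatrix}$, $K^{(j)}(u)=\mathcal F^{(j)}K_1^{(\frac12)}(uq^{-j+\frac12})R^{(\frac12,j-\frac12)}(u^2q^{-j+1})K_2^{(j-\frac12)}(uq^{\frac12})\mathcal E^{(j)}$; $\tilde K^{(j)}(u)=\Big(\prod_{\ell=0}^{2j-2}c(u^2q^{1-\ell})\Big)^{-1}K^{(j)}(u)$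 (Laurent polynomial entries); $\tilde K^{+(j)}(u)=\big(\tilde K^{(j)}(u^{-1}q^{-1})\big)^t$ with $\varepsilon_\pm\to\bar\varepsilon_\mp$, $k_\pm\to-\bar k_\mp$. **Homogeneous normalized transfer matrix and Hamiltonian.** $\tilde{\boldsymbol t}(u)=\mathrm{tr}_{\mathbb C^{2j+1}}\big(\tilde K_a^{+(j)}(u)\tilde R_{Na}^{(j,j)}(u)\cdots\tilde R_{1a}^{(j,j)}(u)\tilde K_a^{(j)}(u)\tilde R_{1a}^{(j,j)}(u)\cdots\tilde R_{Na}^{(j,j)}(u)\big)$ on $(\mathbb C^{2j+1})^{\otimes N}$ (tensor factors ordered $N,\dots,1$). $\mathcal H^{\text{spin }j}_{XXZ}=\tilde{\boldsymbol t}(1)^{-1}\frac d{du}\tilde{\boldsymbol t}(u)|_{u=1}$, for parameters such that $\tilde{\boldsymbol t}(1)$ is invertible. It depends on the boundary parameters only through $h_\pm=\frac{2k_\pm}{\varepsilon_++\varepsilon_-}$, $\bar h_\pm=\frac{2\bar k_\pm}{\bar\varepsilon_++\bar\varepsilon_-}$, $h_z=\frac{\varepsilon_+-\varepsilon_-}{\varepsilon_++\varepsilon_-}$, $\bar h_z=\frac{\bar\varepsilon_+-\bar\varepsilon_-}{\bar\varepsilon_++\bar\varepsilon_-}$ and is written $\mathcal H^{\text{spin }j}_{XXZ}(h_\pm,h_z,\bar h_\pm,\bar h_z)$; third argument $0$ means $\bar h_+=\bar h_-=0$. **Operators.** With the $k_\pm,\varepsilon_\pm$ defining $h_\pm,h_z$: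 $\mathcal W_0^{(0)}=\varepsilon_+$, $\mathcal W_1^{(0)}=\varepsilon_-$, $\mathcal W_0^{(n)}=\big(k_+q^{\frac12}S_+q^{\frac12S_3}+k_-q^{-\frac12}S_-q^{\frac12S_3}\big)\otimes\mathbb I^{(n-1)}+q^{S_3}\otimes\mathcal W_0^{(n-1)}$, $\mathcal W_1^{(n)}=\big(k_+q^{-\frac12}S_+q^{-\frac12S_3}+k_-q^{\frac12}S_-q^{-\frac12S_3}\big)\otimes\mathbb I^{(n-1)}+q^{-S_3}\otimes\mathcal W_1^{(n-1)}$ (spin-$j$ matrices). *)

theory Defs
  imports
    "HOL-Complex_Analysis.Complex_Analysis"
    "Jordan_Normal_Form.Gauss_Jordan_Elimination"
begin

text \<open>
  Conventions used throughout.

  \<^item> A spin \<open>j \<in> \<half>\<nat>\<close> is represented by the natural number \<open>d = 2 j\<close>, so that spin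
    \<open>j\<close> lives on \<open>\<complex>\<^sup>d\<^sup>+\<^sup>1\<close>.
  \<^item> All powers of \<open>q\<close> that occur have exponents in \<open>\<half>\<int>\<close>.  They are expressed through a
    fixed square root \<open>s\<close> of \<open>q\<close>: \<open>s powi m\<close> is \<open>q\<^sup>m\<^sup>/\<^sup>2\<close>; in particular
    \<open>s powi 2 = q\<close>.
  \<^item> Matrices of the matrix library are indexed from 0; \<open>mat1\<close> builds a matrix from a
    function of indices that start at 1.
\<close>

definition mat1 :: "nat \<Rightarrow> nat \<Rightarrow> (nat \<Rightarrow> nat \<Rightarrow> 'a) \<Rightarrow> 'a mat" where
  "mat1 nr nc f = mat nr nc (\<lambda>(i, k). f (i + 1) (k + 1))"

definition kron :: "'a :: times mat \<Rightarrow> 'a mat \<Rightarrow> 'a mat" (infixr \<open>\<otimes>\<^sub>K\<close> 75) where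
  "A \<otimes>\<^sub>K B = mat (dim_row A * dim_row B) (dim_col A * dim_col B)
     (\<lambda>(i, k). A $$ (i div dim_row B, k div dim_col B) * B $$ (i mod dim_row B, k mod dim_col B))"

text \<open>
  For tensor factors of dimensions \<open>ds\<close> (leftmost factor first, positions counted from 0),
  \<open>digit ds p i\<close> is the component at position \<open>p\<close> of the \<open>i\<close>-th product basis vector.
  If \<open>M\<close> acts on the tensor product of factor \<open>p\<close> and factor \<open>r\<close>, in this order, then
  \<open>two_leg ds p r M\<close> is \<open>M\<^sub>p\<^sub>r\<close>, acting trivially on all other factors.
\<close>

definition digit :: "nat list \<Rightarrow> nat \<Rightarrow> nat \<Rightarrow> nat" where
  "digit ds p i = (i div prod_list (drop (Suc p) ds)) mod (ds ! p)"

definition two_leg :: "nat list \<Rightarrow> nat \<Rightarrow> nat \<Rightarrow> complex mat \<Rightarrow> complex mat" where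
  "two_leg ds p r M = mat (prod_list ds) (prod_list ds) (\<lambda>(i, k).
     if \<forall>t < length ds. t \<noteq> p \<and> t \<noteq> r \<longrightarrow> digit ds t i = digit ds t k
     then M $$ (digit ds p i * (ds ! r) + digit ds r i, digit ds p k * (ds ! r) + digit ds r k)
     else 0)"

definition ptrace_last :: "nat \<Rightarrow> nat \<Rightarrow> complex mat \<Rightarrow> complex mat" where
  "ptrace_last n m M = mat n n (\<lambda>(i, k). \<Sum>x<m. M $$ (i * m + x, k * m + x))"

definition commutator :: "complex mat \<Rightarrow> complex mat \<Rightarrow> complex mat" where
  "commutator A B = A * B - B * A"

definition cfun :: "complex \<Rightarrow> complex" where
  "cfun u = u - inverse u"

definition qint :: "complex \<Rightarrow> int \<Rightarrow> complex" where
  "qint s n = (s powi (2 * n) - s powi (- 2 * n)) / (s powi 2 - s powi (- 2))"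

text \<open>\<open>q\<^sup>A\<^sup>/\<^sup>2\<close> for a diagonal integer matrix \<open>A\<close>.\<close>

definition qexp_half :: "complex \<Rightarrow> int mat \<Rightarrow> complex mat" where
  "qexp_half s A = mat (dim_row A) (dim_row A) (\<lambda>(i, k). if i = k then s powi (A $$ (i, i)) else 0)"


subsection \<open>Spin matrices and fusion\<close>

text \<open>
  \<open>Bcoef s a b\<close> is \<open>B\<^sub>j\<^sub>,\<^sub>j\<^sub>'\<close> for \<open>a = 2 j\<close> and \<open>b = 2 j'\<close>; it is only used
  when \<open>a\<close> and \<open>b\<close> have the same parity.
\<close>

definition Bcoef :: "complex \<Rightarrow> int \<Rightarrow> int \<Rightarrow> complex" where
  "Bcoef s a b = csqrt (qint s ((a + b) div 2) * qint s ((a - b) div 2 + 1))"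

definition S_plus :: "complex \<Rightarrow> nat \<Rightarrow> complex mat" where
  "S_plus s d = mat1 (d + 1) (d + 1)
     (\<lambda>m n. if m + 1 = n then Bcoef s (int d) (int d + 2 - 2 * int m) else 0)"

definition S_minus :: "complex \<Rightarrow> nat \<Rightarrow> complex mat" where
  "S_minus s d = mat1 (d + 1) (d + 1)
     (\<lambda>m n. if m = n + 1 then Bcoef s (int d) (int d + 2 - 2 * int n) else 0)"

definition S_three :: "nat \<Rightarrow> int mat" where
  "S_three d = mat1 (d + 1) (d + 1) (\<lambda>m n. if m = n then int d + 2 - 2 * int n else 0)"

definition sigma_plus :: "complex mat" where
  "sigma_plus = mat_of_rows_list 2 [[0, 1], [0, 0]]"

definition sigma_minus :: "complex mat" where
  "sigma_minus = mat_of_rows_list 2 [[0, 0], [1, 0]]"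

definition sigma_z :: "int mat" where
  "sigma_z = mat_of_rows_list 2 [[1, 0], [0, - 1]]"

text \<open>\<open>E_diag s d (1 + n)\<close> is the entry \<open>(1 + n, 1 + n)\<close>, for \<open>0 \<le> n \<le> 2 j - 1\<close>.\<close>

definition E_diag :: "complex \<Rightarrow> nat \<Rightarrow> nat \<Rightarrow> complex" where
  "E_diag s d i = (\<Prod>p<i - 1. Bcoef s (int d - 1) (int d - 2 * int p - 1)
                             / Bcoef s (int d) (int d - 2 * int p))"

text \<open>
  Entries with indices from 1.  The second case is \<open>(r, c) = (2 j + m, 1 + m)\<close> with
  \<open>1 \<le> m \<le> 2 j\<close>.
\<close>

definition E_entry :: "complex \<Rightarrow> nat \<Rightarrow> nat \<Rightarrow> nat \<Rightarrow> complex" where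
  "E_entry s d r c =
     (if r = c \<and> 1 \<le> c \<and> c \<le> d then E_diag s d c
      else if 2 \<le> c \<and> c \<le> d + 1 \<and> r + 1 = d + c
        then qint s (int c - 1) * E_diag s d (c - 1)
             / Bcoef s (int d) (int d + 2 - 2 * (int c - 1))
      else 0)"

definition E_fus :: "complex \<Rightarrow> nat \<Rightarrow> complex mat" where
  "E_fus s d = mat1 (2 * d) (d + 1) (E_entry s d)"

definition F_off :: "complex \<Rightarrow> nat \<Rightarrow> nat \<Rightarrow> complex" where
  "F_off s d n = E_entry s d (n + d - 1) n / ((E_entry s d n n)\<^sup>2 + (E_entry s d (n + d - 1) n)\<^sup>2)"

definition F_entry :: "complex \<Rightarrow> nat \<Rightarrow> nat \<Rightarrow> nat \<Rightarrow> complex" where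
  "F_entry s d r c =
     (if r = 1 \<and> c = 1 then 1
      else if 2 \<le> r \<and> r \<le> d \<and> c = r + d - 1 then F_off s d r
      else if 2 \<le> r \<and> r \<le> d \<and> c = r
        then (1 - F_off s d r * E_entry s d (r + d - 1) r) / E_entry s d r r
      else if r = d + 1 \<and> c = 2 * d then inverse (E_entry s d (2 * d) (d + 1))
      else 0)"

definition F_fus :: "complex \<Rightarrow> nat \<Rightarrow> complex mat" where
  "F_fus s d = mat1 (d + 1) (2 * d) (F_entry s d)"


subsection \<open>R-matrices\<close>

definition R_half :: "complex \<Rightarrow> nat \<Rightarrow> complex \<Rightarrow> complex mat" where
  "R_half s d u =
     (if d = 0 then 1\<^sub>m 2
      else (\<Prod>k<d - 1. cfun (u * s powi (int d - 1 - 2 * int k))) \<cdot>\<^sub>m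
        ((s powi 2 - s powi (- 2)) \<cdot>\<^sub>m (sigma_plus \<otimes>\<^sub>K S_minus s d + sigma_minus \<otimes>\<^sub>K S_plus s d)
         + u \<cdot>\<^sub>m qexp_half s (1\<^sub>m (2 * (d + 1)) + sigma_z \<otimes>\<^sub>K S_three d)
         - inverse u \<cdot>\<^sub>m qexp_half s (- (1\<^sub>m (2 * (d + 1)) + sigma_z \<otimes>\<^sub>K S_three d))))"

fun R_mat :: "complex \<Rightarrow> nat \<Rightarrow> nat \<Rightarrow> complex \<Rightarrow> complex mat" where
  "R_mat s 0 d2 u = 1\<^sub>m (d2 + 1)"
| "R_mat s (Suc 0) d2 u = R_half s d2 u"
| "R_mat s (Suc (Suc d)) d2 u =
     (let d1 = Suc (Suc d); ds = [2, d1, d2 + 1] in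
        (F_fus s d1 \<otimes>\<^sub>K 1\<^sub>m (d2 + 1))
        * two_leg ds 0 2 (R_half s d2 (u * s powi (1 - int d1)))
        * two_leg ds 1 2 (R_mat s (Suc d) d2 (u * s))
        * (E_fus s d1 \<otimes>\<^sub>K 1\<^sub>m (d2 + 1)))"

text \<open>
  The quotient defining the normalized R-matrix is of the form \<open>0 / 0\<close> at \<open>u = 1\<close> when
  \<open>j\<^sub>1 = j\<^sub>2 \<ge> 1\<close>; its value there is the one that removes the singularity.  The
  same applies to the normalized K-matrices below.
\<close>

definition R_tilde :: "complex \<Rightarrow> nat \<Rightarrow> nat \<Rightarrow> complex \<Rightarrow> complex mat" where
  "R_tilde s d1 d2 u = mat ((d1 + 1) * (d2 + 1)) ((d1 + 1) * (d2 + 1)) (\<lambda>(i, k).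
     remove_sings (\<lambda>v.
       inverse (\<Prod>m<d1. \<Prod>l<d2. cfun (v * s powi (int d1 + int d2 - 2 * int m - 2 * int l)))
       * R_mat s d1 d2 v $$ (i, k)) u)"


subsection \<open>K-matrices\<close>

record boundary =
  k_plus :: complex
  k_minus :: complex
  eps_plus :: complex
  eps_minus :: complex

definition K_half :: "complex \<Rightarrow> boundary \<Rightarrow> complex \<Rightarrow> complex mat" where
  "K_half s b u = mat_of_rows_list 2
     [[u * eps_plus b + inverse u * eps_minus b,
       k_plus b * cfun (u\<^sup>2) / (s powi 2 - s powi (- 2))],
      [k_minus b * cfun (u\<^sup>2) / (s powi 2 - s powi (- 2)),
       u * eps_minus b + inverse u * eps_plus b]]"

fun K_mat :: "complex \<Rightarrow> boundary \<Rightarrow> nat \<Rightarrow> complex \<Rightarrow> complex mat" where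
  "K_mat s b 0 u = 1\<^sub>m 1"
| "K_mat s b (Suc 0) u = K_half s b u"
| "K_mat s b (Suc (Suc d)) u =
     (let e = Suc (Suc d) in
        F_fus s e
        * (K_half s b (u * s powi (1 - int e)) \<otimes>\<^sub>K 1\<^sub>m e)
        * R_half s (Suc d) (u\<^sup>2 * s powi (2 - int e))
        * (1\<^sub>m 2 \<otimes>\<^sub>K K_mat s b (Suc d) (u * s))
        * E_fus s e)"

text \<open>
  \<open>K_norm\<close> is the factor \<open>\<Prod>\<^sub>l c(u\<^sup>2 q\<^sup>1\<^sup>-\<^sup>l)\<close>, \<open>0 \<le> l \<le> 2 j - 2\<close>.  It is
  what a single fusion step splits off.  From \<open>j = 3/2\<close> on, dividing by it still leaves in
  \<open>K_mat\<close> the scalar factors inherited from the smaller spins; one of them is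
  \<open>c(u\<^sup>2 q\<^sup>2)\<close>, which vanishes at \<open>u = q\<^sup>-\<^sup>1\<close>, that is, in the dual K-matrix at spectral
  parameter 1, where the transfer matrix is then zero.  \<open>K_norm_full\<close> is the
  product \<open>K_norm s d u * K_norm s (d - 1) (u * s) * \<dots>\<close> over all fusion steps;
  it agrees with \<open>K_norm\<close> for \<open>j = 1/2\<close> and \<open>j = 1\<close>, and dividing by it leaves a
  transfer matrix that is generically invertible at 1.  The normalization is kept as
  a parameter \<open>\<nu>\<close> so that both can be used.
\<close>

definition K_norm :: "complex \<Rightarrow> nat \<Rightarrow> complex \<Rightarrow> complex" where
  "K_norm s d u = (\<Prod>l<d - 1. cfun (u\<^sup>2 * s powi (2 * (1 - int l))))"

definition K_norm_full :: "complex \<Rightarrow> nat \<Rightarrow> complex \<Rightarrow> complex" where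
  "K_norm_full s d u = (\<Prod>n<d. K_norm s (d - n) (u * s ^ n))"

definition K_tilde ::
  "(complex \<Rightarrow> nat \<Rightarrow> complex \<Rightarrow> complex) \<Rightarrow> complex \<Rightarrow> boundary \<Rightarrow> nat \<Rightarrow> complex \<Rightarrow> complex mat"
  where
  "K_tilde \<nu> s b d u = mat (d + 1) (d + 1) (\<lambda>(i, k).
     remove_sings (\<lambda>v. inverse (\<nu> s d v) * K_mat s b d v $$ (i, k)) u)"

text \<open>The argument \<open>bb\<close> holds the barred boundary parameters.\<close>

definition K_plus_tilde ::
  "(complex \<Rightarrow> nat \<Rightarrow> complex \<Rightarrow> complex) \<Rightarrow> complex \<Rightarrow> boundary \<Rightarrow> nat \<Rightarrow> complex \<Rightarrow> complex mat"
  where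
  "K_plus_tilde \<nu> s bb d u = transpose_mat (K_tilde \<nu> s
     \<lparr>k_plus = - k_minus bb, k_minus = - k_plus bb, eps_plus = eps_minus bb, eps_minus = eps_plus bb\<rparr>
     d (inverse u * s powi (- 2)))"


subsection \<open>Transfer matrix and Hamiltonian\<close>

text \<open>
  The tensor factors are ordered \<open>N, \<dots>, 1, a\<close>, so that site \<open>n\<close> has position \<open>N - n\<close>
  and the auxiliary space \<open>a\<close> has position \<open>N\<close>.
\<close>

definition R_site :: "complex \<Rightarrow> nat \<Rightarrow> nat \<Rightarrow> nat \<Rightarrow> complex \<Rightarrow> complex mat" where
  "R_site s d N n u = two_leg (replicate (N + 1) (d + 1)) (N - n) N (R_tilde s d d u)"

definition transfer ::
  "(complex \<Rightarrow> nat \<Rightarrow> complex \<Rightarrow> complex) \<Rightarrow> complex \<Rightarrow> nat \<Rightarrow> nat \<Rightarrow> boundary \<Rightarrow> boundary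
   \<Rightarrow> complex \<Rightarrow> complex mat" where
  "transfer \<nu> s d N b bb u =
     (let I = 1\<^sub>m ((d + 1) ^ N); J = 1\<^sub>m ((d + 1) ^ (N + 1)) in
      ptrace_last ((d + 1) ^ N) (d + 1)
        ((I \<otimes>\<^sub>K K_plus_tilde \<nu> s bb d u)
         * foldr (\<lambda>n M. R_site s d N n u * M) (rev [1..<N + 1]) J
         * (I \<otimes>\<^sub>K K_tilde \<nu> s b d u)
         * foldr (\<lambda>n M. R_site s d N n u * M) [1..<N + 1] J))"

text \<open>Meaningful only if \<open>transfer \<nu> s d N b bb 1\<close> is invertible.\<close>

definition H_XXZ ::
  "(complex \<Rightarrow> nat \<Rightarrow> complex \<Rightarrow> complex) \<Rightarrow> complex \<Rightarrow> nat \<Rightarrow> nat \<Rightarrow> boundary \<Rightarrow> boundary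
   \<Rightarrow> complex mat" where
  "H_XXZ \<nu> s d N b bb =
     the (mat_inverse (transfer \<nu> s d N b bb 1))
     * mat ((d + 1) ^ N) ((d + 1) ^ N) (\<lambda>(i, k). deriv (\<lambda>u. transfer \<nu> s d N b bb u $$ (i, k)) 1)"

text \<open>\<open>b\<close> has the reduced parameters \<open>h\<^sub>+\<close>, \<open>h\<^sub>-\<close>, \<open>h\<^sub>z\<close>.\<close>

definition reduced_params :: "boundary \<Rightarrow> complex \<Rightarrow> complex \<Rightarrow> complex \<Rightarrow> bool" where
  "reduced_params b hp hm hz \<longleftrightarrow>
     eps_plus b + eps_minus b \<noteq> 0 \<and>
     hp = 2 * k_plus b / (eps_plus b + eps_minus b) \<and>
     hm = 2 * k_minus b / (eps_plus b + eps_minus b) \<and>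
     hz = (eps_plus b - eps_minus b) / (eps_plus b + eps_minus b)"


subsection \<open>The operators commuting with the Hamiltonian\<close>

fun W0 :: "complex \<Rightarrow> nat \<Rightarrow> boundary \<Rightarrow> nat \<Rightarrow> complex mat" where
  "W0 s d b 0 = eps_plus b \<cdot>\<^sub>m 1\<^sub>m 1"
| "W0 s d b (Suc n) =
     ((k_plus b * s) \<cdot>\<^sub>m (S_plus s d * qexp_half s (S_three d))
      + (k_minus b * inverse s) \<cdot>\<^sub>m (S_minus s d * qexp_half s (S_three d))) \<otimes>\<^sub>K 1\<^sub>m ((d + 1) ^ n)
     + qexp_half s (2 \<cdot>\<^sub>m S_three d) \<otimes>\<^sub>K W0 s d b n"

fun W1 :: "complex \<Rightarrow> nat \<Rightarrow> boundary \<Rightarrow> nat \<Rightarrow> complex mat" where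
  "W1 s d b 0 = eps_minus b \<cdot>\<^sub>m 1\<^sub>m 1"
| "W1 s d b (Suc n) =
     ((k_plus b * inverse s) \<cdot>\<^sub>m (S_plus s d * qexp_half s (- S_three d))
      + (k_minus b * s) \<cdot>\<^sub>m (S_minus s d * qexp_half s (- S_three d))) \<otimes>\<^sub>K 1\<^sub>m ((d + 1) ^ n)
     + qexp_half s (- (2 \<cdot>\<^sub>m S_three d)) \<otimes>\<^sub>K W1 s d b n"

end

theory Submission
  imports Defs
begin

text \<open>
  Why the theorem holds.  The operators in question satisfy
  \<open>W\<^sup>(\<^sup>N\<^sup>) = X \<otimes> 1 + q\<^sup>\<tau>\<^sup>S\<^sup>3 \<otimes> W\<^sup>(\<^sup>N\<^sup>-\<^sup>1\<^sup>)\<close> with a ladder operator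
  \<open>X = k\<^sub>+ s\<^sup>\<tau> S\<^sub>+ q\<^sup>\<tau>\<^sup>S\<^sup>3\<^sup>/\<^sup>2 + k\<^sub>- s\<^sup>-\<^sup>\<tau> S\<^sub>- q\<^sup>\<tau>\<^sup>S\<^sup>3\<^sup>/\<^sup>2\<close>, where \<open>s\<^sup>2 = q\<close>, and the sign is \<open>\<tau> = 1\<close>
  for \<open>W\<^sub>0\<close> and \<open>\<tau> = - 1\<close> for \<open>W\<^sub>1\<close>.  Let \<open>X(u)\<close> be \<open>X\<close> with \<open>s u\<close> in place of the two
  explicit \<open>s\<close> (an evaluation representation with spectral parameter \<open>u\<close>).  Three facts carry
  the proof.

  \<^item> The R-matrix \<open>R\<^sup>(\<^sup>j\<^sup>1\<^sup>,\<^sup>j\<^sup>2\<^sup>)(u)\<close> exchanges the two coproducts of a ladder operator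
    (\<open>Rop_intertwines\<close>), and \<open>K\<^sup>(\<^sup>j\<^sup>)(u)\<close> takes \<open>X(u) + \<epsilon>\<^sub>\<plusminus> q\<^sup>\<tau>\<^sup>S\<^sup>3\<close> to
    \<open>X(1/u) + \<epsilon>\<^sub>\<plusminus> q\<^sup>\<tau>\<^sup>S\<^sup>3\<close> (\<open>Kop_intertwines\<close>), with \<open>\<epsilon>\<^sub>+\<close> for \<open>\<tau> = 1\<close> and \<open>\<epsilon>\<^sub>-\<close> for
    \<open>\<tau> = - 1\<close>.  For spin 1/2 this is a computation.  The fused matrices are \<open>F Y\<close>, where \<open>Y\<close> is
    the fusion map \<open>E\<close> followed by smaller R- and K-matrices, and \<open>F E = 1\<close>; the relation passes
    from \<open>Y\<close> to \<open>F Y\<close> once \<open>Y\<close> is known to take its values in the image of \<open>E\<close>.  That image is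
    the kernel of an intertwiner \<open>P\<close>, so \<open>M = P Y\<close> is an intertwiner depending on \<open>u\<close> through
    Laurent polynomials, and one shows \<open>M = 0\<close> without using the Yang-Baxter or the reflection
    equation.  For R-matrices, \<open>M\<close> kills the product of highest weight vectors for weight
    reasons, and the relations for the two signs \<open>\<tau>\<close> propagate this to every basis vector
    (\<open>Mop_Rop_zero\<close>).  For K-matrices, weights are not conserved, but the top coefficients in
    \<open>u\<close> of the entries of \<open>M\<close> satisfy two two-term recursions that force them to vanish
    (\<open>top_coeff_zero\<close>, \<open>Pop_YK_Kop_zero\<close>).

  \<^item> Moving \<open>X(u)\<close> in the auxiliary space through the double row
    \<open>T(u) = R\<^sub>N\<^sub>a \<cdots> R\<^sub>1\<^sub>a K\<^sub>a R\<^sub>1\<^sub>a \<cdots> R\<^sub>N\<^sub>a\<close> gives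
    \<open>T(u) (X\<^sub>a(u) + q\<^sup>\<tau>\<^sup>S\<^sup>3\<^sup>,\<^sup>a W\<^sup>(\<^sup>N\<^sup>)) = (X\<^sub>a(1/u) + q\<^sup>\<tau>\<^sup>S\<^sup>3\<^sup>,\<^sup>a W\<^sup>(\<^sup>N\<^sup>)) T(u)\<close>
    (\<open>chain_intertwines\<close>).

  \<^item> If \<open>k\<^sub>\<plusminus>\<close> vanish in the barred parameters, the dual K-matrix is diagonal and the ratios
    of its successive entries are explicit (\<open>Kop_diag\<close>, \<open>Dg_ratio\<close>).  In the trace over the
    auxiliary space the terms with \<open>X\<^sub>a(u)\<close> and \<open>X\<^sub>a(1/u)\<close> then cancel in the combination of
    the two signs with coefficients \<open>\<epsilon>\<^sub>+\<close> and \<open>\<epsilon>\<^sub>-\<close> of the barred parameters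
    (\<open>trop_commutes\<close>).

  Hence \<open>\<epsilon>\<^sub>+ W\<^sub>0 + \<epsilon>\<^sub>- W\<^sub>1\<close>, with the barred parameters \<open>\<epsilon>\<^sub>\<plusminus>\<close>, commutes with the transfer
  matrix at \<open>u\<close> (\<open>transfer_commutes\<close>) for all \<open>u\<close> near 1, therefore with its value and its
  derivative at 1, and with the Hamiltonian (\<open>H_commutes\<close>).  If the barred \<open>h\<^sub>z\<close> is 1 or \<open>- 1\<close>,
  one of the two coefficients vanishes.

  The computations are not done with matrices.  A vector of \<open>\<complex>\<^sup>d\<^sup>+\<^sup>1\<close> is a function \<open>f\<close> on
  the integers of which only the values on \<open>{0..d}\<close> matter, index 0 being the highest
  weight; a vector of a tensor product is a function of several integer arguments, and a matrix is
  an operator on such functions.  The ladder coefficients vanish at both ends, so that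
  the relations hold at the boundary of the index range without case distinctions.  The matrices
  are compared with these operators only at the end.
\<close>

section \<open>Spin matrices and the spin-1/2 R-operator\<close>

text \<open>
  A fixed square root \<open>s\<close> of the parameter \<open>q\<close>, nonzero and not a root of unity.
\<close>

locale generic_q =
  fixes s :: complex
  assumes s_nz [simp]: "s \<noteq> 0"
    and not_root: "\<And>k :: int. k \<noteq> 0 \<Longrightarrow> s powi k \<noteq> 1"
begin

lemma powi_nz [simp]: "s powi k \<noteq> 0"
  by (simp add: power_int_eq_0_iff)

lemmas powi_add = power_int_add[OF disjI1, OF s_nz]

lemma powi_double: "s powi (2 * k) = s powi k * s powi k"
  by (metis mult_2 power_int_add s_nz)

lemma powi_double': "s powi (k * 2) = s powi k * s powi k"
  by (subst mult.commute) (rule powi_double)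

lemma powi_inj: "s powi k = s powi l \<longleftrightarrow> k = l"
proof
  assume "s powi k = s powi l"
  then have "s powi (k - l) = 1" by (metis power_int_diff right_inverse_eq powi_nz s_nz)
  then show "k = l" using not_root[of "k - l"] by auto
qed simp

text \<open>
  The constant \<open>q - q\<^sup>-\<^sup>1\<close>.
\<close>

abbreviation Q :: complex where "Q \<equiv> s powi 2 - s powi (- 2)"

lemma Q_nz [simp]: "Q \<noteq> 0"
  using powi_inj[of 2 "-2"] by simp

lemma qint_nz: "n \<noteq> 0 \<Longrightarrow> qint s n \<noteq> 0"
  using powi_inj[of "2 * n" "- 2 * n"] Q_nz by (simp add: qint_def)

lemma qint_0 [simp]: "qint s 0 = 0"
  by (simp add: qint_def)

lemma qint_1 [simp]: "qint s 1 = 1"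
  using Q_nz by (simp add: qint_def)

text \<open>
  The ladder coefficient of spin \<open>d/2\<close>: \<open>(S\<^sub>+ f) n = b d n * f (n + 1)\<close> and
  \<open>(S\<^sub>- f) n = b d (n - 1) * f (n - 1)\<close>.
\<close>

definition b :: "nat \<Rightarrow> int \<Rightarrow> complex" where
  "b d n = Bcoef s (int d) (int d - 2 * n)"

lemma b_sq: "b d n * b d n = qint s (int d - n) * qint s (n + 1)"
proof -
  have 1: "(int d + (int d - 2 * n)) div 2 = int d - n" by simp
  have 2: "(int d - (int d - 2 * n)) div 2 + 1 = n + 1" by simp
  show ?thesis
    unfolding b_def Bcoef_def 1 2
    by (metis power2_csqrt power2_eq_square)
qed

lemma b_nz: "0 \<le> n \<Longrightarrow> n < int d \<Longrightarrow> b d n \<noteq> 0"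
  using b_sq[of d n] qint_nz[of "int d - n"] qint_nz[of "n + 1"] by auto

lemma b_bot [simp]: "b d (- 1) = 0"
  using b_sq[of d "- 1"] by simp

lemma b_top [simp]: "b d (int d) = 0"
  using b_sq[of d "int d"] by simp

lemma b_one_0 [simp]: "b (Suc 0) 0 = 1"
  by (simp add: b_def Bcoef_def)

text \<open>
  The diagonal entries of \<open>q\<^sup>t\<^sup>S\<^sup>3\<^sup>/\<^sup>2\<close>.
\<close>

definition kp :: "nat \<Rightarrow> int \<Rightarrow> int \<Rightarrow> complex" where
  "kp d t n = s powi (t * (int d - 2 * n))"

text \<open>
  The coefficient of \<open>f (n + g)\<close> in \<open>(S\<^sub>g f) n\<close>, where \<open>g = 1\<close> stands for \<open>S\<^sub>+\<close> and \<open>g = - 1\<close> for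
  \<open>S\<^sub>-\<close>.
\<close>

definition bs :: "nat \<Rightarrow> int \<Rightarrow> int \<Rightarrow> complex" where
  "bs d g n = (if g = 1 then b d n else b d (n - 1))"

text \<open>
  The operator \<open>x S\<^sub>g \<otimes> q\<^sup>-\<^sup>t\<^sup>S\<^sup>3\<^sup>/\<^sup>2 + q\<^sup>t\<^sup>S\<^sup>3\<^sup>/\<^sup>2 \<otimes> S\<^sub>g\<close> on spins \<open>d1/2\<close> and \<open>d2/2\<close>: a coproduct
  of the ladder operator \<open>S\<^sub>g\<close>, twisted by \<open>x\<close> in the first factor.  Changing the sign of \<open>t\<close> passes to
  the opposite coproduct.
\<close>

definition cop where
  "cop g t x d1 d2 f n a =
     x * bs d1 g n * kp d2 (- t) a * f (n + g) a + kp d1 t n * bs d2 g a * f n (a + g)"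

text \<open>
  Indicator function of the index range \<open>{0..d}\<close>.
\<close>

definition inr :: "nat \<Rightarrow> int \<Rightarrow> complex" where
  "inr d a = of_bool (0 \<le> a \<and> a \<le> int d)"

text \<open>
  The R-matrix for spins 1/2 and \<open>d/2\<close> without its scalar prefactor; \<open>p\<close> indexes the spin-1/2 factor.
  \<open>Lop\<close> below is the same operator with the output cut to the index range of the second factor.
\<close>

definition Lraw :: "nat \<Rightarrow> complex \<Rightarrow> (int \<Rightarrow> int \<Rightarrow> complex) \<Rightarrow> int \<Rightarrow> int \<Rightarrow> complex" where
  "Lraw d u f p a =
    (if p = 0 then (u * s * kp d 1 a - inverse (u * s * kp d 1 a)) * f 0 a + Q * b d (a - 1) * f 1 (a - 1)
     else if p = 1 then (u * s * kp d (-1) a - inverse (u * s * kp d (-1) a)) * f 1 a + Q * b d a * f 0 (a + 1)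
     else 0)"

definition Lop where "Lop d u f p a = inr d a * Lraw d u f p a"

lemma bs_inr:
  assumes "g = 1 \<or> g = - 1"
  shows "bs d g a * inr d (a + g) = inr d a * bs d g a"
proof (cases "bs d g a = 0")
  case False
  then have "g = 1 \<Longrightarrow> a \<noteq> -1 \<and> a \<noteq> int d" "g = -1 \<Longrightarrow> a \<noteq> 0 \<and> a \<noteq> int d + 1"
    by (auto simp: bs_def)
  with assms show ?thesis by (auto simp: inr_def)
qed auto

text \<open>
  For spin 1/2 the exchange of the two coproducts is a direct computation.
\<close>

lemma Lraw_intertwines:
  assumes u: "u \<noteq> 0" and g: "g = 1 \<or> g = - 1" and t: "t = 1 \<or> t = - 1"
  shows "Lraw d u (cop g t (u powi (g * t)) (Suc 0) d f) p a
       = cop g (- t) (u powi (g * t)) (Suc 0) d (Lraw d u f) p a"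
proof -
  define K where "K = s powi int d"
  define X where "X = s powi a"
  have K: "K \<noteq> 0" and X: "X \<noteq> 0" by (simp_all add: K_def X_def)
  have k1: "kp d 1 a = K / (X * X)" "kp d (-1) a = X * X / K"
    "kp d 1 (a+1) = K / (X * X * s^2)" "kp d (-1) (a+1) = X * X * s^2/ K"
    "kp d 1 (a-1) = K / (X * X) * s^2" "kp d (-1) (a-1) = X * X / (K * s^2)"
    by (simp_all add: kp_def K_def X_def power_int_diff power_int_add power_int_minus field_simps powi_double powi_double' power2_eq_square)
  have k2: "kp (Suc 0) 1 0 = s" "kp (Suc 0) (-1) 0 = 1/s" "kp (Suc 0) 1 1 = 1/s" "kp (Suc 0) (-1) 1 = s"
    by (simp_all add: kp_def power_int_minus field_simps)
  have s4: "s ^ 4 - 1 \<noteq> 0"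
    using not_root[of 4] by simp
  have Qs: "s\<^sup>2 - s powi - 2 = (s ^ 4 - 1) / s ^ 2"
    by (simp add: power_int_minus field_simps)
  have q1: "qint s (int d - a) = (K^2/X^2 - X^2/K^2) * s^2 / (s^4 - 1)"
    "qint s (a + 1) = (s^2 * X^2 - 1/(s^2 * X^2)) * s^2 / (s^4 - 1)"
    "qint s (int d - (a - 1)) = (K^2 * s^2/X^2 - X^2/(K^2 * s^2)) * s^2 / (s^4 - 1)"
    "qint s a = (X^2 - 1/X^2) * s^2 / (s^4 - 1)"
    using s4 by (simp_all add: qint_def Qs K_def X_def power_int_diff power_int_add power_int_minus field_simps powi_double powi_double' power2_eq_square power4_eq_xxxx)
  have Dq: "(s^4 - 1) * (b d a * b d a) = (s^4 - 1) * (b d (a-1) * b d (a-1)) + s^2 * (K^2/X^4 - X^4/K^2)"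
    unfolding b_sq q1 using K X s4
    apply (simp add: q1 divide_simps)
    apply (simp add: algebra_simps power_numeral_reduce)
    done
  have Dqm: "(s^4 - 1) * X^4 * K^2 * (b d a * b d a) = (s^4 - 1) * X^4 * K^2 * (b d (a-1) * b d (a-1)) + s^2 * (K^4 - X^8)"
    using Dq K X s4 by (simp add: field_simps power_numeral_reduce)
  have b1m: "p + 1 = 0 \<Longrightarrow> b (Suc 0) p = 0" "p = 2 \<Longrightarrow> b (Suc 0) (p - 1) = 0" for p
    using b_top[of "Suc 0"] b_bot[of "Suc 0"] by (auto simp: add_eq_0_iff)
  have b11: "b (Suc 0) 1 = 0" using b_top[of "Suc 0"] by simp
  show ?thesis
    apply (rule disjE[OF g]; rule disjE[OF t]; hypsubst; cases "p = 0"; cases "p = 1"; (simp add: Lraw_def cop_def bs_def k1 k2 b11 K X u Qs)?)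
    apply (simp_all add: divide_simps K X u)
    apply (simp_all add: algebra_simps power_numeral_reduce b1m)
    subgoal premises using arg_cong[OF Dqm, of "\<lambda>z. s * u * f 1 a * z"] by (simp add: algebra_simps power_numeral_reduce)
    subgoal premises using arg_cong[OF Dqm, of "\<lambda>z. s^3 * u * u * f 1 a * z"] by (simp add: algebra_simps power_numeral_reduce)
    subgoal premises using arg_cong[OF Dqm, of "\<lambda>z. s^3 * u * u * f 0 a * z"] by (simp add: algebra_simps power_numeral_reduce)
    subgoal premises using arg_cong[OF Dqm, of "\<lambda>z. s * u * f 0 a * z"] by (simp add: algebra_simps power_numeral_reduce)
    done
qed

lemma Lop_intertwines:
  assumes u: "u \<noteq> 0" and g: "g = 1 \<or> g = - 1" and t: "t = 1 \<or> t = - 1"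
  shows "Lop d u (cop g t (u powi (g * t)) (Suc 0) d f)
       = cop g (- t) (u powi (g * t)) (Suc 0) d (Lop d u f)"
proof (intro ext)
  fix p a
  have "Lop d u (cop g t (u powi (g * t)) (Suc 0) d f) p a =
     (inr d a * (u powi (g * t) * bs (Suc 0) g p * kp d t a * Lraw d u f (p + g) a)) +
     kp (Suc 0) (-t) p * (inr d a * bs d g a) * Lraw d u f p (a + g)"
    unfolding Lop_def Lraw_intertwines[OF assms] by (simp add: cop_def algebra_simps)
  also have "\<dots> = cop g (- t) (u powi (g * t)) (Suc 0) d (Lop d u f) p a"
    unfolding bs_inr[OF g, symmetric] by (simp add: cop_def Lop_def algebra_simps)
  finally show "Lop d u (cop g t (u powi (g * t)) (Suc 0) d f) p a
       = cop g (- t) (u powi (g * t)) (Suc 0) d (Lop d u f) p a" .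
qed

lemma Lop_lin: "Lop d u (\<lambda>n a. c * f n a + e * g n a) p a = c * Lop d u f p a + e * Lop d u g p a"
  by (simp add: Lop_def Lraw_def algebra_simps)

lemma Lop_weight: "Lop d u (\<lambda>n a. w (n + a) * f n a) p a = w (p + a) * Lop d u f p a"
  by (simp add: Lop_def Lraw_def algebra_simps)

section \<open>Fusion maps\<close>

text \<open>
  The nonzero entries of the fusion map from \<open>\<complex>\<^sup>d\<^sup>+\<^sup>1\<close> to \<open>\<complex>\<^sup>2 \<otimes> \<complex>\<^sup>d\<close>, extended by zero: \<open>al d n\<close> is
  the entry in column \<open>n\<close> with spin-1/2 index 0, and \<open>be d n\<close> the one with spin-1/2 index 1.
\<close>

definition al :: "nat \<Rightarrow> int \<Rightarrow> complex" where
  "al d n = (if 0 \<le> n \<and> n < int d then \<Prod>p<nat n. b (d - 1) (int p) / b d (int p) else 0)"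

definition be :: "nat \<Rightarrow> int \<Rightarrow> complex" where
  "be d n = (if 1 \<le> n \<and> n \<le> int d then qint s n * al d (n - 1) / b d (n - 1) else 0)"

lemma al_nz: "0 \<le> n \<Longrightarrow> n < int d \<Longrightarrow> al d n \<noteq> 0"
  by (auto simp: al_def b_nz)

lemma be_nz: "1 \<le> n \<Longrightarrow> n \<le> int d \<Longrightarrow> be d n \<noteq> 0"
  by (auto simp: be_def al_nz b_nz qint_nz)

lemma al_step: "al (Suc e) (n + 1) * b (Suc e) n = al (Suc e) n * b e n"
proof -
  consider "n < -1" | "n = -1" | "0 \<le> n" "n < int e" | "n = int e" | "n > int e" by linarith
  then show ?thesis
  proof cases
    case 3
    then have "nat (n + 1) = Suc (nat n)" by simp
    with 3 b_nz[of n "Suc e"] show ?thesis by (simp add: al_def)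
  qed (auto simp: al_def)
qed

lemma be_step: "be d (n + 1) * b d n = qint s (n + 1) * al d n"
proof -
  consider "n < 0" | "0 \<le> n" "n < int d" | "n = int d" | "n > int d" by linarith
  then show ?thesis
    using b_nz[of n d] by cases (auto simp: be_def al_def)
qed

lemma be_al: "b e n * be (Suc e) (n + 1) = qint s (n + 1) * al (Suc e) (n + 1)"
proof -
  consider "n < 0" | "0 \<le> n" "n < int e" | "n = int e" | "n > int e" by linarith
  then show ?thesis
  proof cases
    case 1 then show ?thesis by (cases "n = -1") (auto simp: be_def al_def)
  next
    case 2
    then show ?thesis using al_step[of e n] be_step[of "Suc e" n] b_nz[of n "Suc e"]
      by (smt (verit, best) mult.assoc mult.commute mult_right_cancel of_nat_Suc)
  qed (auto simp: be_def al_def)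
qed

lemma qint_Suc:
  assumes "t = 1 \<or> t = - 1"
  shows "qint s (m + 1) = s powi (2 * t) * qint s m + s powi (- (2 * t * m))"
  using assms Q_nz
  apply (elim disjE)
  apply (simp_all add: qint_def divide_simps)
  apply (simp_all add: power_int_add power_int_diff power_int_minus powi_double' field_simps)
  done

text \<open>
  The fusion map \<open>E\<close>.
\<close>

definition Eop :: "nat \<Rightarrow> (int \<Rightarrow> complex) \<Rightarrow> int \<Rightarrow> int \<Rightarrow> complex" where
  "Eop d f p i = (if p = 0 then al d i * f i else if p = 1 then be d (i + 1) * f (i + 1) else 0)"

lemma Eop_lin: "Eop d (\<lambda>n. c * f n + e * g n) p i = c * Eop d f p i + e * Eop d g p i"
  by (simp add: Eop_def algebra_simps)

lemma Eop_weight: "Eop d (\<lambda>n. w n * f n) p i = w (p + i) * Eop d f p i"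
  by (simp add: Eop_def algebra_simps)

lemma b_one_out [simp]: "b (Suc 0) 1 = 0" "b (Suc 0) (-1) = 0"
  using b_top[of "Suc 0"] by (simp_all del: b_top)

lemma b_top_Suc [simp]: "b (Suc e) (int e + 1) = 0" "b (Suc e) (1 + int e) = 0"
  using b_top[of "Suc e"] by (simp_all del: b_top add: add.commute)

lemma E_rel1:
  assumes t: "t = 1 \<or> t = - 1"
  shows "s powi (2 * t * (i - int e)) * be (Suc e) (i + 1) + s powi (2 * t) * b e i * al (Suc e) (i + 1)
       = al (Suc e) i * b (Suc e) i"
proof (cases "0 \<le> i \<and> i < int (Suc e)")
  case True
  then have nz: "b (Suc e) i \<noteq> 0" using b_nz by simp
  have "(s powi (2 * t * (i - int e)) * be (Suc e) (i + 1) + s powi (2 * t) * b e i * al (Suc e) (i + 1)) * b (Suc e) i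
    = s powi (2 * t * (i - int e)) * (be (Suc e) (i + 1) * b (Suc e) i) + s powi (2 * t) * b e i * (al (Suc e) (i + 1) * b (Suc e) i)"
    by (simp add: algebra_simps)
  also have "\<dots> = (s powi (2 * t * (i - int e)) + s powi (2 * t) * qint s (int e - i)) * qint s (i + 1) * al (Suc e) i"
    unfolding be_step al_step using b_sq[of e i] by (simp add: algebra_simps)
  also have "s powi (2 * t * (i - int e)) + s powi (2 * t) * qint s (int e - i) = qint s (int (Suc e) - i)"
    using qint_Suc[OF t, of "int e - i"] by (simp add: algebra_simps)
  also have "qint s (int (Suc e) - i) * qint s (i + 1) * al (Suc e) i = al (Suc e) i * b (Suc e) i * b (Suc e) i"
    using b_sq[of "Suc e" i] by (simp add: algebra_simps)
  finally show ?thesis using nz by simp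
next
  case False
  then show ?thesis by (cases "i = -1") (auto simp: al_def be_def)
qed

lemma E_rel2: "b e i * be (Suc e) (i + 2) = be (Suc e) (i + 1) * b (Suc e) (i + 1)"
proof -
  consider "i < -1" | "i = -1" | "i \<ge> int e" | "0 \<le> i" "i < int e" by linarith
  then show ?thesis
  proof cases
    case 3 then show ?thesis
      by (cases "i = int e") (auto simp: be_def)
  next
    case 4
    then have n1: "b (Suc e) i \<noteq> 0" and n2: "b (Suc e) (i + 1) \<noteq> 0" using b_nz by simp_all
    have "(b e i * be (Suc e) (i + 2)) * (b (Suc e) (i+1) * b (Suc e) i)
      = b e i * (be (Suc e) ((i + 1) + 1) * b (Suc e) (i+1)) * b (Suc e) i" by (simp add: algebra_simps)
    also have "\<dots> = b e i * qint s (i + 2) * (al (Suc e) (i + 1) * b (Suc e) i)"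
      unfolding be_step by (simp add: algebra_simps)
    also have "\<dots> = qint s (i + 2) * al (Suc e) i * (b e i * b e i)"
      unfolding al_step by (simp add: algebra_simps)
    also have "\<dots> = (qint s (i + 1) * al (Suc e) i) * (qint s (int e - i) * qint s (i + 2))"
      unfolding b_sq by (simp add: algebra_simps)
    also have "qint s (int e - i) * qint s (i + 2) = b (Suc e) (i+1) * b (Suc e) (i+1)"
      unfolding b_sq by (simp add: algebra_simps)
    also have "qint s (i + 1) * al (Suc e) i = be (Suc e) (i + 1) * b (Suc e) i"
      by (simp add: be_step)
    also have "be (Suc e) (i + 1) * b (Suc e) i * (b (Suc e) (i + 1) * b (Suc e) (i + 1))
       = (be (Suc e) (i + 1) * b (Suc e) (i + 1)) * (b (Suc e) (i+1) * b (Suc e) i)" by (simp add: algebra_simps)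
    finally show ?thesis using n1 n2 by simp
  qed (auto simp: be_def)
qed

lemma E_rel3:
  assumes t: "t = 1 \<or> t = - 1"
  shows "s powi (2 * t * i) * al (Suc e) i + s powi (- (2 * t)) * b e (i - 1) * be (Suc e) i = qint s (i + 1) * al (Suc e) i"
proof -
  have "b e (i - 1) * be (Suc e) i = qint s i * al (Suc e) i"
    using be_al[of e "i - 1"] by simp
  moreover have "qint s (i + 1) = s powi (- (2 * t)) * qint s i + s powi (2 * t * i)"
    using qint_Suc[of "-t" i] t by auto
  ultimately show ?thesis by (simp add: algebra_simps)
qed

text \<open>
  The fusion map embeds spin \<open>(e + 1)/2\<close> into the coproduct of spin 1/2 and spin \<open>e/2\<close>, provided
  the twist has one particular value.
\<close>

lemma Eop_cop:
  assumes g: "g = 1 \<or> g = - 1" and t: "t = 1 \<or> t = - 1"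
  shows "s powi (g * t) * cop g t (s powi (- (g * t * int (Suc e)))) (Suc 0) e (Eop (Suc e) f) p i
     = Eop (Suc e) (\<lambda>n. bs (Suc e) g n * f (n + g)) p i"
proof -
  have k: "kp (Suc 0) t 0 = s powi t" "kp (Suc 0) t 1 = s powi (- t)"
    by (simp_all add: kp_def)
  have q1: "s powi t * (s powi (- (t * int (Suc e))) * kp e (- t) i) = s powi (2 * t * (i - int e))"
    by (simp only: kp_def powi_add[symmetric]) (simp add: algebra_simps)
  have q2: "s powi (- t) * (s powi (t * int (Suc e)) * kp e (- t) i) = s powi (2 * t * i)"
    by (simp only: kp_def powi_add[symmetric]) (simp add: algebra_simps)
  have q3: "s powi t * s powi t = s powi (2 * t)" "s powi t * s powi (- t) = 1" "s powi (- t) * s powi (- t) = s powi (- (2 * t))"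
    by (simp_all only: powi_add[symmetric]) simp_all
  consider "g = 1" "p = 0" | "g = 1" "p = 1" | "g = -1" "p = 0" | "g = -1" "p = 1" | "p \<notin> {0,1}" using g by auto
  then show ?thesis
  proof cases
    case 1
    have "s powi (g * t) * cop g t (s powi (- (g * t * int (Suc e)))) (Suc 0) e (Eop (Suc e) f) p i
      = ((s powi t * (s powi (- (t * int (Suc e))) * kp e (- t) i)) * be (Suc e) (i + 1) + (s powi t * s powi t) * b e i * al (Suc e) (i + 1)) * f (i + 1)"
      using 1 by (simp add: cop_def bs_def Eop_def k algebra_simps)
    then show ?thesis unfolding q1 q3 E_rel1[OF t] using 1 by (simp add: Eop_def bs_def)
  next
    case 2
    have "s powi (g * t) * cop g t (s powi (- (g * t * int (Suc e)))) (Suc 0) e (Eop (Suc e) f) p i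
      = (s powi t * s powi (- t)) * (b e i * be (Suc e) (i + 2)) * f (i + 2)"
      using 2 by (simp add: cop_def bs_def Eop_def k algebra_simps)
    then show ?thesis unfolding q3 E_rel2 using 2 by (simp add: Eop_def bs_def algebra_simps)
  next
    case 3
    have "s powi (g * t) * cop g t (s powi (- (g * t * int (Suc e)))) (Suc 0) e (Eop (Suc e) f) p i
      = (s powi t * s powi (- t)) * (al (Suc e) (i - 1) * b e (i - 1)) * f (i - 1)"
      using 3 by (simp add: cop_def bs_def Eop_def k algebra_simps)
    then show ?thesis unfolding q3 al_step[symmetric] using 3 by (simp add: Eop_def bs_def algebra_simps)
  next
    case 4
    have "s powi (g * t) * cop g t (s powi (- (g * t * int (Suc e)))) (Suc 0) e (Eop (Suc e) f) p i
      = ((s powi (- t) * (s powi (t * int (Suc e)) * kp e (- t) i)) * al (Suc e) i + (s powi (- t) * s powi (- t)) * b e (i - 1) * be (Suc e) i) * f i"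
      using 4 by (simp add: cop_def bs_def Eop_def k algebra_simps)
    then show ?thesis unfolding q2 q3 E_rel3[OF t] be_step[symmetric] using 4 by (simp add: Eop_def bs_def algebra_simps)
  next
    case 5
    have "bs (Suc 0) g p * Eop (Suc e) f (p + g) i = 0"
    proof -
      consider "p + g \<notin> {0, 1}" | "p = - 1" "g = 1" | "p = 2" "g = - 1" using 5 g by force
      then show ?thesis by cases (auto simp: Eop_def bs_def)
    qed
    then have "bs (Suc 0) g p * kp e (- t) i * Eop (Suc e) f (p + g) i = 0" by auto
    with 5 show ?thesis by (simp add: cop_def Eop_def [of _ _ p])
  qed
qed

text \<open>
  A map from \<open>\<complex>\<^sup>2 \<otimes> \<complex>\<^sup>d\<close> to \<open>\<complex>\<^sup>d\<^sup>-\<^sup>1\<close>, a multiple in each component of the projection on spin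
  \<open>d/2 - 1\<close>; on vectors supported in the index range, its kernel is the image of
  \<open>Eop d\<close>.
\<close>

definition Pop :: "nat \<Rightarrow> (int \<Rightarrow> int \<Rightarrow> complex) \<Rightarrow> int \<Rightarrow> complex" where
  "Pop d g i = b (d - 1) i * g 1 i - qint s (i + 1) * g 0 (i + 1)"

text \<open>
  Matrix entries of the ladder operators in the quotient by the image of \<open>E\<close>, in the
  coordinates given by \<open>Pop\<close>.
\<close>

definition cQ :: "nat \<Rightarrow> int \<Rightarrow> int \<Rightarrow> complex" where
  "cQ e g i = (if g = 1 then b e (i + 1) * qint s (i + 1) / qint s (i + 2) else b e i)"

lemma Pop_cop:
  assumes g: "g = 1 \<or> g = - 1" and t: "t = 1 \<or> t = - 1" and i: "0 \<le> i"
  shows "Pop (Suc e) (cop g t (s powi (- (g * t * int (Suc e)))) (Suc 0) e h) i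
     = s powi (g * t) * cQ e g i * Pop (Suc e) h (i + g)"
proof -
  have k: "kp (Suc 0) t 0 = s powi t" "kp (Suc 0) t 1 = s powi (- t)"
    by (simp_all add: kp_def)
  have q3: "s powi t * s powi (- t) = 1"
    by (simp_all only: powi_add[symmetric]) simp_all
  have nz: "qint s (i + 2) \<noteq> 0" using qint_nz i by simp
  show ?thesis
  proof (cases "g = 1")
    case True
    have q1: "s powi (- (t * int (Suc e))) * kp e (- t) (i + 1) = s powi (- t) * s powi (2 * t * (i + 1 - int e))"
      by (simp only: kp_def powi_add[symmetric]) (simp add: algebra_simps)
    have q2: "s powi (- t) * (b e i * b e i) - qint s (i + 1) * (s powi (- t) * s powi (2 * t * (i + 1 - int e)))
      = s powi t * (b e (i + 1) * b e (i + 1)) * qint s (i + 1) / qint s (i + 2)"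
    proof -
      have 1: "qint s (int e - i) = s powi (2 * t) * qint s (int e - (i + 1)) + s powi (2 * t * (i + 1 - int e))"
        using qint_Suc[OF t, of "int e - (i + 1)"] by (simp add: algebra_simps)
      have 2: "s powi (- t) * s powi (2 * t) = s powi t"
        by (simp only: powi_add[symmetric]) simp
      have "s powi (- t) * (b e i * b e i) - qint s (i + 1) * (s powi (- t) * s powi (2 * t * (i + 1 - int e)))
        = qint s (i + 1) * (s powi (- t) * s powi (2 * t)) * qint s (int e - (i + 1))"
        unfolding b_sq 1 by (simp add: algebra_simps)
      also have "\<dots> = s powi t * (b e (i + 1) * b e (i + 1)) * qint s (i + 1) / qint s (i + 2)"
        using nz unfolding b_sq 2 by (simp add: field_simps)
      finally show ?thesis .
    qed
    have "Pop (Suc e) (cop g t (s powi (- (g * t * int (Suc e)))) (Suc 0) e h) i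
      = (s powi (- t) * (b e i * b e i) - qint s (i + 1) * (s powi (- (t * int (Suc e))) * kp e (- t) (i + 1))) * h 1 (i + 1)
         - qint s (i + 1) * s powi t * b e (i + 1) * h 0 (i + 2)"
      using True by (simp add: Pop_def cop_def bs_def k algebra_simps)
    then show ?thesis unfolding q1 q2 using True nz by (simp add: Pop_def cQ_def field_simps)
  next
    case False
    then have gm: "g = -1" using g by simp
    have q1: "s powi (t * int (Suc e)) * kp e (- t) i = s powi t * s powi (2 * t * i)"
      by (simp only: kp_def powi_add[symmetric]) (simp add: algebra_simps)
    have q2: "s powi t * s powi (2 * t * i) - qint s (i + 1) * s powi t = - (s powi (- t) * qint s i)"
      using qint_Suc[of "-t" i] t
        by (auto simp: field_simps powi_double powi_double' power_int_minus)
    have "Pop (Suc e) (cop g t (s powi (- (g * t * int (Suc e)))) (Suc 0) e h) i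
      = (s powi (t * int (Suc e)) * kp e (- t) i - qint s (i + 1) * s powi t) * b e i * h 0 i
         + s powi (- t) * b e i * b e (i - 1) * h 1 (i - 1)"
      using gm by (simp add: Pop_def cop_def bs_def k algebra_simps)
    then show ?thesis unfolding q1 q2 using gm by (simp add: Pop_def cQ_def field_simps)
  qed
qed

text \<open>
  A vector killed by \<open>Pop\<close> has in each weight space the direction of the image of \<open>E\<close>.
\<close>

lemma Pop_zero_proportional:
  assumes P: "\<And>i. 0 \<le> i \<Longrightarrow> i < int e \<Longrightarrow> Pop (Suc e) g i = 0"
    and sp: "\<And>p i. p \<noteq> 0 \<Longrightarrow> p \<noteq> 1 \<Longrightarrow> g p i = 0" "\<And>p i. i < 0 \<or> i > int e \<Longrightarrow> g p i = 0"
  shows "be (Suc e) i * g 0 i = al (Suc e) i * g 1 (i - 1)"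
proof -
  consider "i \<le> 0" | "i > int e" | "1 \<le> i" "i \<le> int e" by linarith
  then show ?thesis
  proof cases
    case 1 then show ?thesis by (auto simp: be_def sp)
  next
    case 2 then show ?thesis by (auto simp: al_def sp)
  next
    case 3
    then have n1: "b (Suc e) (i - 1) \<noteq> 0" using b_nz by simp
    have "b (Suc e) (i - 1) * (be (Suc e) i * g 0 i) = al (Suc e) (i - 1) * (qint s i * g 0 i)"
      using be_step[of "Suc e" "i - 1"] by (simp add: algebra_simps)
    also have "qint s i * g 0 i = b e (i - 1) * g 1 (i - 1)"
      using P[of "i - 1"] 3 by (simp add: Pop_def)
    also have "al (Suc e) (i - 1) * (b e (i - 1) * g 1 (i - 1)) = b (Suc e) (i - 1) * (al (Suc e) i * g 1 (i - 1))"
      using al_step[of e "i - 1"] by (simp add: algebra_simps)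
    finally show ?thesis using n1 by simp
  qed
qed

text \<open>
  The nonzero entries of the left inverse of the fusion map: \<open>f0 d n\<close> and \<open>f1 d n\<close> are those in row
  \<open>n\<close> with spin-1/2 index 0 and 1.
\<close>

definition f0 :: "nat \<Rightarrow> int \<Rightarrow> complex" where
  "f0 d n = (if 0 \<le> n \<and> n < int d then F_entry s d (nat n + 1) (nat n + 1) else 0)"

definition f1 :: "nat \<Rightarrow> int \<Rightarrow> complex" where
  "f1 d n = (if 1 \<le> n \<and> n \<le> int d then F_entry s d (nat n + 1) (nat n + d) else 0)"

lemma E_entry_al: "n < d \<Longrightarrow> E_entry s d (n + 1) (n + 1) = al d (int n)"
proof -
  have "Bcoef s c (int d - 2 * x - 1) = Bcoef s c (int d - 1 - 2 * x)" for c x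
    by (rule arg_cong) simp
  then show "n < d \<Longrightarrow> ?thesis"
    by (auto simp: E_entry_def al_def E_diag_def b_def of_nat_diff intro!: prod.cong)
qed

lemma E_entry_be: "1 \<le> n \<Longrightarrow> n \<le> d \<Longrightarrow> 2 \<le> d \<Longrightarrow> E_entry s d (n + d) (n + 1) = be d (int n)"
  using E_entry_al[of "n - 1" d]
  by (auto simp: E_entry_def be_def b_def of_nat_diff algebra_simps)

lemma f0_f1:
  assumes "2 \<le> d" "0 \<le> n" "n \<le> int d"
  shows "f0 d n * al d n + f1 d n * be d n = 1"
proof -
  obtain m where m: "n = int m" using assms(2) nonneg_int_cases by blast
  consider "m = 0" | "m = d" | "1 \<le> m" "m < d" using assms m by linarith
  then show ?thesis
  proof cases
    case 1 with m assms show ?thesis by (simp add: f0_def f1_def F_entry_def al_def)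
  next
    case 2
    have "E_entry s d (2 * d) (d + 1) = be d (int d)" using E_entry_be[of d d] assms by (simp add: mult_2)
    with 2 m assms be_nz[of n d] show ?thesis
      by (simp add: f0_def f1_def F_entry_def mult_2)
  next
    case 3
    have "E_entry s d (m + 1) (m + 1) = al d n" "E_entry s d (m + d) (m + 1) = be d n"
      using E_entry_al[of m d] E_entry_be[of m d] 3 m assms by simp_all
    then show ?thesis using 3 m assms al_nz[of n d]
      by (simp add: f0_def f1_def F_entry_def)
  qed
qed

text \<open>
  The left inverse \<open>F\<close> of the fusion map.
\<close>

definition Fop :: "nat \<Rightarrow> (int \<Rightarrow> int \<Rightarrow> complex) \<Rightarrow> int \<Rightarrow> complex" where
  "Fop d g n = f0 d n * g 0 n + f1 d n * g 1 (n - 1)"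

lemma Fop_lin: "Fop d (\<lambda>p i. c * f p i + e * g p i) n = c * Fop d f n + e * Fop d g n"
  by (simp add: Fop_def algebra_simps)

lemma Fop_out: "n < 0 \<or> n > int d \<Longrightarrow> Fop d g n = 0"
  by (auto simp: Fop_def f0_def f1_def)

lemma Fop_Eop: "2 \<le> d \<Longrightarrow> 0 \<le> n \<Longrightarrow> n \<le> int d \<Longrightarrow> Fop d (Eop d f) n = f n"
  using arg_cong[OF f0_f1[of d n], of "\<lambda>z. z * f n"] by (simp add: Fop_def Eop_def algebra_simps)

text \<open>
  On the kernel of \<open>Pop\<close>, which is the image of \<open>E\<close>, the map \<open>F\<close> is also a right inverse.
\<close>

lemma Eop_Fop:
  assumes P: "\<And>i. 0 \<le> i \<Longrightarrow> i < int e \<Longrightarrow> Pop (Suc e) g i = 0" and e: "1 \<le> e"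
    and sp: "\<And>p i. p \<noteq> 0 \<Longrightarrow> p \<noteq> 1 \<Longrightarrow> g p i = 0" "\<And>p i. i < 0 \<or> i > int e \<Longrightarrow> g p i = 0"
  shows "Eop (Suc e) (Fop (Suc e) g) p i = g p i"
proof -
  have par: "be (Suc e) i * g 0 i = al (Suc e) i * g 1 (i - 1)" for i
    by (rule Pop_zero_proportional; (fact P sp)?)
  show ?thesis
  proof (cases "i < 0 \<or> i > int e")
    case True
    then show ?thesis using sp(2)[OF True] by (auto simp: Eop_def al_def be_def)
  next
    case False
    have 0: "al (Suc e) i * Fop (Suc e) g i = (f0 (Suc e) i * al (Suc e) i + f1 (Suc e) i * be (Suc e) i) * g 0 i"
      using par[of i] by (simp add: Fop_def algebra_simps)
    have 1: "be (Suc e) (i + 1) * Fop (Suc e) g (i + 1) = (f0 (Suc e) (i+1) * al (Suc e) (i+1) + f1 (Suc e) (i+1) * be (Suc e) (i+1)) * g 1 i"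
      using par[of "i + 1"] by (simp add: Fop_def algebra_simps)
    show ?thesis using 0 1 f0_f1[of "Suc e" i] f0_f1[of "Suc e" "i + 1"] False e sp(1)[of p i]
      by (auto simp: Eop_def)
  qed
qed

end

section \<open>Laurent polynomials and operators on tensor products\<close>

text \<open>
  The function agrees on \<open>\<complex> - {0}\<close> with a Laurent polynomial; its value at 0 is irrelevant.
\<close>

definition laur :: "(complex \<Rightarrow> complex) \<Rightarrow> bool" where
  "laur f \<longleftrightarrow> (\<exists>p (k::nat). \<forall>u. u \<noteq> 0 \<longrightarrow> f u * u ^ k = poly p u)"

lemma laurI: "(\<And>u. u \<noteq> 0 \<Longrightarrow> f u * u ^ k = poly p u) \<Longrightarrow> laur f"
  by (auto simp: laur_def)

lemma laur_const [intro, simp]: "laur (\<lambda>u. c)"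
  by (rule laurI[of _ 0 "[:c:]"]) simp

lemma laur_id [intro, simp]: "laur (\<lambda>u. u)"
  by (rule laurI[of _ 0 "[:0, 1:]"]) simp

lemma laur_inverse [intro, simp]: "laur (\<lambda>u. inverse u)"
  by (rule laurI[of _ 1 "1"]) simp

lemma laur_add [intro]: assumes "laur f" "laur g" shows "laur (\<lambda>u. f u + g u)"
proof -
  from assms obtain p k q l where 1: "\<And>u. u \<noteq> 0 \<Longrightarrow> f u * u ^ k = poly p u" "\<And>u. u \<noteq> 0 \<Longrightarrow> g u * u ^ l = poly q u"
    unfolding laur_def by metis
  show ?thesis
    by (rule laurI[of _ "k + l" "p * monom 1 l + q * monom 1 k"])
      (simp add: 1[symmetric] poly_monom power_add algebra_simps)
qed

lemma laur_mult [intro]: assumes "laur f" "laur g" shows "laur (\<lambda>u. f u * g u)"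
proof -
  from assms obtain p k q l where 1: "\<And>u. u \<noteq> 0 \<Longrightarrow> f u * u ^ k = poly p u" "\<And>u. u \<noteq> 0 \<Longrightarrow> g u * u ^ l = poly q u"
    unfolding laur_def by metis
  show ?thesis
    by (rule laurI[of _ "k + l" "p * q"])
      (simp add: 1[symmetric] power_add algebra_simps)
qed

lemma laur_diff [intro]: assumes "laur f" "laur g" shows "laur (\<lambda>u. f u - g u)"
  using laur_add[OF assms(1) laur_mult[OF laur_const[of "-1"] assms(2)]] by simp

lemma laur_sum [intro]: "(\<And>x. x \<in> I \<Longrightarrow> laur (f x)) \<Longrightarrow> laur (\<lambda>u. \<Sum>x\<in>I. f x u)"
  by (induction I rule: infinite_finite_induct) auto

lemma laur_prod [intro]: "(\<And>x. x \<in> I \<Longrightarrow> laur (f x)) \<Longrightarrow> laur (\<lambda>u. \<Prod>x\<in>I. f x u)"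
  by (induction I rule: infinite_finite_induct) auto

text \<open>
  A Laurent polynomial that vanishes off a finite set vanishes.
\<close>

lemma laur_zero:
  assumes f: "laur f" and S: "finite S" and z: "\<And>u. u \<noteq> 0 \<Longrightarrow> u \<notin> S \<Longrightarrow> f u = 0" and u: "u \<noteq> 0"
  shows "f u = 0"
proof -
  from f obtain p k where 1: "\<And>u. u \<noteq> 0 \<Longrightarrow> f u * u ^ k = poly p u" unfolding laur_def by metis
  have "p = 0"
  proof (rule ccontr)
    assume "p \<noteq> 0"
    then have "finite {u. poly p u = 0}" by (rule poly_roots_finite)
    then have "finite ({u. poly p u = 0} \<union> S \<union> {0})" using S by simp
    moreover have "v \<in> {u. poly p u = 0} \<union> S \<union> {0}" for v
      using 1[of v] z[of v] by (cases "v = 0 \<or> v \<in> S") auto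
    then have "{u. poly p u = 0} \<union> S \<union> {0} = UNIV" by blast
    ultimately have "finite (UNIV :: complex set)" by (simp only:)
    then show False by (simp add: infinite_UNIV_char_0)
  qed
  with 1[OF u] u show ?thesis by simp
qed

text \<open>
  Linearity of an operator on functions of two integer arguments.
\<close>

definition lin2 :: "((int \<Rightarrow> int \<Rightarrow> complex) \<Rightarrow> int \<Rightarrow> int \<Rightarrow> complex) \<Rightarrow> bool" where
  "lin2 T \<longleftrightarrow> (\<forall>c e f g n a. T (\<lambda>n a. c * f n a + e * g n a) n a = c * T f n a + e * T g n a)"

lemma lin2D: "lin2 T \<Longrightarrow> T (\<lambda>n a. c * f n a + e * g n a) n a = c * T f n a + e * T g n a"
  by (simp add: lin2_def)

lemma lin2_scale: "lin2 T \<Longrightarrow> T (\<lambda>n a. c * f n a) n a = c * T f n a"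
  using lin2D[of T c f 0 f] by simp

lemma lin2_0: "lin2 T \<Longrightarrow> T (\<lambda>n a. 0) n a = 0"
  using lin2_scale[of T 0 "\<lambda>n a. 0"] by simp

lemma lin2_sum:
  assumes "lin2 T"
  shows "T (\<lambda>n a. \<Sum>x\<in>I. c x * F x n a) n a = (\<Sum>x\<in>I. c x * T (F x) n a)"
proof (induction I rule: infinite_finite_induct)
  case (insert x I)
  with lin2D[OF assms, of "c x" "F x" 1 "\<lambda>n a. \<Sum>x\<in>I. c x * F x n a"] show ?case by simp
qed (simp_all add: lin2_0[OF assms])

text \<open>
  The operator conserves the total weight: it commutes with multiplication by every function of
  \<open>n + a\<close>.
\<close>

definition weighted :: "((int \<Rightarrow> int \<Rightarrow> complex) \<Rightarrow> int \<Rightarrow> int \<Rightarrow> complex) \<Rightarrow> bool" where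
  "weighted T \<longleftrightarrow> (\<forall>w f n a. T (\<lambda>n a. w (n + a) * f n a) n a = w (n + a) * T f n a)"

text \<open>
  The basis vector with indices \<open>m\<close> and \<open>b\<close>.
\<close>

definition delta2 :: "int \<Rightarrow> int \<Rightarrow> int \<Rightarrow> int \<Rightarrow> complex" where
  "delta2 m b n a = of_bool (n = m \<and> a = b)"

context generic_q begin

section \<open>Fused R-operators\<close>

text \<open>
  The product \<open>R\<^sub>1\<^sub>3(v) T\<^sub>2\<^sub>3 E\<^sub>1\<^sub>2\<close> with the spin-1/2 R-operator \<open>R\<close>: the fused operator before \<open>F\<close> is
  applied.
\<close>

definition Yop where
  "Yop T d2 v d f p i a = Lop d2 v (\<lambda>p a. T (\<lambda>i a. Eop d (\<lambda>m. f m a) p i) i a) p a"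

text \<open>
  The R-matrix for spins \<open>d1/2\<close> and \<open>d2/2\<close> without the scalar factors contributed by the spin-1/2
  R-matrices.
\<close>

fun Rop :: "nat \<Rightarrow> nat \<Rightarrow> complex \<Rightarrow> (int \<Rightarrow> int \<Rightarrow> complex) \<Rightarrow> int \<Rightarrow> int \<Rightarrow> complex" where
  "Rop 0 d2 u = (\<lambda>f. f)"
| "Rop (Suc 0) d2 u = Lop d2 u"
| "Rop (Suc (Suc e)) d2 u = (\<lambda>f n a.
     Fop (Suc (Suc e)) (\<lambda>p i. Yop (Rop (Suc e) d2 (u * s)) d2 (u * s powi (- int (Suc e))) (Suc (Suc e)) f p i a) n)"

lemma lin2_Lop: "lin2 (Lop d u)"
  by (simp add: lin2_def Lop_lin)

lemma Yop_lin:
  assumes "lin2 T"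
  shows "Yop T d2 v d (\<lambda>n a. c * f n a + e * g n a) p i a = c * Yop T d2 v d f p i a + e * Yop T d2 v d g p i a"
  by (simp add: Yop_def Eop_lin lin2D[OF assms] Lop_lin)

lemma Yop_weight:
  assumes "weighted T"
  shows "Yop T d2 v d (\<lambda>n a. w (n + a) * f n a) p i a = w (p + i + a) * Yop T d2 v d f p i a"
proof -
  have 1: "Eop d (\<lambda>m. w (m + a) * f m a) p i = w (p + (i + a)) * Eop d (\<lambda>m. f m a) p i" for p i a
    using Eop_weight[of d "\<lambda>m. w (m + a)"] by (simp add: add.assoc)
  have 2: "T (\<lambda>i a. w (p + (i + a)) * h i a) i a = w (p + (i + a)) * T h i a" for h p i a
    using assms[unfolded weighted_def, rule_format, of "\<lambda>k. w (p + k)"] .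
  have 3: "Lop d2 v (\<lambda>p a. w (p + (i + a)) * h p a) p a = w (p + i + a) * Lop d2 v h p a" for h i p a
    using Lop_weight[of d2 v "\<lambda>k. w (i + k)" h p a] by (simp add: add_ac)
  show ?thesis unfolding Yop_def 1 2 3 ..
qed

lemma lin2_Rop: "lin2 (Rop (Suc e) d2 u)"
proof (induction e arbitrary: u)
  case 0 then show ?case by (simp add: lin2_Lop)
next
  case (Suc e)
  show ?case unfolding lin2_def by (simp add: Yop_lin[OF Suc] Fop_lin)
qed

lemma weighted_Rop: "weighted (Rop (Suc e) d2 u)"
proof (induction e arbitrary: u)
  case 0 then show ?case by (simp add: weighted_def Lop_weight)
next
  case (Suc e)
  show ?case unfolding weighted_def
    by (simp add: Yop_weight[OF Suc] Fop_def) (simp add: algebra_simps)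
qed

lemma Lop_out: "\<not> (0 \<le> a \<and> a \<le> int d) \<Longrightarrow> Lop d u f p a = 0" "p \<noteq> 0 \<Longrightarrow> p \<noteq> 1 \<Longrightarrow> Lop d u f p a = 0"
  by (auto simp: Lop_def Lraw_def inr_def)

lemma Rop_out:
  assumes "\<not> (0 \<le> a \<and> a \<le> int d2) \<or> \<not> (0 \<le> n \<and> n \<le> int (Suc e))"
  shows "Rop (Suc e) d2 u f n a = 0"
proof (cases e)
  case 0
  with assms have "\<not> (0 \<le> a \<and> a \<le> int d2) \<or> (n \<noteq> 0 \<and> n \<noteq> 1)" by auto
  then have "Lop d2 u f n a = 0" by (auto simp: Lop_def Lraw_def inr_def)
  with 0 show ?thesis by simp
next
  case (Suc k)
  show ?thesis
  proof (cases "0 \<le> a \<and> a \<le> int d2")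
    case True
    with assms have "n < 0 \<or> n > int (Suc e)" by auto
    then show ?thesis unfolding Suc Rop.simps by (intro Fop_out) (simp add: Suc)
  next
    case False
    then have "Lop d2 v h p a = 0" for v h p by (simp add: Lop_def inr_def)
    then show ?thesis unfolding Suc by (simp add: Yop_def Fop_def)
  qed
qed

lemma Lop_in: "Lop d u (\<lambda>p a. inr (Suc 0) p * inr d a * f p a) p a = Lop d u f p a"
proof -
  have "b d (a - 1) = 0" if "a = 0" using that by simp
  moreover have "b d a = 0" if "a = int d" using that by simp
  ultimately show ?thesis by (cases "a = 0"; cases "a = int d") (auto simp: Lop_def Lraw_def inr_def)
qed

lemma Eop_in: "Eop d (\<lambda>m. inr d m * f m) p i = Eop d f p i"
  by (auto simp: Eop_def inr_def al_def be_def)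

text \<open>
  The operator depends only on the values of its argument inside the index range.
\<close>

lemma Rop_in: "Rop (Suc e) d2 u (\<lambda>p a. inr (Suc e) p * inr d2 a * f p a) n a = Rop (Suc e) d2 u f n a"
proof (induction e arbitrary: u f n a)
  case 0 then show ?case by (simp add: Lop_in)
next
  case (Suc k)
  define e where "e = Suc k"
  have 1: "Eop (Suc e) (\<lambda>m. inr (Suc e) m * inr d2 a * f m a) p i = inr d2 a * Eop (Suc e) (\<lambda>m. f m a) p i" for p i a
    using Eop_lin[of "Suc e" "inr d2 a" "\<lambda>m. inr (Suc e) m * f m a" 0 "\<lambda>m. 0"] Eop_in[of "Suc e" "\<lambda>m. f m a"]
    by (simp add: algebra_simps)
  have 2: "Rop (Suc k) d2 v (\<lambda>i a. inr d2 a * h i a) = Rop (Suc k) d2 v h" for v h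
  proof (intro ext)
    fix i a
    have idem: "inr d2 a * (inr d2 a * z) = inr d2 a * z" for a z by (simp add: inr_def)
    show "Rop (Suc k) d2 v (\<lambda>i a. inr d2 a * h i a) i a = Rop (Suc k) d2 v h i a"
      unfolding Suc[of v "\<lambda>i a. inr d2 a * h i a", symmetric] Suc[of v h, symmetric] by (simp only: mult.assoc idem)
  qed
  show ?case using 1 unfolding e_def by (simp add: Yop_def 2)
qed

lemma Rop_in2: "Rop (Suc e) d2 v (\<lambda>i a. inr d2 a * h i a) = Rop (Suc e) d2 v h"
proof (intro ext)
  fix i a
  have idem: "inr d2 a * (inr d2 a * z) = inr d2 a * z" for a z by (simp add: inr_def)
  show "Rop (Suc e) d2 v (\<lambda>i a. inr d2 a * h i a) i a = Rop (Suc e) d2 v h i a"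
    unfolding Rop_in[of e d2 v "\<lambda>i a. inr d2 a * h i a", symmetric] Rop_in[of e d2 v h, symmetric] by (simp only: mult.assoc idem)
qed

lemma laur_Lop:
  assumes "\<And>n a. laur (\<lambda>u. g u n a)" "c \<noteq> 0"
  shows "laur (\<lambda>u. Lop d (c * u) (g u) p a)"
proof -
  have "laur (\<lambda>u. inverse (c * u * s * k))" for k
    using laur_mult[OF laur_inverse laur_const[of "inverse (c * s * k)"]] by (simp add: algebra_simps)
  then have 1: "laur (\<lambda>u. c * u * s * k - inverse (c * u * s * k))" for k
    by (intro laur_diff laur_mult laur_const laur_id)
  show ?thesis
    by (cases "p = 0"; cases "p = 1")
      (auto simp: Lop_def Lraw_def intro!: laur_mult laur_add 1 assms(1))
qed

lemma laur_Rop: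
  assumes "\<And>n a. laur (\<lambda>u. g u n a)" "c \<noteq> 0"
  shows "laur (\<lambda>u. Rop (Suc e) d2 (c * u) (g u) n a)"
  using assms
proof (induction e arbitrary: g c n a)
  case 0
  then show ?case by (simp add: laur_Lop)
next
  case (Suc e)
  have E: "laur (\<lambda>u. Eop (Suc (Suc e)) (\<lambda>m. g u m a) p i)" for p i a
    by (cases "p = 0"; cases "p = 1") (auto simp: Eop_def intro!: laur_mult Suc.prems)
  have T: "laur (\<lambda>u. Rop (Suc e) d2 (c * s * u) (\<lambda>i a. Eop (Suc (Suc e)) (\<lambda>m. g u m a) p i) i a)" for p i a
    by (rule Suc.IH) (use E Suc.prems in auto)
  have Y: "laur (\<lambda>u. Lop d2 (c * s powi (- int (Suc e)) * u) (\<lambda>p a. Rop (Suc e) d2 (c * s * u) (\<lambda>i a. Eop (Suc (Suc e)) (\<lambda>m. g u m a) p i) i a) p a)" for p i a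
    by (rule laur_Lop) (use T Suc.prems in auto)
  have eq: "c * u * s = c * s * u" "c * u * s powi k = c * s powi k * u" for u k by simp_all
  show ?case unfolding Rop.simps Yop_def Fop_def eq
    by (intro laur_add laur_mult laur_const Y)
qed

lemma Pop_lin: "Pop d (\<lambda>p i. c * f p i + e * g p i) i = c * Pop d f i + e * Pop d g i"
  by (simp add: Pop_def algebra_simps)

lemma Pop_weight: "Pop d (\<lambda>p i. w (p + i) * f p i) i = w (i + 1) * Pop d f i"
  by (simp add: Pop_def algebra_simps)

lemma kp_Suc: "kp (Suc 0) t p * kp e t i = kp (Suc e) t (p + i)"
  by (simp only: kp_def powi_add[symmetric]) (simp add: algebra_simps)

lemma powi_mult: "(u * s powi k) powi m = u powi m * s powi (k * m)"
  by (simp add: power_int_mult_distrib power_int_mult)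

text \<open>
  How \<open>Y\<close> exchanges the coproduct.  On the right, the bracket \<open>cop g t \<dots>\<close> in the first two tensor
  factors has exactly the twist for which \<open>Eop\<close> and \<open>Pop\<close> are intertwiners.
\<close>

lemma Yop_cop:
  assumes T: "lin2 T" "weighted T"
    and Tc: "\<And>f. T (cop g t ((u * s) powi (g * t)) e d2 f) = cop g (- t) ((u * s) powi (g * t)) e d2 (T f)"
    and u: "u \<noteq> 0" and g: "g = 1 \<or> g = - 1" and t: "t = 1 \<or> t = - 1"
  defines "Y \<equiv> Yop T d2 (u * s powi (- int e)) (Suc e)"
  shows "Y (cop g t (u powi (g * t)) (Suc e) d2 f) p i a
    = (u powi (g * t) * s powi (g * t) * kp d2 t a)
        * cop g t (s powi (- (g * t * int (Suc e)))) (Suc 0) e (\<lambda>p i. Y f p i a) p i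
      + kp (Suc e) (- t) (p + i) * bs d2 g a * Y f p i (a + g)"
proof -
  let ?x = "u powi (g * t)"
  let ?E = "\<lambda>f p i a. Eop (Suc e) (\<lambda>m. f m a) p i"
  let ?Z = "\<lambda>f p i a. T (\<lambda>i a. ?E f p i a) i a"
  define z where "z = s powi (- (g * t * int (Suc e)))"
  have us: "(u * s) powi (g * t) = ?x * s powi (g * t)"
    by (simp add: power_int_mult_distrib)
  have us1: "(u * s powi (- int e)) powi (g * t) = ?x * s powi (g * t) * z"
    by (simp only: powi_mult z_def mult.assoc powi_add[symmetric]) (simp add: algebra_simps)
  \<comment> \<open>The coproduct is moved successively through the fusion map, through \<open>T\<close>, and through the spin-1/2 operator.\<close>
  have E: "?E (cop g t ?x (Suc e) d2 f) p i a
     = (?x * s powi (g * t) * z * bs (Suc 0) g p) * (kp e (-t) i * kp d2 (-t) a * ?E f (p + g) i a)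
      + kp (Suc 0) t p * cop g t ((u * s) powi (g * t)) e d2 (\<lambda>i a. ?E f p i a) i a" for p i a
  proof -
    have "?E (cop g t ?x (Suc e) d2 f) p i a
       = (?x * kp d2 (-t) a) * Eop (Suc e) (\<lambda>m. bs (Suc e) g m * f (m + g) a) p i
         + bs d2 g a * Eop (Suc e) (\<lambda>m. kp (Suc e) t m * f m (a + g)) p i"
      by (simp add: cop_def Eop_def algebra_simps)
    also have "Eop (Suc e) (\<lambda>m. bs (Suc e) g m * f (m + g) a) p i =
       s powi (g * t) * cop g t z (Suc 0) e (\<lambda>p i. ?E f p i a) p i"
      unfolding z_def by (rule Eop_cop[OF g t, symmetric])
    also have "Eop (Suc e) (\<lambda>m. kp (Suc e) t m * f m (a + g)) p i = kp (Suc 0) t p * kp e t i * ?E f p i (a + g)"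
      unfolding Eop_weight kp_Suc ..
    finally show ?thesis unfolding us by (simp add: cop_def algebra_simps)
  qed
  have W: "T (\<lambda>i a. kp e (-t) i * kp d2 (-t) a * h i a) i a = kp e (-t) i * kp d2 (-t) a * T h i a" for h i a
  proof -
    have "kp e (-t) i * kp d2 (-t) a = s powi (- t * (int e + int d2 - 2 * (i + a)))" for i a
      by (simp only: kp_def powi_add[symmetric]) (simp add: algebra_simps)
    then show ?thesis using T(2)[unfolded weighted_def, rule_format, of "\<lambda>k. s powi (- t * (int e + int d2 - 2 * k))"] by simp
  qed
  have WL: "Lop d2 v (\<lambda>p a. kp (Suc 0) t p * kp d2 t a * h p a) p a = kp (Suc 0) t p * kp d2 t a * Lop d2 v h p a" for h v p a
  proof -
    have "kp (Suc 0) t p * kp d2 t a = s powi (t * (1 + int d2 - 2 * (p + a)))" for p a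
      by (simp only: kp_def powi_add[symmetric]) (simp add: algebra_simps)
    then show ?thesis using Lop_weight[of d2 v "\<lambda>k. s powi (t * (1 + int d2 - 2 * k))"] by simp
  qed
  have Z: "?Z (cop g t ?x (Suc e) d2 f) p i a
     = kp e (-t) i * cop g t ((u * s powi (- int e)) powi (g * t)) (Suc 0) d2 (\<lambda>p a. ?Z f p i a) p a
     + ((u * s) powi (g * t) * bs e g i) * (kp (Suc 0) t p * kp d2 t a * ?Z f p (i + g) a)" for p i a
    unfolding E lin2D[OF T(1)] W Tc us1 by (simp add: cop_def algebra_simps)
  have L: "Lop d2 v (\<lambda>p a. c * f p a + c' * h p a) p a = c * Lop d2 v f p a + c' * Lop d2 v h p a" for v c c' f h p a
    by (rule Lop_lin)
  have uz: "u * s powi (- int e) \<noteq> 0" using u by simp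
  have k2: "kp (Suc e) (- t) (p + i) = kp (Suc 0) (- t) p * kp e (- t) i" by (simp add: kp_Suc)
  show ?thesis
    unfolding Y_def Yop_def Z L WL
    unfolding Lop_intertwines[OF uz g t]
    unfolding us1 us z_def[symmetric] k2
    by (simp add: cop_def algebra_simps)
qed

lemma Pop_bot: "Pop (Suc e) g (- 1) = 0"
  by (simp add: Pop_def)

text \<open>
  The obstruction \<open>P Y\<close> to \<open>Y\<close> having values in the image of \<open>E\<close>.
\<close>

definition Mop where "Mop T d2 v d f i a = Pop d (\<lambda>p i. Yop T d2 v d f p i a) i"

text \<open>
  The kernel of \<open>Mop\<close> is stable under the coproducts of ladder operators.
\<close>

lemma Mop_cop_zero:
  assumes T: "lin2 T" "weighted T"
    and Tc: "\<And>f. T (cop g t ((u * s) powi (g * t)) e d2 f) = cop g (- t) ((u * s) powi (g * t)) e d2 (T f)"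
    and u: "u \<noteq> 0" and g: "g = 1 \<or> g = - 1" and t: "t = 1 \<or> t = - 1"
  defines "M \<equiv> Mop T d2 (u * s powi (- int e)) (Suc e)"
  assumes z: "\<And>i a. 0 \<le> i \<Longrightarrow> i < int e \<Longrightarrow> M f i a = 0" and i: "0 \<le> i" "i < int e"
  shows "M (cop g t (u powi (g * t)) (Suc e) d2 f) i a = 0"
proof -
  let ?Y = "Yop T d2 (u * s powi (- int e)) (Suc e)"
  let ?z = "s powi (- (g * t * int (Suc e)))"
  have "cQ e g i * M f (i + g) a = 0"
  proof (cases "0 \<le> i + g \<and> i + g < int e")
    case False
    then consider "i = 0" "g = -1" | "i = int e - 1" "g = 1" using g i by linarith
    then show ?thesis by cases (simp_all add: M_def Mop_def Pop_bot cQ_def)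
  qed (use z in auto)
  then have 1: "Pop (Suc e) (cop g t ?z (Suc 0) e (\<lambda>p i. ?Y f p i a)) i = 0"
    unfolding Pop_cop[OF g t i(1)] by (auto simp: M_def Mop_def)
  have 2: "Pop (Suc e) (\<lambda>p i. kp (Suc e) (- t) (p + i) * (bs d2 g a * ?Y f p i (a + g))) i = 0"
    unfolding Pop_weight[of "Suc e" "kp (Suc e) (- t)"] using z[OF i, of "a + g"] Pop_lin[of "Suc e" "bs d2 g a" "\<lambda>p i. ?Y f p i (a + g)" 0 "\<lambda>p i. 0"]
    by (simp add: M_def Mop_def)
  show ?thesis
    using 1 2 unfolding M_def Mop_def Yop_cop[OF T Tc u g t] mult.assoc[of _ "bs d2 g a"]
    using Pop_lin[of "Suc e" "u powi (g * t) * s powi (g * t) * kp d2 t a" "cop g t ?z (Suc 0) e (\<lambda>p i. ?Y f p i a)" 1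
       "\<lambda>p i. kp (Suc e) (- t) (p + i) * (bs d2 g a * ?Y f p i (a + g))" i]
    by simp
qed

lemma Mop_lin:
  assumes "lin2 T"
  shows "Mop T d2 v d (\<lambda>n a. c * f n a + e * g n a) i a = c * Mop T d2 v d f i a + e * Mop T d2 v d g i a"
  by (simp add: Mop_def Yop_lin[OF assms] Pop_lin)

lemma Mop_weight:
  assumes "weighted T"
  shows "Mop T d2 v d (\<lambda>n a. w (n + a) * f n a) i a = w (i + 1 + a) * Mop T d2 v d f i a"
  using Pop_weight[of d "\<lambda>k. w (k + a)" "\<lambda>p i. Yop T d2 v d f p i a" i]
  unfolding Mop_def Yop_weight[OF assms] by (simp add: add.assoc)

text \<open>
  The product of highest weight vectors has weight 0, while the weights \<open>i + 1 + a\<close> in the target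
  are positive.
\<close>

lemma Mop_delta_00:
  assumes "weighted T" "0 \<le> i"
  shows "Mop T d2 v d (delta2 0 0) i a = 0"
proof (cases "0 \<le> a")
  case True
  have "delta2 0 0 = (\<lambda>n a. of_bool (n + a = 0) * delta2 0 0 n a)" by (auto simp: delta2_def fun_eq_iff)
  then have "Mop T d2 v d (delta2 0 0) i a = of_bool (i + 1 + a = 0) * Mop T d2 v d (delta2 0 0) i a"
    using Mop_weight[OF assms(1), of d2 v d "\<lambda>k. of_bool (k = 0)" "delta2 0 0" i a] by simp
  then show ?thesis using True assms(2) by simp
next
  case False
  then show ?thesis by (simp add: Mop_def Pop_def Yop_def Lop_out)
qed

lemma cop_delta:
  "cop (- 1) t x d d2 (delta2 m c) = (\<lambda>n a. (x * b d m * kp d2 (- t) c) * delta2 (m + 1) c n a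
      + (kp d t m * b d2 c) * delta2 m (c + 1) n a)"
  by (auto simp: cop_def bs_def delta2_def fun_eq_iff)

text \<open>
  Lowering a basis vector by the coproduct with \<open>t = 1\<close> and with \<open>t = - 1\<close> gives two linear relations
  for its two neighbours.  They are independent for all but finitely many \<open>u\<close>, so both neighbours
  are killed.
\<close>

lemma Mop_delta_step:
  fixes M :: "complex \<Rightarrow> int \<Rightarrow> int \<Rightarrow> int \<Rightarrow> int \<Rightarrow> complex"
  assumes lau: "\<And>m c i a. laur (\<lambda>u. M u m c i a)"
    and rel: "\<And>u t i a. u \<noteq> 0 \<Longrightarrow> t = 1 \<or> t = -1 \<Longrightarrow> 0 \<le> i \<Longrightarrow> i < int e \<Longrightarrow>
      (u powi (- t) * b d m * kp d2 (- t) c) * M u (m + 1) c i a + (kp d t m * b d2 c) * M u m (c + 1) i a = 0"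
    and i: "0 \<le> i" "i < int e" and u: "u \<noteq> 0"
  shows "b d m \<noteq> 0 \<Longrightarrow> M u (m + 1) c i a = 0" and "b d2 c \<noteq> 0 \<Longrightarrow> M u m (c + 1) i a = 0"
proof -
  define z where "z = kp d 1 m * kp d2 1 c"
  have k: "kp d' (-1) n = inverse (kp d' 1 n)" "kp d' 1 n \<noteq> 0" for d' n
    by (simp_all add: kp_def power_int_minus[symmetric])
  have z: "z \<noteq> 0" using k by (simp add: z_def)
  have key: "b d m * M u (m + 1) c i a = 0" if "u \<noteq> 0" for u
  proof (rule laur_zero[of "\<lambda>u. b d m * M u (m + 1) c i a" "{inverse z, - inverse z}"])
    show "laur (\<lambda>u. b d m * M u (m + 1) c i a)" by (intro laur_mult laur_const lau)
    fix v :: complex assume v: "v \<noteq> 0" "v \<notin> {inverse z, - inverse z}"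
    let ?A = "b d m * M v (m + 1) c i a" and ?B = "b d2 c * M v m (c + 1) i a"
    have 1: "?A / (v * z) + ?B = 0"
      using rel[of v 1 i a, OF v(1) _ i] z v(1) k by (simp add: field_simps z_def)
    have 2: "?A * (v * z) + ?B = 0"
      using rel[of v "-1" i a, OF v(1) _ i] z v(1) k by (simp add: field_simps z_def)
    have 3: "?A + (v * z) * ?B = 0" using 1 z v(1) by (simp add: field_simps)
    have "?A * ((v * z)\<^sup>2 - 1) = (v * z) * (?A * (v * z) + ?B) - (?A + (v * z) * ?B)"
      by (simp add: algebra_simps power2_eq_square)
    then have "?A * ((v * z)\<^sup>2 - 1) = 0" unfolding 2 3 by simp
    moreover have "(v * z)\<^sup>2 \<noteq> 1"
    proof
      assume "(v * z)\<^sup>2 = 1"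
      then have "v * z = 1 \<or> v * z = -1" by (simp add: power2_eq_1_iff)
      then show False using v z by (auto simp: field_simps eq_neg_iff_add_eq_0)
    qed
    ultimately show "?A = 0" by simp
  qed (use that in auto)
  then show 1: "b d m \<noteq> 0 \<Longrightarrow> M u (m + 1) c i a = 0" using u by simp
  have "(inverse u * kp d2 (-1) c) * (b d m * M u (m + 1) c i a) + kp d 1 m * (b d2 c * M u m (c + 1) i a) = 0"
    using rel[of u 1 i a] i u by (simp add: algebra_simps)
  then have "kp d 1 m * (b d2 c * M u m (c + 1) i a) = 0"
    unfolding key[OF u] by simp
  then show "b d2 c \<noteq> 0 \<Longrightarrow> M u m (c + 1) i a = 0" using k by simp
qed

end

lemma delta2_expand:
  assumes "finite A" "finite B"
  shows "(\<Sum>x\<in>A \<times> B. f (fst x) (snd x) * delta2 (fst x) (snd x) n a) = of_bool (n \<in> A \<and> a \<in> B) * f n a"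
proof -
  have "(\<Sum>x\<in>A \<times> B. f (fst x) (snd x) * delta2 (fst x) (snd x) n a)
    = (\<Sum>x\<in>A \<times> B. if x = (n, a) then f n a else 0)"
    by (intro sum.cong refl) (auto simp: delta2_def)
  then show ?thesis using assms by (simp add: sum.delta)
qed

context generic_q begin

lemma inr_mem: "inr d n * inr d2 a = of_bool (n \<in> {0..int d} \<and> a \<in> {0..int d2})"
  by (auto simp: inr_def)

lemma lin2_Mop: "lin2 T \<Longrightarrow> lin2 (Mop T d2 v d)"
  by (simp add: lin2_def Mop_lin[unfolded lin2_def])

lemma Mop_in:
  "Mop (Rop (Suc e) d2 u) d2 v d (\<lambda>n a. inr d n * inr d2 a * f n a) = Mop (Rop (Suc e) d2 u) d2 v d f"
proof -
  have 1: "Eop d (\<lambda>m. inr d m * inr d2 a * f m a) p i = inr d2 a * Eop d (\<lambda>m. f m a) p i" for p i a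
    using Eop_lin[of d "inr d2 a" "\<lambda>m. inr d m * f m a" 0 "\<lambda>m. 0"] Eop_in[of d "\<lambda>m. f m a"]
    by (simp add: algebra_simps)
  show ?thesis unfolding Mop_def Yop_def 1 Rop_in2 ..
qed

text \<open>
  The values of \<open>Y\<close> lie in the image of \<open>E\<close>.
\<close>

lemma Mop_Rop_zero:
  fixes e d2 :: nat
  defines "M \<equiv> \<lambda>u. Mop (Rop (Suc e) d2 (u * s)) d2 (u * s powi (- int (Suc e))) (Suc (Suc e))"
  assumes IH: "\<And>u g t f. u \<noteq> 0 \<Longrightarrow> g = 1 \<or> g = - 1 \<Longrightarrow> t = 1 \<or> t = - 1 \<Longrightarrow>
     Rop (Suc e) d2 u (cop g t (u powi (g * t)) (Suc e) d2 f) = cop g (- t) (u powi (g * t)) (Suc e) d2 (Rop (Suc e) d2 u f)"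
    and i: "0 \<le> i" "i \<le> int e"
  shows "u \<noteq> 0 \<Longrightarrow> M u f i a = 0"
proof -
  have lau: "laur (\<lambda>u. M u (delta2 m c) i a)" for m c i a
  proof -
    have eq: "u * s powi k = s powi k * u" "u * s = s * u" for u k by simp_all
    show ?thesis unfolding M_def Mop_def Pop_def Yop_def eq
      by (intro laur_diff laur_mult laur_const laur_Lop laur_Rop) auto
  qed
  have IH': "Rop (Suc e) d2 (u * s) (cop g t ((u * s) powi (g * t)) (Suc e) d2 f) = cop g (- t) ((u * s) powi (g * t)) (Suc e) d2 (Rop (Suc e) d2 (u * s) f)"
    if "u \<noteq> 0" "g = 1 \<or> g = - 1" "t = 1 \<or> t = - 1" for u g t f
    using IH[of "u * s" g t] that by simp
  \<comment> \<open>Induction on the total weight \<open>m + c\<close>: a basis vector is reached by lowering one with smaller weight.\<close>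
  have D: "M u (delta2 m c) i a = 0"
    if "nat (m + c) = k" "0 \<le> m" "m \<le> int (Suc (Suc e))" "0 \<le> c" "c \<le> int d2" "u \<noteq> 0" "0 \<le> i" "i < int (Suc e)" for k m c u i a
    using that
  proof (induction k arbitrary: m c u i a)
    case 0
    then have "m = 0" "c = 0" by simp_all
    with 0 show ?case by (simp add: M_def Mop_delta_00 weighted_Rop)
  next
    case (Suc k)
    have rel: "(u powi (- t) * b (Suc (Suc e)) m' * kp d2 (- t) c') * M u (delta2 (m' + 1) c') i a
        + (kp (Suc (Suc e)) t m' * b d2 c') * M u (delta2 m' (c' + 1)) i a = 0"
      if "nat (m' + c') = k" "0 \<le> m'" "m' \<le> int (Suc (Suc e))" "0 \<le> c'" "c' \<le> int d2"
        "u \<noteq> 0" "t = 1 \<or> t = -1" "0 \<le> i" "i < int (Suc e)" for u t i a m' c'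
    proof -
      have "M u (cop (-1) t (u powi (-1 * t)) (Suc (Suc e)) d2 (delta2 m' c')) i a = 0"
        unfolding M_def
        by (rule Mop_cop_zero[OF lin2_Rop weighted_Rop IH' \<open>u \<noteq> 0\<close>])
          (use that Suc.IH[unfolded M_def] in auto)
      then show ?thesis unfolding cop_delta unfolding M_def Mop_lin[OF lin2_Rop] by simp
    qed
    show ?case
    proof (cases "m = 0")
      case False
      have nz: "b (Suc (Suc e)) (m - 1) \<noteq> 0" using b_nz False Suc.prems by auto
      have r: "(u powi (- t) * b (Suc (Suc e)) (m - 1) * kp d2 (- t) c) * M u (delta2 (m - 1 + 1) c) i a
          + (kp (Suc (Suc e)) t (m - 1) * b d2 c) * M u (delta2 (m - 1) (c + 1)) i a = 0"
        if "u \<noteq> 0" "t = 1 \<or> t = -1" "0 \<le> i" "i < int (Suc e)" for u t i a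
        by (rule rel) (use that False Suc.prems in auto)
      have "M u (delta2 (m - 1 + 1) c) i a = 0"
        by (rule Mop_delta_step(1)[where M = "\<lambda>u m c. M u (delta2 m c)", OF lau r Suc.prems(7,8,6) nz])
      then show ?thesis by simp
    next
      case True
      have nz: "b d2 (c - 1) \<noteq> 0" using b_nz True Suc.prems by auto
      have r: "(u powi (- t) * b (Suc (Suc e)) m * kp d2 (- t) (c - 1)) * M u (delta2 (m + 1) (c - 1)) i a
          + (kp (Suc (Suc e)) t m * b d2 (c - 1)) * M u (delta2 m (c - 1 + 1)) i a = 0"
        if "u \<noteq> 0" "t = 1 \<or> t = -1" "0 \<le> i" "i < int (Suc e)" for u t i a
        by (rule rel) (use that True Suc.prems in auto)
      have "M u (delta2 m (c - 1 + 1)) i a = 0"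
        by (rule Mop_delta_step(2)[where M = "\<lambda>u m c. M u (delta2 m c)", OF lau r Suc.prems(7,8,6) nz])
      then show ?thesis by simp
    qed
  qed
  assume u: "u \<noteq> 0"
  let ?A = "{0..int (Suc (Suc e))}" and ?B = "{0..int d2}"
  have "M u f i a = M u (\<lambda>n a. \<Sum>x\<in>?A \<times> ?B. f (fst x) (snd x) * delta2 (fst x) (snd x) n a) i a"
    unfolding delta2_expand[OF finite_atLeastAtMost_int finite_atLeastAtMost_int] inr_mem[symmetric]
    unfolding M_def Mop_in ..
  also have "\<dots> = (\<Sum>x\<in>?A \<times> ?B. f (fst x) (snd x) * M u (delta2 (fst x) (snd x)) i a)"
    unfolding M_def by (rule lin2_sum[OF lin2_Mop[OF lin2_Rop]])
  also have "\<dots> = 0"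
    by (rule sum.neutral) (use D u i in auto)
  finally show "M u f i a = 0" .
qed

text \<open>
  The R-operator exchanges the coproduct and the opposite coproduct of the ladder operators.
\<close>

lemma Rop_intertwines:
  assumes "u \<noteq> 0" "g = 1 \<or> g = - 1" "t = 1 \<or> t = - 1"
  shows "Rop (Suc e) d2 u (cop g t (u powi (g * t)) (Suc e) d2 f) = cop g (- t) (u powi (g * t)) (Suc e) d2 (Rop (Suc e) d2 u f)"
  using assms
proof (induction e arbitrary: u g t f)
  case 0 then show ?case by (simp add: Lop_intertwines)
next
  case (Suc e)
  note u = Suc.prems(1) and g = Suc.prems(2) and t = Suc.prems(3)
  let ?d = "Suc (Suc e)"
  define Y where "Y = Yop (Rop (Suc e) d2 (u * s)) d2 (u * s powi (- int (Suc e))) ?d"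
  have R: "Rop ?d d2 u h n a = Fop ?d (\<lambda>p i. Y h p i a) n" for h n a
    by (simp add: Y_def)
  have IH': "Rop (Suc e) d2 (u * s) (cop g t ((u * s) powi (g * t)) (Suc e) d2 f) = cop g (- t) ((u * s) powi (g * t)) (Suc e) d2 (Rop (Suc e) d2 (u * s) f)" for f
    using Suc.IH[of "u * s" g t] Suc.prems by simp
  \<comment> \<open>As the values of \<open>Y\<close> lie in the image of \<open>E\<close>, the outer \<open>F\<close> in the recursion can be undone.\<close>
  have YE: "Y h p i a = Eop ?d (\<lambda>n. Rop ?d d2 u h n a) p i" for h p i a
    unfolding R
  proof (rule Eop_Fop[symmetric])
    show "Pop ?d (\<lambda>p i. Y h p i a) i = 0" if "0 \<le> i" "i < int (Suc e)" for i
      using Mop_Rop_zero[OF Suc.IH, of i u h a] that u by (simp add: Mop_def Y_def)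
    show "Y h p i a = 0" if "p \<noteq> 0" "p \<noteq> 1" for p i
      using that by (simp add: Y_def Yop_def Lop_out)
    show "Y h p i a = 0" if "i < 0 \<or> i > int (Suc e)" for p i
    proof -
      have "Rop (Suc e) d2 (u * s) k i a = 0" for k a using that by (intro Rop_out) auto
      then show ?thesis by (simp add: Y_def Yop_def Lop_def Lraw_def)
    qed
  qed simp
  show ?case
  proof (intro ext)
    fix n a
    let ?h = "\<lambda>n. cop g (- t) (u powi (g * t)) ?d d2 (Rop ?d d2 u f) n a"
    have "Y (cop g t (u powi (g * t)) ?d d2 f) p i a = Eop ?d ?h p i" for p i
    proof -
      have "Y (cop g t (u powi (g * t)) ?d d2 f) p i a
        = (u powi (g * t) * kp d2 t a) * (s powi (g * t) * cop g t (s powi (- (g * t * int ?d))) (Suc 0) (Suc e) (\<lambda>p i. Y f p i a) p i)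
          + kp ?d (- t) (p + i) * (bs d2 g a * Y f p i (a + g))"
        unfolding Y_def Yop_cop[OF lin2_Rop weighted_Rop IH' u g t] by simp
      also have "\<dots> = (u powi (g * t) * kp d2 t a) * Eop ?d (\<lambda>n. bs ?d g n * Rop ?d d2 u f (n + g) a) p i
          + kp ?d (- t) (p + i) * (bs d2 g a * Eop ?d (\<lambda>n. Rop ?d d2 u f n (a + g)) p i)"
        unfolding YE Eop_cop[OF g t] ..
      also have "\<dots> = Eop ?d ?h p i"
        by (simp add: cop_def Eop_def algebra_simps)
      finally show ?thesis .
    qed
    then have 1: "Rop ?d d2 u (cop g t (u powi (g * t)) ?d d2 f) n a = Fop ?d (Eop ?d ?h) n"
      unfolding R by (simp only:)
    show "Rop ?d d2 u (cop g t (u powi (g * t)) ?d d2 f) n a = ?h n"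
    proof (cases "0 \<le> n \<and> n \<le> int ?d")
      case True
      then show ?thesis unfolding 1 by (intro Fop_Eop) auto
    next
      case False
      then have z1: "Rop ?d d2 u k n a = 0" for k a by (intro Rop_out) auto
      have z2: "bs ?d g n * Rop ?d d2 u f (n + g) a = 0"
      proof (cases "0 \<le> n + g \<and> n + g \<le> int ?d")
        case True
        with False g consider "n = -1" "g = 1" | "n = int ?d + 1" "g = -1" by linarith
        then have "bs ?d g n = 0" using b_top[of ?d] by cases (simp_all add: bs_def)
        then show ?thesis by simp
      next
        case F: False
        then have "Rop ?d d2 u f (n + g) a = 0" by (intro Rop_out) auto
        then show ?thesis by simp
      qed
      have "?h n = (u powi (g * t) * kp d2 t a) * (bs ?d g n * Rop ?d d2 u f (n + g) a) + kp ?d (- t) n * bs d2 g a * Rop ?d d2 u f n (a + g)"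
        unfolding cop_def by (simp add: algebra_simps)
      then show ?thesis unfolding z1 z2 by simp
    qed
  qed
qed

end

section \<open>A uniqueness result for Laurent polynomial solutions\<close>

lemma laur_common:
  assumes "finite I" "\<And>x. x \<in> I \<Longrightarrow> laur (f x)"
  shows "\<exists>p (k::nat). \<forall>x\<in>I. \<forall>u. u \<noteq> 0 \<longrightarrow> f x u * u ^ k = poly (p x) u"
  using assms
proof (induction I rule: finite_induct)
  case empty then show ?case by simp
next
  case (insert y I)
  have "\<exists>p (k::nat). \<forall>x\<in>I. \<forall>u. u \<noteq> 0 \<longrightarrow> f x u * u ^ k = poly (p x) u"
    by (rule insert.IH) (use insert.prems in blast)
  then obtain p k where 1: "\<forall>x\<in>I. \<forall>u. u \<noteq> 0 \<longrightarrow> f x u * u ^ k = poly (p x) u" by blast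
  from insert(4)[of y] obtain q l where 2: "\<And>u. u \<noteq> 0 \<Longrightarrow> f y u * u ^ l = poly q u" unfolding laur_def by auto
  have "f x u * u ^ (k + l) = poly (if x = y then q * monom 1 k else p x * monom 1 l) u"
    if "x \<in> insert y I" "u \<noteq> 0" for x u
    using that insert(2) 1[rule_format, of x u] 2[of u] by (auto simp: power_add poly_monom algebra_simps)
  then show ?case by (intro exI[of _ "\<lambda>x. if x = y then q * monom 1 k else p x * monom 1 l"] exI[of _ "k + l"]) blast
qed

lemma poly_eq_nz:
  fixes P R :: "complex poly"
  assumes "\<And>u. u \<noteq> 0 \<Longrightarrow> poly P u = poly R u"
  shows "P = R"
proof (rule ccontr)
  assume "P \<noteq> R"
  then have f: "finite {u. poly (P - R) u = 0}" by (intro poly_roots_finite) simp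
  have "v \<in> insert 0 {u. poly (P - R) u = 0}" for v using assms[of v] by (cases "v = 0") auto
  then have "insert 0 {u. poly (P - R) u = 0} = UNIV" by blast
  with f have "finite (UNIV :: complex set)" by (metis finite_insert)
  then show False by (simp add: infinite_UNIV_char_0)
qed

text \<open>
  Let \<open>D\<close> be the highest power of \<open>u\<close> in any \<open>m u i n\<close>, and \<open>t\<^sub>i\<^sub>n\<close> its coefficient.  The coefficients of
  \<open>u\<^sup>D\<^sup>+\<^sup>1\<close> in the two relations are \<open>A\<^sub>n t\<^sub>i\<^sub>,\<^sub>n\<^sub>-\<^sub>1 = C\<^sub>i t\<^sub>i\<^sub>-\<^sub>1\<^sub>,\<^sub>n\<close> and a similar relation in the opposite direction.
  The first one gives \<open>t\<^sub>i\<^sub>n = 0\<close> for \<open>i + n < d\<close> by induction from \<open>i = 0\<close>, the second one for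
  \<open>i + n \<ge> r\<close> by induction from \<open>i = r - 1\<close>.  As \<open>r \<le> d\<close>, all \<open>t\<^sub>i\<^sub>n\<close> vanish.
\<close>

lemma top_coeff_zero:
  fixes m :: "complex \<Rightarrow> int \<Rightarrow> int \<Rightarrow> complex" and r d :: int
  assumes lau: "\<And>i n. laur (\<lambda>u. m u i n)"
    and out: "\<And>u i n. \<not> (0 \<le> i \<and> i < r \<and> 0 \<le> n \<and> n \<le> d) \<Longrightarrow> m u i n = 0"
    and rel1: "\<And>u i n. u \<noteq> 0 \<Longrightarrow> 0 \<le> i \<Longrightarrow> i < r \<Longrightarrow> 0 \<le> n \<Longrightarrow> n \<le> d \<Longrightarrow>
       u * A n * m u i (n - 1) + inverse u * A1 n * m u i (n + 1) + E n * m u i n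
       = inverse u * C1 i * m u (i + 1) n + u * C i * m u (i - 1) n + G i * m u i n"
    and rel2: "\<And>u i n. u \<noteq> 0 \<Longrightarrow> 0 \<le> i \<Longrightarrow> i < r \<Longrightarrow> 0 \<le> n \<Longrightarrow> n \<le> d \<Longrightarrow>
       inverse u * A2 n * m u i (n - 1) + u * A3 n * m u i (n + 1) + E2 n * m u i n
       = u * C3 i * m u (i + 1) n + inverse u * C2 i * m u (i - 1) n + G2 i * m u i n"
    and A: "\<And>n. 1 \<le> n \<Longrightarrow> n \<le> d \<Longrightarrow> A n \<noteq> 0" and A3: "\<And>n. 0 \<le> n \<Longrightarrow> n < d \<Longrightarrow> A3 n \<noteq> 0"
    and r: "r \<le> d" and u: "u \<noteq> 0"
  shows "m u i n = 0"
proof -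
  let ?I = "{0..<r} \<times> {0..d}"
  have "\<exists>p (k::nat). \<forall>x\<in>?I. \<forall>u. u \<noteq> 0 \<longrightarrow> m u (fst x) (snd x) * u ^ k = poly (p x) u"
    by (rule laur_common) (use lau in auto)
  then obtain p0 k where p0: "\<forall>x\<in>?I. \<forall>u. u \<noteq> 0 \<longrightarrow> m u (fst x) (snd x) * u ^ k = poly (p0 x) u" by blast
  define p where "p i n = (if (i, n) \<in> ?I then p0 (i, n) else 0)" for i n
  have p: "m u i n * u ^ k = poly (p i n) u" if "u \<noteq> 0" for u i n
  proof (cases "(i, n) \<in> ?I")
    case True
    then have "p i n = p0 (i, n)" unfolding p_def by (rule if_P)
    then show ?thesis using p0[rule_format, OF True that] by simp
  next
    case False
    then have "p i n = 0" unfolding p_def by (rule if_not_P)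
    moreover from False have "m u i n = 0" by (intro out) auto
    ultimately show ?thesis by simp
  qed
  have p_out: "p i n = 0" if "\<not> (0 \<le> i \<and> i < r \<and> 0 \<le> n \<and> n \<le> d)" for i n
    using that by (auto simp: p_def)
  have pr1: "pCons 0 (pCons 0 ([:A n:] * p i (n - 1))) + [:A1 n:] * p i (n + 1) + pCons 0 ([:E n:] * p i n)
     = [:C1 i:] * p (i + 1) n + pCons 0 (pCons 0 ([:C i:] * p (i - 1) n)) + pCons 0 ([:G i:] * p i n)"
    if "0 \<le> i" "i < r" "0 \<le> n" "n \<le> d" for i n
  proof (rule poly_eq_nz)
    fix v :: complex assume v: "v \<noteq> 0"
    then have inv: "v * (c * (inverse v * z)) = c * z" for c z by simp
    show "poly (pCons 0 (pCons 0 ([:A n:] * p i (n - 1))) + [:A1 n:] * p i (n + 1) + pCons 0 ([:E n:] * p i n)) v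
     = poly ([:C1 i:] * p (i + 1) n + pCons 0 (pCons 0 ([:C i:] * p (i - 1) n)) + pCons 0 ([:G i:] * p i n)) v"
      using arg_cong[OF rel1[OF v that], of "\<lambda>z. z * v * v ^ k"] inv
      by (simp add: p[OF v, symmetric] algebra_simps)
  qed
  have pr2: "[:A2 n:] * p i (n - 1) + pCons 0 (pCons 0 ([:A3 n:] * p i (n + 1))) + pCons 0 ([:E2 n:] * p i n)
     = pCons 0 (pCons 0 ([:C3 i:] * p (i + 1) n)) + [:C2 i:] * p (i - 1) n + pCons 0 ([:G2 i:] * p i n)"
    if "0 \<le> i" "i < r" "0 \<le> n" "n \<le> d" for i n
  proof (rule poly_eq_nz)
    fix v :: complex assume v: "v \<noteq> 0"
    then have inv: "v * (c * (inverse v * z)) = c * z" for c z by simp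
    show "poly ([:A2 n:] * p i (n - 1) + pCons 0 (pCons 0 ([:A3 n:] * p i (n + 1))) + pCons 0 ([:E2 n:] * p i n)) v
     = poly (pCons 0 (pCons 0 ([:C3 i:] * p (i + 1) n)) + [:C2 i:] * p (i - 1) n + pCons 0 ([:G2 i:] * p i n)) v"
      using arg_cong[OF rel2[OF v that], of "\<lambda>z. z * v * v ^ k"] inv
      by (simp add: p[OF v, symmetric] algebra_simps)
  qed
  \<comment> \<open>\<open>p i n\<close> is \<open>m u i n\<close> multiplied by a common power of \<open>u\<close>.\<close>
  have step: "coeff (p i n) D = 0" if deg: "\<And>i n k. k > D \<Longrightarrow> coeff (p i n) k = 0" for D i n
  proof -
    let ?t = "\<lambda>i n. coeff (p i n) D"
    have t1: "A n * ?t i (n - 1) = C i * ?t (i - 1) n" if "0 \<le> i" "i < r" "0 \<le> n" "n \<le> d" for i n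
      using arg_cong[OF pr1[OF that], of "\<lambda>q. coeff q (Suc (Suc D))"] deg by simp
    have t2: "A3 n * ?t i (n + 1) = C3 i * ?t (i + 1) n" if "0 \<le> i" "i < r" "0 \<le> n" "n \<le> d" for i n
      using arg_cong[OF pr2[OF that], of "\<lambda>q. coeff q (Suc (Suc D))"] deg by simp
    have low: "?t (int j) n = 0" if "int j < r" "0 \<le> n" "int j + n \<le> d - 1" for j n
      using that
    proof (induction j arbitrary: n)
      case 0
      then show ?case using t1[of 0 "n + 1"] A[of "n + 1"] p_out[of "-1" "n + 1"] by simp
    next
      case (Suc j)
      then show ?case using t1[of "int (Suc j)" "n + 1"] A[of "n + 1"] Suc.IH[of "n + 1"] by simp
    qed
    have high: "?t (r - 1 - int j) n = 0" if "0 \<le> r - 1 - int j" "n \<le> d" "n \<ge> 1 + int j" for j n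
      using that
    proof (induction j arbitrary: n)
      case 0
      then show ?case using t2[of "r - 1" "n - 1"] A3[of "n - 1"] p_out[of r "n - 1"] by simp
    next
      case (Suc j)
      define i where "i = r - 1 - int (Suc j)"
      have e: "r - 1 - int j = i + 1" by (simp add: i_def)
      have "?t (r - 1 - int j) (n - 1) = 0" by (rule Suc.IH) (use Suc.prems in auto)
      then have "?t (i + 1) (n - 1) = 0" unfolding e .
      then have "?t i n = 0" using t2[of i "n - 1"] A3[of "n - 1"] Suc.prems by (simp add: i_def)
      then show ?case by (simp add: i_def)
    qed
    show ?thesis
    proof (cases "0 \<le> i \<and> i < r \<and> 0 \<le> n \<and> n \<le> d")
      case False then show ?thesis using p_out by simp
    next
      case True
      then show ?thesis using low[of "nat i" n] high[of "nat (r - 1 - i)" n] r by (cases "i + n \<le> d - 1") auto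
    qed
  qed
  have "(\<forall>i n k. k \<ge> D \<longrightarrow> coeff (p i n) k = 0) \<Longrightarrow> p i n = 0" for D
  proof (induction D)
    case 0 then show ?case by (intro poly_eqI) simp
  next
    case (Suc D)
    have "coeff (p i n) k = 0" if "k \<ge> D" for i n k
    proof (cases "k = D")
      case True then show ?thesis using step[of D i n] Suc.prems by simp
    next
      case False then show ?thesis using Suc.prems that by simp
    qed
    then show ?case using Suc.IH by blast
  qed
  moreover obtain D where "\<forall>i n k. k \<ge> D \<longrightarrow> coeff (p i n) k = 0"
  proof -
    have fin: "finite ((\<lambda>x. degree (p0 x)) ` ?I)" by simp
    have "coeff (p i n) k = 0" if "k \<ge> Suc (Max (insert 0 ((\<lambda>x. degree (p0 x)) ` ?I)))" for i n k
    proof (cases "(i, n) \<in> ?I")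
      case True
      then have "p i n = p0 (i, n)" unfolding p_def by (rule if_P)
      moreover have "degree (p0 (i, n)) \<in> insert 0 ((\<lambda>x. degree (p0 x)) ` ?I)" using True by (intro insertI2 imageI)
      then have "degree (p0 (i, n)) \<le> Max (insert 0 ((\<lambda>x. degree (p0 x)) ` ?I))" using fin by (intro Max_ge) simp_all
      with that have "coeff (p0 (i, n)) k = 0" by (intro coeff_eq_0) linarith
      ultimately show ?thesis by simp
    next
      case False
      then have "p i n = 0" unfolding p_def by (rule if_not_P)
      then show ?thesis by simp
    qed
    then show ?thesis using that by blast
  qed
  ultimately have "p i n = 0" by blast
  with p[OF u, of i n] u show ?thesis by simp
qed

section \<open>Fused K-operators\<close>

text \<open>
  Linearity of an operator on functions of one integer argument.
\<close>

definition lin1 :: "((int \<Rightarrow> complex) \<Rightarrow> int \<Rightarrow> complex) \<Rightarrow> bool" where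
  "lin1 T \<longleftrightarrow> (\<forall>c e f g n. T (\<lambda>n. c * f n + e * g n) n = c * T f n + e * T g n)"

lemma lin1D: "lin1 T \<Longrightarrow> T (\<lambda>n. c * f n + e * g n) n = c * T f n + e * T g n"
  by (simp add: lin1_def)

lemma lin1_sum:
  assumes "lin1 T"
  shows "T (\<lambda>n. \<Sum>x\<in>I. c x * F x n) n = (\<Sum>x\<in>I. c x * T (F x) n)"
proof (induction I rule: infinite_finite_induct)
  case (insert x I)
  with lin1D[OF assms, of "c x" "F x" 1 "\<lambda>n. \<Sum>x\<in>I. c x * F x n"] show ?case by simp
qed (use lin1D[OF assms, of 0 "\<lambda>n. 0" 0 "\<lambda>n. 0"] in simp_all)

text \<open>
  The basis vector with index \<open>m\<close>.
\<close>

definition delta1 :: "int \<Rightarrow> int \<Rightarrow> complex" where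
  "delta1 m n = of_bool (n = m)"

lemma delta1_expand: "finite A \<Longrightarrow> (\<Sum>x\<in>A. f x * delta1 x n) = of_bool (n \<in> A) * f n"
  by (simp add: delta1_def of_bool_def if_distrib cong: if_cong)

text \<open>
  The boundary parameter \<open>k\<^sub>\<plusminus>\<close> that goes with \<open>S\<^sub>\<plusminus>\<close>.
\<close>

definition kB :: "boundary \<Rightarrow> int \<Rightarrow> complex" where
  "kB B g = (if g = 1 then k_plus B else k_minus B)"

text \<open>
  The boundary parameter \<open>\<epsilon>\<^sub>\<plusminus>\<close> that goes with \<open>W\<^sub>0\<close> (\<open>t = 1\<close>) and \<open>W\<^sub>1\<close> (\<open>t = - 1\<close>).
\<close>

definition epB :: "boundary \<Rightarrow> int \<Rightarrow> complex" where
  "epB B t = (if t = 1 then eps_plus B else eps_minus B)"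

lemma laur_compose_sq:
  assumes "laur f" shows "laur (\<lambda>u. f (u\<^sup>2))"
proof -
  from assms obtain p k where 1: "\<forall>u. u \<noteq> 0 \<longrightarrow> f u * u ^ k = poly p u" unfolding laur_def by blast
  show ?thesis
  proof (rule laurI[of _ "2 * k" "pcompose p [:0, 0, 1:]"])
    fix u :: complex assume "u \<noteq> 0"
    then have "f (u\<^sup>2) * (u\<^sup>2) ^ k = poly p (u\<^sup>2)" using 1[rule_format, of "u\<^sup>2"] by simp
    then show "f (u\<^sup>2) * u ^ (2 * k) = poly (pcompose p [:0, 0, 1:]) u"
      by (simp add: poly_pcompose power_mult power2_eq_square)
  qed
qed

context generic_q begin

text \<open>
  One term \<open>k\<^sub>g (s u)\<^sup>g\<^sup>t S\<^sub>g q\<^sup>t\<^sup>S\<^sup>3\<^sup>/\<^sup>2\<close> of the ladder operator \<open>X(u)\<close>.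
\<close>

definition Xop :: "boundary \<Rightarrow> nat \<Rightarrow> int \<Rightarrow> int \<Rightarrow> complex \<Rightarrow> (int \<Rightarrow> complex) \<Rightarrow> int \<Rightarrow> complex" where
  "Xop B d g t u f n = kB B g * (s * u) powi (g * t) * bs d g n * kp d t (n + g) * f (n + g)"

text \<open>
  The operator \<open>X(u) + \<epsilon> q\<^sup>t\<^sup>S\<^sup>3\<close>: the action of \<open>W\<^sub>0\<close> (\<open>t = 1\<close>) or \<open>W\<^sub>1\<close> (\<open>t = - 1\<close>) on spin \<open>d/2\<close> with
  spectral parameter \<open>u\<close>.
\<close>

definition Vop :: "boundary \<Rightarrow> nat \<Rightarrow> int \<Rightarrow> complex \<Rightarrow> (int \<Rightarrow> complex) \<Rightarrow> int \<Rightarrow> complex" where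
  "Vop B d t u f n = Xop B d 1 t u f n + Xop B d (- 1) t u f n + epB B t * kp d (2 * t) n * f n"

text \<open>
  The K-matrix of spin 1/2.
\<close>

definition Khop :: "boundary \<Rightarrow> complex \<Rightarrow> (int \<Rightarrow> complex) \<Rightarrow> int \<Rightarrow> complex" where
  "Khop B u f p =
     (if p = 0 then (u * eps_plus B + inverse u * eps_minus B) * f 0 + k_plus B * cfun (u\<^sup>2) / Q * f 1
      else if p = 1 then k_minus B * cfun (u\<^sup>2) / Q * f 0 + (u * eps_minus B + inverse u * eps_plus B) * f 1
      else 0)"

text \<open>
  The product \<open>K\<^sub>1(v\<^sub>1) R\<^sub>1\<^sub>2(v\<^sub>2) T\<^sub>2 E\<close> in which \<open>K\<close> is the K-matrix and \<open>R\<close> the R-operator of spin 1/2: the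
  fused K-operator before \<open>F\<close> is applied.
\<close>

definition YK where
  "YK B T e v1 v2 f p i = Khop B v1 (\<lambda>p. Lop e v2 (\<lambda>p i. T (\<lambda>i. Eop (Suc e) f p i) i) p i) p"

text \<open>
  The K-matrix of spin \<open>d/2\<close> without the scalar factors contributed by the R-matrices.
\<close>

fun Kop :: "boundary \<Rightarrow> nat \<Rightarrow> complex \<Rightarrow> (int \<Rightarrow> complex) \<Rightarrow> int \<Rightarrow> complex" where
  "Kop B 0 u = (\<lambda>f. f)"
| "Kop B (Suc 0) u = Khop B u"
| "Kop B (Suc (Suc e)) u = (\<lambda>f.
     Fop (Suc (Suc e)) (YK B (Kop B (Suc e) (u * s)) (Suc e) (u * s powi (- int (Suc e))) (u\<^sup>2 * s powi (- int e)) f))"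

lemma Khop_lin: "Khop B u (\<lambda>n. c * f n + e * g n) p = c * Khop B u f p + e * Khop B u g p"
  by (simp add: Khop_def algebra_simps add_divide_distrib)

lemma YK_lin:
  assumes "lin1 T"
  shows "YK B T e v1 v2 (\<lambda>n. c * f n + c' * g n) p i = c * YK B T e v1 v2 f p i + c' * YK B T e v1 v2 g p i"
  by (simp add: YK_def Eop_lin lin1D[OF assms] Lop_lin Khop_lin)

lemma lin1_Kop: "lin1 (Kop B (Suc e) u)"
proof (induction e arbitrary: u)
  case 0 then show ?case by (simp add: lin1_def Khop_lin)
next
  case (Suc e)
  show ?case unfolding lin1_def Kop.simps Fop_def YK_lin[OF Suc] by (simp add: algebra_simps)
qed

lemma Kop_out: "\<not> (0 \<le> n \<and> n \<le> int (Suc e)) \<Longrightarrow> Kop B (Suc e) u f n = 0"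
proof (cases e)
  case 0
  assume "\<not> (0 \<le> n \<and> n \<le> int (Suc e))"
  with 0 have "n \<noteq> 0 \<and> n \<noteq> 1" by auto
  with 0 show ?thesis by (simp add: Khop_def)
next
  case (Suc k)
  assume "\<not> (0 \<le> n \<and> n \<le> int (Suc e))"
  then have "n < 0 \<or> n > int (Suc e)" by auto
  then show ?thesis unfolding Suc Kop.simps by (intro Fop_out) (simp add: Suc)
qed

lemma Eop_in': "Eop d (\<lambda>m. inr d m * f m) = Eop d f"
  by (intro ext) (rule Eop_in)

lemma YK_in: "YK B T e v1 v2 (\<lambda>n. inr (Suc e) n * f n) = YK B T e v1 v2 f"
  unfolding YK_def Eop_in' ..

lemma Kop_in: "Kop B (Suc e) u (\<lambda>n. inr (Suc e) n * f n) n = Kop B (Suc e) u f n"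
proof (cases e)
  case 0 then show ?thesis by (simp add: Khop_def inr_def)
next
  case (Suc k)
  then show ?thesis by (simp add: YK_in)
qed

lemma laur_cfun: "laur f \<Longrightarrow> laur (\<lambda>u. inverse (f u)) \<Longrightarrow> laur (\<lambda>u. cfun (f u))"
  unfolding cfun_def by (rule laur_diff)

lemma laur_Khop:
  assumes "\<And>n. laur (\<lambda>u. g u n)" "c \<noteq> 0"
  shows "laur (\<lambda>u. Khop B (c * u) (g u) p)"
proof -
  have i: "laur (\<lambda>u. inverse (c * u))"
    using laur_mult[OF laur_const[of "inverse c"] laur_inverse] by simp
  then have i2: "laur (\<lambda>u. inverse ((c * u)\<^sup>2))"
    using laur_mult[OF i i] by (simp add: power2_eq_square)
  have "laur (\<lambda>u. cfun ((c * u)\<^sup>2))"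
    by (rule laur_cfun[OF _ i2]) (simp only: power2_eq_square, intro laur_mult laur_const laur_id)
  then have c2: "laur (\<lambda>u. k * cfun ((c * u)\<^sup>2) / Q)" for k
    unfolding divide_inverse by (intro laur_mult laur_const)
  have c3: "laur (\<lambda>u. k * cfun ((c * u)\<^sup>2) * g u n / (s\<^sup>2 - s powi - 2))" for k n
    using laur_mult[OF c2[of k] assms(1)[of n]] by simp
  show ?thesis
    by (cases "p = 0"; cases "p = 1")
      (auto simp: Khop_def intro!: laur_mult laur_add i c3 assms(1))
qed

lemma laur_Lop_sq:
  assumes "\<And>n a. laur (\<lambda>u. g u n a)" "c \<noteq> 0"
  shows "laur (\<lambda>u. Lop d (c * u\<^sup>2) (g u) p a)"
proof -
  have 1: "laur (\<lambda>u. u\<^sup>2)" "laur (\<lambda>u. inverse (u\<^sup>2))"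
    using laur_compose_sq[OF laur_id] laur_compose_sq[OF laur_inverse] .
  show ?thesis
    by (cases "p = 0"; cases "p = 1")
      (auto simp: Lop_def Lraw_def intro!: laur_mult laur_add laur_diff 1 assms(1))
qed

lemma laur_Kop:
  assumes "\<And>n. laur (\<lambda>u. g u n)" "c \<noteq> 0"
  shows "laur (\<lambda>u. Kop B (Suc e) (c * u) (g u) n)"
  using assms
proof (induction e arbitrary: g c n)
  case 0
  then show ?case by (simp add: laur_Khop)
next
  case (Suc e)
  have E: "laur (\<lambda>u. Eop (Suc (Suc e)) (g u) p i)" for p i
    by (cases "p = 0"; cases "p = 1") (auto simp: Eop_def intro!: laur_mult Suc.prems)
  have T: "laur (\<lambda>u. Kop B (Suc e) (c * s * u) (\<lambda>i. Eop (Suc (Suc e)) (g u) p i) i)" for p i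
    by (rule Suc.IH) (use E Suc.prems in auto)
  have L: "laur (\<lambda>u. Lop (Suc e) (c\<^sup>2 * s powi (- int e) * u\<^sup>2) (\<lambda>p i. Kop B (Suc e) (c * s * u) (\<lambda>i. Eop (Suc (Suc e)) (g u) p i) i) p i)" for p i
    by (rule laur_Lop_sq) (use T Suc.prems in auto)
  have Y: "laur (\<lambda>u. Khop B (c * s powi (- int (Suc e)) * u) (\<lambda>p. Lop (Suc e) (c\<^sup>2 * s powi (- int e) * u\<^sup>2) (\<lambda>p i. Kop B (Suc e) (c * s * u) (\<lambda>i. Eop (Suc (Suc e)) (g u) p i) i) p i) p)" for p i
    by (rule laur_Khop) (use L Suc.prems in auto)
  have eq: "c * u * s = c * s * u" "c * u * s powi k = c * s powi k * u" "(c * u)\<^sup>2 * s powi k = c\<^sup>2 * s powi k * u\<^sup>2" for u k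
    by (simp_all add: power_mult_distrib)
  show ?case unfolding Kop.simps YK_def Fop_def eq
    by (intro laur_add laur_mult laur_const Y)
qed

lemma Khop_intertwines:
  assumes u: "u \<noteq> 0" and t: "t = 1 \<or> t = - 1"
  shows "Khop B u (Vop B (Suc 0) t u f) p = Vop B (Suc 0) t (inverse u) (Khop B u f) p"
proof -
  have s4: "s ^ 4 \<noteq> 1" using not_root[of 4] by simp
  have Qs: "s\<^sup>2 - s powi - 2 = (s ^ 4 - 1) / s ^ 2"
    by (simp add: power_int_minus field_simps)
  have k2: "kp (Suc 0) 1 0 = s" "kp (Suc 0) (-1) 0 = 1/s" "kp (Suc 0) 1 1 = 1/s" "kp (Suc 0) (-1) 1 = s"
    "kp (Suc 0) 2 0 = s^2" "kp (Suc 0) (-2) 0 = 1/s^2" "kp (Suc 0) 2 1 = 1/s^2" "kp (Suc 0) (-2) 1 = s^2"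
    by (simp_all add: kp_def power_int_minus field_simps)
  consider "p = 0" | "p = 1" | "p = -1" | "p = 2" | "p \<notin> {-1,0,1,2}" by auto
  then show ?thesis
    using t u s4
    by cases (auto simp: Vop_def Xop_def Khop_def kB_def epB_def bs_def k2 cfun_def Qs divide_simps, (simp add: algebra_simps power_numeral_reduce)+)
qed

end

lemma lin1D3: "lin1 T \<Longrightarrow> T (\<lambda>n. c1 * f1 n + c2 * f2 n + c3 * f3 n) n = c1 * T f1 n + c2 * T f2 n + c3 * T f3 n"
  using lin1D[of T 1 "\<lambda>n. c1 * f1 n + c2 * f2 n" c3 f3] lin1D[of T c1 f1 c2 f2] by simp

lemma lin2D3: "lin2 T \<Longrightarrow> T (\<lambda>n a. c1 * f1 n a + c2 * f2 n a + c3 * f3 n a) n a = c1 * T f1 n a + c2 * T f2 n a + c3 * T f3 n a"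
  using lin2D[of T 1 "\<lambda>n a. c1 * f1 n a + c2 * f2 n a" c3 f3] lin2D[of T c1 f1 c2 f2] by simp

context generic_q begin

lemma kp_unit: "kp e (- t) i * kp e t i = 1" "kp e t i * kp e (- t) i = 1"
  by (simp_all only: kp_def powi_add[symmetric]) simp_all

lemma kp_double: "kp e t i * kp e t i = kp e (2 * t) i"
  by (simp only: kp_def powi_add[symmetric]) (simp add: algebra_simps)

lemma lin1_Khop: "lin1 (Khop B u)"
  by (simp add: lin1_def Khop_lin)

text \<open>
  The operator \<open>Y\<close> takes \<open>Vop\<close> at \<open>u\<close> to its counterpart at \<open>1/u\<close> in the tensor product.  The two
  ladder terms \<open>H\<close> of the result carry the twist for which \<open>Eop\<close> and \<open>Pop\<close> are intertwiners.
\<close>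

lemma YK_Vop:
  assumes T: "lin1 T" and TV: "\<And>f. T (Vop B e t (u * s) f) = Vop B e t (inverse (u * s)) (T f)"
    and u: "u \<noteq> 0" and t: "t = 1 \<or> t = - 1"
  defines "Y \<equiv> YK B T e (u * s powi (- int e)) (u\<^sup>2 * s powi (1 - int e))"
  defines "H \<equiv> \<lambda>g f p i. kB B g * inverse u powi (g * t) * cop g (- t) (s powi (g * t * int (Suc e))) (Suc 0) e (\<lambda>p i. kp (Suc e) t (p + i) * Y f p i) p i"
  shows "Y (Vop B (Suc e) t u f) p i = H 1 f p i + H (- 1) f p i + epB B t * kp (Suc e) (2 * t) (p + i) * Y f p i"
proof -
  define v1 where "v1 = u * s powi (- int e)"
  define v2 where "v2 = u\<^sup>2 * s powi (1 - int e)"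
  have v: "v1 \<noteq> 0" "v2 \<noteq> 0" using u by (simp_all add: v1_def v2_def)
  let ?C = "\<lambda>g. inverse u powi (g * t)"
  have p1: "(s * v1) powi k = inverse u powi k * v2 powi k" for k
  proof -
    have "s * v1 = inverse u * v2"
      using u by (simp add: v1_def v2_def power_int_diff power_int_minus field_simps power2_eq_square)
    then show ?thesis by (simp add: power_int_mult_distrib)
  qed
  have p2: "(s * inverse (u * s)) powi k = inverse u powi k" for k
    using u by (simp add: field_simps)
  have p3: "(s * inverse v1) powi k = inverse u powi k * s powi (k * int (Suc e))" for k
  proof -
    have "s powi int (Suc e) = s * s powi int e"
      using power_int_add[of s 1 "int e"] by simp
    then have "s * inverse v1 = inverse u * s powi int (Suc e)"
      using u by (simp add: v1_def power_int_minus field_simps del: of_nat_Suc)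
    then show ?thesis by (simp only: powi_mult) (simp add: mult.commute)
  qed
  have p4: "(s * (u * s)) powi k = (s * u) powi k * s powi k" for k
    by (simp add: power_int_mult_distrib)
  have p5: "(s * u) powi (g * t) * s powi (g * t) * s powi (- (g * t * int (Suc e))) = (s * v1) powi (g * t)" for g
  proof -
    have "(s * u) powi (g * t) * s powi (g * t) * s powi (- (g * t * int (Suc e)))
       = (s * u * s * s powi (- int (Suc e))) powi (g * t)"
      by (simp add: power_int_mult_distrib power_int_mult[symmetric] algebra_simps)
    also have "s * u * s * s powi (- int (Suc e)) = s * v1"
      by (simp add: v1_def power_int_diff power_int_minus field_simps)
    finally show ?thesis .
  qed
  \<comment> \<open>\<open>Vop\<close> is moved in turn through the fusion map (\<open>EV\<close>), \<open>T\<close> (\<open>Z\<close>), the R-operator (\<open>V\<close>) and \<open>K\<close>.\<close>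
  let ?E = "\<lambda>f p i. Eop (Suc e) f p i"
  let ?A = "\<lambda>g p. kB B g * (s * v1) powi (g * t) * bs (Suc 0) g p * kp (Suc 0) t (p + g)"
  have E1: "?E (Xop B (Suc e) g t u f) p i = ?A g p * ?E f (p + g) i + kp (Suc 0) (2 * t) p * Xop B e g t (u * s) (?E f p) i"
    if g: "g = 1 \<or> g = - 1" for g f p i
  proof -
    have "Xop B (Suc e) g t u f = (\<lambda>n. (kB B g * (s * u) powi (g * t)) * (bs (Suc e) g n * (kp (Suc e) t (n + g) * f (n + g))))"
      by (simp add: Xop_def fun_eq_iff)
    then have "?E (Xop B (Suc e) g t u f) p i = (kB B g * (s * u) powi (g * t)) * ?E (\<lambda>n. bs (Suc e) g n * (kp (Suc e) t (n + g) * f (n + g))) p i"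
      by (simp add: Eop_def)
    also have "?E (\<lambda>n. bs (Suc e) g n * (kp (Suc e) t (n + g) * f (n + g))) p i
      = s powi (g * t) * cop g t (s powi (- (g * t * int (Suc e)))) (Suc 0) e (?E (\<lambda>n. kp (Suc e) t n * f n)) p i"
      by (rule Eop_cop[OF g t, symmetric])
    also have "?E (\<lambda>n. kp (Suc e) t n * f n) = (\<lambda>p i. kp (Suc 0) t p * kp e t i * ?E f p i)"
      unfolding Eop_weight kp_Suc ..
    also have "cop g t (s powi (- (g * t * int (Suc e)))) (Suc 0) e (\<lambda>p i. kp (Suc 0) t p * kp e t i * ?E f p i) p i
      = s powi (- (g * t * int (Suc e))) * bs (Suc 0) g p * kp (Suc 0) t (p + g) * (kp e (-t) i * kp e t i) * ?E f (p + g) i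
       + (kp (Suc 0) t p * kp (Suc 0) t p) * bs e g i * kp e t (i + g) * ?E f p (i + g)"
      by (simp add: cop_def algebra_simps)
    finally show ?thesis
      unfolding kp_unit kp_double p5[symmetric] Xop_def p4 by (simp add: algebra_simps)
  qed
  have EV: "?E (Vop B (Suc e) t u f) p = (\<lambda>i. ?A 1 p * ?E f (p + 1) i + ?A (-1) p * ?E f (p + -1) i + kp (Suc 0) (2 * t) p * Vop B e t (u * s) (?E f p) i)" for f p
  proof
    fix i
    have "?E (Vop B (Suc e) t u f) p i = ?E (Xop B (Suc e) 1 t u f) p i + ?E (Xop B (Suc e) (-1) t u f) p i
        + epB B t * ?E (\<lambda>n. kp (Suc e) (2 * t) n * f n) p i"
      by (simp add: Vop_def Eop_def algebra_simps)
    then show "?E (Vop B (Suc e) t u f) p i = ?A 1 p * ?E f (p + 1) i + ?A (-1) p * ?E f (p + -1) i + kp (Suc 0) (2 * t) p * Vop B e t (u * s) (?E f p) i"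
      unfolding E1[OF disjI1[OF refl]] E1[OF disjI2[OF refl]] Eop_weight kp_Suc[symmetric]
      by (simp add: Vop_def algebra_simps)
  qed
  let ?Z = "\<lambda>f p i. T (?E f p) i"
  let ?k = "\<lambda>p i. kp (Suc e) t (p + i)"
  have Z1: "?A g p * z (p + g) i + kp (Suc 0) (2 * t) p * Xop B e g t (inverse (u * s)) (z p) i
    = (kB B g * ?C g) * cop g t (v2 powi (g * t)) (Suc 0) e (\<lambda>p i. ?k p i * z p i) p i" for g z p i
  proof -
    have "cop g t (v2 powi (g * t)) (Suc 0) e (\<lambda>p i. ?k p i * z p i) p i
      = v2 powi (g * t) * bs (Suc 0) g p * kp (Suc 0) t (p + g) * (kp e (-t) i * kp e t i) * z (p + g) i
       + (kp (Suc 0) t p * kp (Suc 0) t p) * bs e g i * kp e t (i + g) * z p (i + g)"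
      by (simp add: cop_def kp_Suc[symmetric] algebra_simps)
    then show ?thesis unfolding kp_unit kp_double p1 Xop_def p2 by (simp add: algebra_simps)
  qed
  have Z: "?Z (Vop B (Suc e) t u f) p i = (kB B 1 * ?C 1) * cop 1 t (v2 powi (1 * t)) (Suc 0) e (\<lambda>p i. ?k p i * ?Z f p i) p i
     + (kB B (-1) * ?C (-1)) * cop (-1) t (v2 powi (-1 * t)) (Suc 0) e (\<lambda>p i. ?k p i * ?Z f p i) p i
     + epB B t * (kp (Suc e) (2 * t) (p + i) * ?Z f p i)" for f p i
    unfolding EV lin1D3[OF T] TV Z1[symmetric] unfolding Vop_def kp_Suc[symmetric] by (simp add: algebra_simps)
  have WL: "Lop e v2 (\<lambda>p i. w (p + i) * z p i) = (\<lambda>p i. w (p + i) * Lop e v2 z p i)" for w z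
    by (intro ext) (rule Lop_weight)
  let ?V = "\<lambda>f p i. Lop e v2 (?Z f) p i"
  have V1: "(kB B g * ?C g) * cop g (-t) (v2 powi (g * t)) (Suc 0) e (\<lambda>p i. ?k p i * z p i) p i
     = kp e (2 * t) i * Xop B (Suc 0) g t v1 (\<lambda>p. z p i) p + (kB B g * ?C g * bs e g i * kp e t (i + g)) * z p (i + g)" for g z p i
  proof -
    have "cop g (-t) (v2 powi (g * t)) (Suc 0) e (\<lambda>p i. ?k p i * z p i) p i
      = v2 powi (g * t) * bs (Suc 0) g p * kp (Suc 0) t (p + g) * (kp e t i * kp e t i) * z (p + g) i
       + (kp (Suc 0) (-t) p * kp (Suc 0) t p) * bs e g i * kp e t (i + g) * z p (i + g)"
      by (simp add: cop_def kp_Suc[symmetric] algebra_simps)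
    then show ?thesis unfolding kp_unit kp_double Xop_def p1 by (simp add: algebra_simps)
  qed
  have V: "?V (Vop B (Suc e) t u f) p i = kp e (2 * t) i * Vop B (Suc 0) t v1 (\<lambda>p. ?V f p i) p
     + (kB B 1 * ?C 1 * bs e 1 i * kp e t (i + 1)) * ?V f p (i + 1)
     + (kB B (-1) * ?C (-1) * bs e (-1) i * kp e t (i + -1)) * ?V f p (i + -1)" for f p i
    unfolding Z lin2D3[OF lin2_Lop] WL[of "kp (Suc e) t"] WL[of "kp (Suc e) (2 * t)"] Lop_intertwines[OF v(2) disjI1[OF refl] t] Lop_intertwines[OF v(2) disjI2[OF refl] t] V1
    unfolding Vop_def kp_Suc[symmetric] by (simp add: algebra_simps)
  have Y: "Y f p i = Khop B v1 (\<lambda>p. ?V f p i) p" for f p i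
    by (simp add: Y_def YK_def v1_def v2_def)
  have Y1: "(kB B g * ?C g) * cop g (-t) (s powi (g * t * int (Suc e))) (Suc 0) e (\<lambda>p i. ?k p i * z p i) p i
     = kp e (2 * t) i * Xop B (Suc 0) g t (inverse v1) (\<lambda>p. z p i) p + (kB B g * ?C g * bs e g i * kp e t (i + g)) * z p (i + g)" for g z p i
  proof -
    have "cop g (-t) (s powi (g * t * int (Suc e))) (Suc 0) e (\<lambda>p i. ?k p i * z p i) p i
      = s powi (g * t * int (Suc e)) * bs (Suc 0) g p * kp (Suc 0) t (p + g) * (kp e t i * kp e t i) * z (p + g) i
       + (kp (Suc 0) (-t) p * kp (Suc 0) t p) * bs e g i * kp e t (i + g) * z p (i + g)"
      by (simp add: cop_def kp_Suc[symmetric] algebra_simps)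
    then show ?thesis unfolding kp_unit kp_double Xop_def p3 by (simp add: algebra_simps)
  qed
  show ?thesis
    unfolding H_def Y1
    unfolding Y V lin1D3[OF lin1_Khop] Khop_intertwines[OF v(1) t]
    unfolding Vop_def kp_Suc[symmetric] by (simp add: algebra_simps)
qed

lemma Vop_delta:
  "Vop B d t u (delta1 n) = (\<lambda>m. (kB B 1 * (s * u) powi t * b d (n - 1) * kp d t n) * delta1 (n - 1) m
     + (kB B (-1) * (s * u) powi (- t) * b d n * kp d t n) * delta1 (n + 1) m
     + (epB B t * kp d (2 * t) n) * delta1 n m)"
  by (auto simp: Vop_def Xop_def bs_def delta1_def fun_eq_iff)

lemma Pop_lin3: "Pop d (\<lambda>p i. c1 * h1 p i + c2 * h2 p i + c3 * h3 p i) i = c1 * Pop d h1 i + c2 * Pop d h2 i + c3 * Pop d h3 i"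
  by (simp add: Pop_def algebra_simps)

lemma cQ_bot: "cQ e 1 (int e - 1) = 0"
  by (simp add: cQ_def)

text \<open>
  The values of \<open>Y\<close> lie in the image of \<open>E\<close>.  This uses that both \<open>k\<^sub>+\<close> and \<open>k\<^sub>-\<close> are nonzero.
\<close>

lemma Pop_YK_Kop_zero:
  fixes e :: nat and B :: boundary
  defines "Y \<equiv> \<lambda>u. YK B (Kop B (Suc e) (u * s)) (Suc e) (u * s powi (- int (Suc e))) (u\<^sup>2 * s powi (- int e))"
  assumes IH: "\<And>u t f. u \<noteq> 0 \<Longrightarrow> t = 1 \<or> t = - 1 \<Longrightarrow> Kop B (Suc e) u (Vop B (Suc e) t u f) = Vop B (Suc e) t (inverse u) (Kop B (Suc e) u f)"
    and k: "k_plus B \<noteq> 0" "k_minus B \<noteq> 0"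
    and i: "0 \<le> i" "i < int (Suc e)" and u: "u \<noteq> 0"
  shows "Pop (Suc (Suc e)) (Y u f) i = 0"
proof -
  let ?d = "Suc (Suc e)"
  define M where "M u f i = Pop ?d (Y u f) i" for u f i
  have M_lin3: "M u (\<lambda>n. c1 * h1 n + c2 * h2 n + c3 * h3 n) i = c1 * M u h1 i + c2 * M u h2 i + c3 * M u h3 i" for u c1 c2 c3 h1 h2 h3 i
    using lin1D3[of "M u"] unfolding lin1_def M_def Y_def YK_lin[OF lin1_Kop] Pop_lin by simp
  \<comment> \<open>\<open>M\<close> intertwines \<open>Vop\<close> at \<open>u\<close> with its image at \<open>1/u\<close> in the quotient by the image of \<open>E\<close>.\<close>
  have relM: "M u (Vop B ?d t u f) i
      = kB B 1 * inverse u powi t * s powi (- t) * cQ (Suc e) 1 i * kp ?d t (i + 2) * M u f (i + 1)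
      + kB B (-1) * inverse u powi (- t) * s powi t * cQ (Suc e) (-1) i * kp ?d t i * M u f (i - 1)
      + epB B t * kp ?d (2 * t) (i + 1) * M u f i"
    if u: "u \<noteq> 0" and t: "t = 1 \<or> t = - 1" and i: "0 \<le> i" for u t f i
  proof -
    have us: "u * s \<noteq> 0" using u by simp
    have ex: "1 - int (Suc e) = - int e" by simp
    let ?H = "\<lambda>g. cop g (- t) (s powi (- (g * (- t) * int ?d))) (Suc 0) (Suc e) (\<lambda>p i. kp ?d t (p + i) * Y u f p i)"
    have Y: "Y u (Vop B ?d t u f) = (\<lambda>p i. (kB B 1 * inverse u powi (1 * t)) * ?H 1 p i
         + (kB B (-1) * inverse u powi (-1 * t)) * ?H (-1) p i + epB B t * (kp ?d (2 * t) (p + i) * Y u f p i))"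
      using YK_Vop[OF lin1_Kop IH[OF us t] u t] unfolding Y_def ex fun_eq_iff by (simp add: mult.assoc)
    have t': "- t = 1 \<or> - t = - 1" using t by auto
    show ?thesis
      unfolding M_def Y Pop_lin3 Pop_cop[OF disjI1[OF refl] t' i] Pop_cop[OF disjI2[OF refl] t' i]
        Pop_weight[of ?d "kp ?d t"] Pop_weight[of ?d "kp ?d (2 * t)"] by (simp add: algebra_simps)
  qed
  \<comment> \<open>The entries of \<open>M\<close>, put to zero outside the index range.\<close>
  define m where "m u i n = (if 0 \<le> i \<and> i < int (Suc e) \<and> 0 \<le> n \<and> n \<le> int ?d then M u (delta1 n) i else 0)" for u i n
  have rel: "kB B 1 * (s * u) powi t * b ?d (n - 1) * kp ?d t n * m u i (n - 1)
     + kB B (-1) * (s * u) powi (- t) * b ?d n * kp ?d t n * m u i (n + 1)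
     + epB B t * kp ?d (2 * t) n * m u i n
     = kB B 1 * inverse u powi t * s powi (- t) * cQ (Suc e) 1 i * kp ?d t (i + 2) * m u (i + 1) n
      + kB B (-1) * inverse u powi (- t) * s powi t * cQ (Suc e) (-1) i * kp ?d t i * m u (i - 1) n
      + epB B t * kp ?d (2 * t) (i + 1) * m u i n"
    if u: "u \<noteq> 0" and t: "t = 1 \<or> t = - 1" and i: "0 \<le> i" "i < int (Suc e)" and n: "0 \<le> n" "n \<le> int ?d" for u t i n
  proof -
    have 1: "b ?d (n - 1) * M u (delta1 (n - 1)) i = b ?d (n - 1) * m u i (n - 1)"
      using i n by (cases "n = 0") (auto simp: m_def)
    have 2: "b ?d n * M u (delta1 (n + 1)) i = b ?d n * m u i (n + 1)"
      using i n b_top[of ?d] by (cases "n = int ?d") (auto simp: m_def simp del: b_top)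
    have 3: "cQ (Suc e) 1 i * M u (delta1 n) (i + 1) = cQ (Suc e) 1 i * m u (i + 1) n"
      using i n cQ_bot[of "Suc e"] by (cases "i = int e") (auto simp: m_def)
    have 4: "M u (delta1 n) (i - 1) = m u (i - 1) n"
      using i n by (cases "i = 0") (auto simp: m_def M_def Pop_bot)
    have 5: "M u (delta1 n) i = m u i n" using i n by (simp add: m_def)
    have 6: "kB B 1 * (s * u) powi t * kp ?d t n * (b ?d (n - 1) * M u (delta1 (n - 1)) i)
       + kB B (-1) * (s * u) powi (- t) * kp ?d t n * (b ?d n * M u (delta1 (n + 1)) i)
       + epB B t * kp ?d (2 * t) n * M u (delta1 n) i
     = kB B 1 * inverse u powi t * s powi (- t) * kp ?d t (i + 2) * (cQ (Suc e) 1 i * M u (delta1 n) (i + 1))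
      + kB B (-1) * inverse u powi (- t) * s powi t * cQ (Suc e) (-1) i * kp ?d t i * M u (delta1 n) (i - 1)
      + epB B t * kp ?d (2 * t) (i + 1) * M u (delta1 n) i"
      using relM[OF u t i(1), of "delta1 n"] unfolding Vop_delta M_lin3 by (simp add: algebra_simps)
    show ?thesis using 6 unfolding 1 2 3 4 5 by (simp add: algebra_simps)
  qed
  have lau: "laur (\<lambda>u. m u i n)" for i n
  proof -
    have E: "laur (\<lambda>u. Eop ?d (delta1 n) p i)" for p i by simp
    have eq: "u * s powi k = s powi k * u" "u\<^sup>2 * s powi k = s powi k * u\<^sup>2" "u * s = s * u" for u k by simp_all
    have "laur (\<lambda>u. Y u (delta1 n) p i)" for p i
      unfolding Y_def YK_def eq
      by (intro laur_Khop laur_Lop_sq laur_Kop) auto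
    then have "laur (\<lambda>u. M u (delta1 n) i)" for i
      unfolding M_def Pop_def by (intro laur_diff laur_mult laur_const)
    moreover have "laur g \<Longrightarrow> laur (\<lambda>u. if P then g u else 0)" for P g by (cases P) simp_all
    ultimately show ?thesis unfolding m_def by blast
  qed
  have D: "m u i n = 0" if "u \<noteq> 0" for u i n
  proof (rule top_coeff_zero[where m = m and r = "int (Suc e)" and d = "int ?d" and u = u and i = i and n = n
      and A = "\<lambda>n. kB B 1 * s * b ?d (n - 1) * kp ?d 1 n" and ?A1.0 = "\<lambda>n. kB B (-1) * inverse s * b ?d n * kp ?d 1 n"
      and E = "\<lambda>n. epB B 1 * kp ?d 2 n" and C = "\<lambda>i. kB B (-1) * s * cQ (Suc e) (-1) i * kp ?d 1 i"
      and ?C1.0 = "\<lambda>i. kB B 1 * inverse s * cQ (Suc e) 1 i * kp ?d 1 (i + 2)" and G = "\<lambda>i. epB B 1 * kp ?d 2 (i + 1)"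
      and ?A2.0 = "\<lambda>n. kB B 1 * inverse s * b ?d (n - 1) * kp ?d (-1) n" and ?A3.0 = "\<lambda>n. kB B (-1) * s * b ?d n * kp ?d (-1) n"
      and ?E2.0 = "\<lambda>n. epB B (-1) * kp ?d (-2) n" and ?C3.0 = "\<lambda>i. kB B 1 * s * cQ (Suc e) 1 i * kp ?d (-1) (i + 2)"
      and ?C2.0 = "\<lambda>i. kB B (-1) * inverse s * cQ (Suc e) (-1) i * kp ?d (-1) i" and ?G2.0 = "\<lambda>i. epB B (-1) * kp ?d (-2) (i + 1)"])
    show "laur (\<lambda>u. m u i n)" for i n by (rule lau)
    show "m u i n = 0" if "\<not> (0 \<le> i \<and> i < int (Suc e) \<and> 0 \<le> n \<and> n \<le> int ?d)" for u i n
      unfolding m_def using that by (intro if_not_P) auto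
    show "kB B 1 * s * b ?d (n - 1) * kp ?d 1 n \<noteq> 0" if "1 \<le> n" "n \<le> int ?d" for n
      using that k b_nz[of "n - 1" ?d] by (simp add: kB_def kp_def)
    show "kB B (-1) * s * b ?d n * kp ?d (-1) n \<noteq> 0" if "0 \<le> n" "n < int ?d" for n
      using that k b_nz[of n ?d] by (simp add: kB_def kp_def)
  qed (use that rel[of _ 1] rel[of _ "-1"] in \<open>simp_all add: algebra_simps power_int_mult_distrib power_int_minus\<close>)
  have Mz: "M u (delta1 n) i = 0" if "n \<in> {0..int ?d}" for n
    using D[OF u, of i n] i that by (simp add: m_def)
  have fe: "(\<lambda>n. inr ?d n * f n) = (\<lambda>n. \<Sum>x\<in>{0..int ?d}. f x * delta1 x n)"
    unfolding delta1_expand[OF finite_atLeastAtMost_int] by (auto simp: inr_def fun_eq_iff)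
  have "lin1 (M u)" unfolding lin1_def M_def Y_def YK_lin[OF lin1_Kop] Pop_lin by simp
  have "M u f i = M u (\<lambda>n. inr ?d n * f n) i"
    unfolding M_def Y_def YK_in ..
  also have "\<dots> = (\<Sum>x\<in>{0..int ?d}. f x * M u (delta1 x) i)"
    unfolding fe by (rule lin1_sum) fact
  also have "\<dots> = 0" by (rule sum.neutral) (use Mz in simp)
  finally show ?thesis by (simp add: M_def)
qed

text \<open>
  The K-operator takes the action with spectral parameter \<open>u\<close> to the one with \<open>1/u\<close>.
\<close>

lemma Kop_intertwines:
  assumes "u \<noteq> 0" "t = 1 \<or> t = - 1" and k: "k_plus B \<noteq> 0" "k_minus B \<noteq> 0"
  shows "Kop B (Suc e) u (Vop B (Suc e) t u f) = Vop B (Suc e) t (inverse u) (Kop B (Suc e) u f)"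
  using assms(1,2)
proof (induction e arbitrary: u t f)
  case 0 then show ?case by (simp add: Khop_intertwines fun_eq_iff)
next
  case (Suc e)
  note u = Suc.prems(1) and t = Suc.prems(2)
  let ?d = "Suc (Suc e)"
  define Y where "Y = YK B (Kop B (Suc e) (u * s)) (Suc e) (u * s powi (- int (Suc e))) (u\<^sup>2 * s powi (- int e))"
  have K: "Kop B ?d u h n = Fop ?d (Y h) n" for h n
    by (simp add: Y_def)
  have YE: "Y h p i = Eop ?d (Kop B ?d u h) p i" for h p i
    unfolding K
  proof (rule Eop_Fop[symmetric])
    show "Pop ?d (Y h) i = 0" if "0 \<le> i" "i < int (Suc e)" for i
      unfolding Y_def by (rule Pop_YK_Kop_zero[OF Suc.IH k that u])
    show "Y h p i = 0" if "p \<noteq> 0" "p \<noteq> 1" for p i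
      using that by (simp add: Y_def YK_def Khop_def)
    show "Y h p i = 0" if "i < 0 \<or> i > int (Suc e)" for p i
    proof -
      have "Lop (Suc e) v z p i = 0" for v z p using that by (intro Lop_out) auto
      then show ?thesis by (simp add: Y_def YK_def Khop_def)
    qed
  qed simp
  have us: "u * s \<noteq> 0" using u by simp
  have ex: "1 - int (Suc e) = - int e" by simp
  have t': "- t = 1 \<or> - t = - 1" using t by auto
  let ?h = "Vop B ?d t (inverse u) (Kop B ?d u f)"
  have H: "kB B g * inverse u powi (g * t) * cop g (- t) (s powi (g * t * int ?d)) (Suc 0) (Suc e) (\<lambda>p i. kp ?d t (p + i) * Y f p i) p i
    = Eop ?d (Xop B ?d g t (inverse u) (Kop B ?d u f)) p i" if g: "g = 1 \<or> g = -1" for g p i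
  proof -
    have "(\<lambda>p i. kp ?d t (p + i) * Y f p i) = Eop ?d (\<lambda>n. kp ?d t n * Kop B ?d u f n)"
      unfolding YE by (intro ext) (simp only: Eop_weight)
    moreover have "s powi (g * (- t)) * cop g (- t) (s powi (g * t * int ?d)) (Suc 0) (Suc e) (Eop ?d (\<lambda>n. kp ?d t n * Kop B ?d u f n)) p i
       = Eop ?d (\<lambda>n. bs ?d g n * (kp ?d t (n + g) * Kop B ?d u f (n + g))) p i"
      using Eop_cop[OF g t', of "Suc e" "\<lambda>n. kp ?d t n * Kop B ?d u f n" p i] by simp
    moreover have "s powi (g * t) * (s powi (g * (- t)) * z) = z" for z
      by (simp add: power_int_minus)
    ultimately have "cop g (- t) (s powi (g * t * int ?d)) (Suc 0) (Suc e) (\<lambda>p i. kp ?d t (p + i) * Y f p i) p i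
       = s powi (g * t) * Eop ?d (\<lambda>n. bs ?d g n * (kp ?d t (n + g) * Kop B ?d u f (n + g))) p i"
      by metis
    then show ?thesis by (simp add: Eop_def Xop_def power_int_mult_distrib algebra_simps)
  qed
  show ?case
  proof
    fix n
    have "Y (Vop B ?d t u f) = Eop ?d ?h"
    proof (intro ext)
      fix p i
      have "Y (Vop B ?d t u f) p i = Eop ?d (Xop B ?d 1 t (inverse u) (Kop B ?d u f)) p i
         + Eop ?d (Xop B ?d (-1) t (inverse u) (Kop B ?d u f)) p i + epB B t * (kp ?d (2 * t) (p + i) * Y f p i)"
        using YK_Vop[OF lin1_Kop Suc.IH[OF us t] u t, of f p i]
        unfolding ex Y_def[symmetric] H[OF disjI1[OF refl]] H[OF disjI2[OF refl]] by simp
      also have "\<dots> = Eop ?d ?h p i"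
        unfolding YE Eop_weight[symmetric] by (simp add: Vop_def Eop_def algebra_simps)
      finally show "Y (Vop B ?d t u f) p i = Eop ?d ?h p i" .
    qed
    then have 1: "Kop B ?d u (Vop B ?d t u f) n = Fop ?d (Eop ?d ?h) n" unfolding K by simp
    show "Kop B ?d u (Vop B ?d t u f) n = ?h n"
    proof (cases "0 \<le> n \<and> n \<le> int ?d")
      case True
      then show ?thesis unfolding 1 by (intro Fop_Eop) auto
    next
      case False
      then have z1: "Kop B ?d u k n = 0" for k by (intro Kop_out) auto
      have z2: "bs ?d g n * Kop B ?d u f (n + g) = 0" if g: "g = 1 \<or> g = -1" for g
      proof (cases "0 \<le> n + g \<and> n + g \<le> int ?d")
        case True
        with False g consider "n = -1" "g = 1" | "n = int ?d + 1" "g = -1" by linarith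
        then have "bs ?d g n = 0" using b_top[of ?d] by cases (simp_all add: bs_def)
        then show ?thesis by simp
      next
        case F: False
        then have "Kop B ?d u f (n + g) = 0" by (intro Kop_out) auto
        then show ?thesis by simp
      qed
      have "Xop B ?d g t (inverse u) (Kop B ?d u f) n = 0" if "g = 1 \<or> g = -1" for g
        using z2[OF that] by (auto simp: Xop_def)
      then have "?h n = epB B t * kp ?d (2 * t) n * Kop B ?d u f n" unfolding Vop_def by (simp del: Kop.simps)
      then show ?thesis unfolding z1 by simp
    qed
  qed
qed

end

section \<open>The double row\<close>

text \<open>
  The double row \<open>R\<^sub>N\<^sub>a \<cdots> R\<^sub>1\<^sub>a K\<^sub>a R\<^sub>1\<^sub>a \<cdots> R\<^sub>N\<^sub>a\<close>.  The list holds the indices of the sites \<open>N, \<dots>, 1\<close>, site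
  \<open>N\<close> first, and the last argument is the index of the auxiliary space.
\<close>

fun chain :: "((int \<Rightarrow> int \<Rightarrow> complex) \<Rightarrow> int \<Rightarrow> int \<Rightarrow> complex) \<Rightarrow> ((int \<Rightarrow> complex) \<Rightarrow> int \<Rightarrow> complex)
    \<Rightarrow> nat \<Rightarrow> (int list \<Rightarrow> int \<Rightarrow> complex) \<Rightarrow> int list \<Rightarrow> int \<Rightarrow> complex" where
  "chain R K 0 f xs a = K (f xs) a"
| "chain R K (Suc N) f xs a =
     R (\<lambda>i c. chain R K N (\<lambda>ys e. R (\<lambda>k b. f (k # ys) b) i e) (tl xs) c) (hd xs) a"

lemma chain_lin:
  assumes R: "lin2 R" and K: "lin1 K"
  shows "chain R K N (\<lambda>ys b. c * f ys b + e * g ys b) xs a = c * chain R K N f xs a + e * chain R K N g xs a"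
proof (induction N arbitrary: f g xs a)
  case 0 then show ?case by (simp add: lin1D[OF K])
next
  case (Suc N)
  have R': "R (\<lambda>n a. c * f n a + e * g n a) = (\<lambda>n a. c * R f n a + e * R g n a)" for c e f g
    by (intro ext) (rule lin2D[OF R])
  show ?case unfolding chain.simps R' Suc ..
qed

lemma chain_lin3:
  assumes R: "lin2 R" and K: "lin1 K"
  shows "chain R K N (\<lambda>ys b. c1 * h1 ys b + c2 * h2 ys b + c3 * h3 ys b) xs a
    = c1 * chain R K N h1 xs a + c2 * chain R K N h2 xs a + c3 * chain R K N h3 xs a"
  using chain_lin[OF assms, of N 1 "\<lambda>ys b. c1 * h1 ys b + c2 * h2 ys b" c3 h3] chain_lin[OF assms, of N c1 h1 c2 h2] by simp

context generic_q begin

text \<open>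
  The ladder operator \<open>X(u)\<close>.
\<close>

definition Aop :: "boundary \<Rightarrow> nat \<Rightarrow> int \<Rightarrow> complex \<Rightarrow> (int \<Rightarrow> complex) \<Rightarrow> int \<Rightarrow> complex" where
  "Aop B d t u f n = Xop B d 1 t u f n + Xop B d (- 1) t u f n"

text \<open>
  The operators \<open>W\<^sub>0\<close> (\<open>t = 1\<close>) and \<open>W\<^sub>1\<close> (\<open>t = - 1\<close>) on a chain of \<open>N\<close> sites.
\<close>

fun Wch :: "boundary \<Rightarrow> nat \<Rightarrow> int \<Rightarrow> nat \<Rightarrow> (int list \<Rightarrow> complex) \<Rightarrow> int list \<Rightarrow> complex" where
  "Wch B d t 0 f xs = epB B t * f xs"
| "Wch B d t (Suc N) f xs = Aop B d t 1 (\<lambda>k. f (k # tl xs)) (hd xs)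
     + kp d (2 * t) (hd xs) * Wch B d t N (\<lambda>ys. f (hd xs # ys)) (tl xs)"

text \<open>
  The matrix entries of \<open>X(u)\<close>.
\<close>

definition cA where "cA B d g t u n = kB B g * (s * u) powi (g * t) * bs d g n * kp d t (n + g)"

lemma Aop_eq: "Aop B d t u f n = cA B d 1 t u n * f (n + 1) + cA B d (-1) t u n * f (n + -1)"
  by (simp add: Aop_def Xop_def cA_def)

lemma Wch_lin: "Wch B d t N (\<lambda>zs. c * f zs + e * g zs) xs = c * Wch B d t N f xs + e * Wch B d t N g xs"
  by (induction N arbitrary: f g xs) (simp_all add: Aop_eq algebra_simps)

lemma Wch_scale: "Wch B d t N (\<lambda>zs. c * f zs) xs = c * Wch B d t N f xs"
  using Wch_lin[of B d t N c f 0 f] by simp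

lemma Wch_sum: "Wch B d t N (\<lambda>zs. \<Sum>x\<in>I. c x * F x zs) xs = (\<Sum>x\<in>I. c x * Wch B d t N (F x) xs)"
proof (induction I rule: infinite_finite_induct)
  case (insert x I)
  then show ?case using Wch_lin[of B d t N "c x" "F x" 1 "\<lambda>zs. \<Sum>x\<in>I. c x * F x zs"] by simp
qed (use Wch_lin[of B d t N 0 "\<lambda>n. 0" 0 "\<lambda>n. 0"] in simp_all)

lemma Wch_comm:
  assumes R: "lin2 R"
  shows "R (\<lambda>k b. Wch B d t N (\<lambda>zs. F zs k b) ys) i e = Wch B d t N (\<lambda>zs. R (F zs) i e) ys"
proof (induction N arbitrary: F ys)
  case 0 then show ?case by (simp add: lin2_scale[OF R])
next
  case (Suc N)
  show ?case by (simp only: Wch.simps Aop_eq lin2D3[OF R] Suc)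
qed

lemma R_weight2:
  assumes "weighted R"
  shows "R (\<lambda>i a. kp d t i * kp d t a * h i a) i a = kp d t i * kp d t a * R h i a"
proof -
  have "kp d t i * kp d t a = s powi (t * (int d + int d - 2 * (i + a)))" for i a
    by (simp only: kp_def powi_add[symmetric]) (simp add: algebra_simps)
  then show ?thesis using assms[unfolded weighted_def, rule_format, of "\<lambda>k. s powi (t * (int d + int d - 2 * k))"] by simp
qed

text \<open>
  Both sides of the exchange at one site are coproducts of the ladder operators, applied after
  \<open>q\<^sup>t\<^sup>S\<^sup>3\<^sup>/\<^sup>2 \<otimes> q\<^sup>t\<^sup>S\<^sup>3\<^sup>/\<^sup>2\<close>.
\<close>

lemma Xop_site_aux:
  assumes x: "(s * v) powi (g * t) * x = s powi (g * t)"
  shows "Xop B d g t v (h i) a + kp d (2 * t) a * Xop B d g t 1 (\<lambda>i. h i a) i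
     = (kB B g * (s * v) powi (g * t)) * cop g (- t) x d d (\<lambda>i a. kp d t i * kp d t a * h i a) i a" (is ?out)
    and "kp d (2 * t) i * Xop B d g t v (h i) a + Xop B d g t 1 (\<lambda>i. h i a) i
     = (kB B g * (s * v) powi (g * t)) * cop g t x d d (\<lambda>i a. kp d t i * kp d t a * h i a) i a" (is ?in)
proof -
  let ?k = "\<lambda>i a. kp d t i * kp d t a * h i a"
  have "(kB B g * (s * v) powi (g * t)) * cop g (- t) x d d ?k i a
    = kB B g * ((s * v) powi (g * t) * x) * bs d g i * (kp d t a * kp d t a) * kp d t (i + g) * h (i + g) a
     + (kB B g * (s * v) powi (g * t)) * (kp d (- t) i * kp d t i) * bs d g a * kp d t (a + g) * h i (a + g)"
    by (simp add: cop_def algebra_simps)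
  then show ?out unfolding x kp_unit kp_double by (simp add: Xop_def algebra_simps)
  have "(kB B g * (s * v) powi (g * t)) * cop g t x d d ?k i a
    = kB B g * ((s * v) powi (g * t) * x) * bs d g i * (kp d (- t) a * kp d t a) * kp d t (i + g) * h (i + g) a
     + (kB B g * (s * v) powi (g * t)) * (kp d t i * kp d t i) * bs d g a * kp d t (a + g) * h i (a + g)"
    by (simp add: cop_def algebra_simps)
  then show ?in unfolding x kp_unit kp_double by (simp add: Xop_def algebra_simps)
qed

text \<open>
  The two ways in which the R-matrix moves the auxiliary space past a site.
\<close>

lemma R_move_in:
  assumes R: "lin2 R" "weighted R"
    and Rc: "\<And>g t f. g = 1 \<or> g = -1 \<Longrightarrow> t = 1 \<or> t = -1 \<Longrightarrow> R (cop g t (u powi (g * t)) d d f) = cop g (- t) (u powi (g * t)) d d (R f)"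
    and u: "u \<noteq> 0" and t: "t = 1 \<or> t = - 1"
  shows "R (\<lambda>i a. Aop B d t u (h i) a + kp d (2 * t) a * Aop B d t 1 (\<lambda>i. h i a) i) i a
    = kp d (2 * t) i * Aop B d t u (R h i) a + Aop B d t 1 (\<lambda>i. R h i a) i"
proof -
  let ?k = "\<lambda>h i a. kp d t i * kp d t a * h i a"
  have W: "R (?k h) = ?k (R h)" by (intro ext) (rule R_weight2[OF R(2)])
  have "(s * u) powi (g * t) * u powi (g * (- t)) = s powi (g * t)" for g
    using u by (simp add: power_int_mult_distrib power_int_minus)
  note X = Xop_site_aux[OF this, where B = B and d = d]
  have t': "- t = 1 \<or> - t = - 1" using t by auto
  have "R (\<lambda>i a. Aop B d t u (h i) a + kp d (2 * t) a * Aop B d t 1 (\<lambda>i. h i a) i) i a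
     = R (\<lambda>i a. (kB B 1 * (s * u) powi (1 * t)) * cop 1 (- t) (u powi (1 * (- t))) d d (?k h) i a
        + (kB B (-1) * (s * u) powi (-1 * t)) * cop (-1) (- t) (u powi (-1 * (- t))) d d (?k h) i a) i a"
    unfolding X(1)[symmetric] Aop_def by (simp add: algebra_simps)
  also have "\<dots> = kp d (2 * t) i * Aop B d t u (R h i) a + Aop B d t 1 (\<lambda>i. R h i a) i"
    unfolding lin2D[OF R(1)] Rc[OF disjI1[OF refl] t'] Rc[OF disjI2[OF refl] t'] W minus_minus[of t] X(2)[symmetric]
    by (simp add: Aop_def algebra_simps)
  finally show ?thesis .
qed

lemma R_move_out:
  assumes R: "lin2 R" "weighted R"
    and Rc: "\<And>g t f. g = 1 \<or> g = -1 \<Longrightarrow> t = 1 \<or> t = -1 \<Longrightarrow> R (cop g t (u powi (g * t)) d d f) = cop g (- t) (u powi (g * t)) d d (R f)"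
    and u: "u \<noteq> 0" and t: "t = 1 \<or> t = - 1"
  shows "R (\<lambda>i a. kp d (2 * t) i * Aop B d t (inverse u) (h i) a + Aop B d t 1 (\<lambda>i. h i a) i) i a
    = Aop B d t (inverse u) (R h i) a + kp d (2 * t) a * Aop B d t 1 (\<lambda>i. R h i a) i"
proof -
  let ?k = "\<lambda>h i a. kp d t i * kp d t a * h i a"
  let ?u = "inverse u"
  have W: "R (?k h) = ?k (R h)" by (intro ext) (rule R_weight2[OF R(2)])
  have "(s * ?u) powi (g * t) * u powi (g * t) = s powi (g * t)" for g
    using u by (simp add: power_int_mult_distrib power_int_inverse)
  note X = Xop_site_aux[OF this, where B = B and d = d]
  have "R (\<lambda>i a. kp d (2 * t) i * Aop B d t ?u (h i) a + Aop B d t 1 (\<lambda>i. h i a) i) i a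
     = R (\<lambda>i a. (kB B 1 * (s * ?u) powi (1 * t)) * cop 1 t (u powi (1 * t)) d d (?k h) i a
        + (kB B (-1) * (s * ?u) powi (-1 * t)) * cop (-1) t (u powi (-1 * t)) d d (?k h) i a) i a"
    unfolding X(2)[symmetric] Aop_def by (simp add: algebra_simps)
  also have "\<dots> = Aop B d t ?u (R h i) a + kp d (2 * t) a * Aop B d t 1 (\<lambda>i. R h i a) i"
    unfolding lin2D[OF R(1)] Rc[OF disjI1[OF refl] t] Rc[OF disjI2[OF refl] t] W X(1)[symmetric]
    by (simp add: Aop_def algebra_simps)
  finally show ?thesis .
qed

text \<open>
  With \<open>T\<close> the double row, this is
  \<open>T (X\<^sub>a(u) + q\<^sup>t\<^sup>S\<^sup>3\<^sup>,\<^sup>a W) = (X\<^sub>a(1/u) + q\<^sup>t\<^sup>S\<^sup>3\<^sup>,\<^sup>a W) T\<close>.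
\<close>

lemma chain_intertwines:
  assumes R: "lin2 R" "weighted R"
    and Rc: "\<And>g t f. g = 1 \<or> g = -1 \<Longrightarrow> t = 1 \<or> t = -1 \<Longrightarrow> R (cop g t (u powi (g * t)) d d f) = cop g (- t) (u powi (g * t)) d d (R f)"
    and K: "lin1 K" and KV: "\<And>f. K (Vop B d t u f) = Vop B d t (inverse u) (K f)"
    and u: "u \<noteq> 0" and t: "t = 1 \<or> t = - 1"
  shows "chain R K N (\<lambda>ys b. Aop B d t u (f ys) b + kp d (2 * t) b * Wch B d t N (\<lambda>zs. f zs b) ys) xs a
    = Aop B d t (inverse u) (chain R K N f xs) a + kp d (2 * t) a * Wch B d t N (\<lambda>zs. chain R K N f zs a) xs"
proof (induction N arbitrary: f xs a)
  case 0
  have V: "Vop B d t v g = (\<lambda>b. Aop B d t v g b + kp d (2 * t) b * (epB B t * g b))" for v g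
    by (simp add: Vop_def Aop_def fun_eq_iff algebra_simps)
  show ?case using KV[of "f xs"] unfolding V by (simp add: fun_eq_iff)
next
  case (Suc N)
  let ?G = "\<lambda>i ys e. R (\<lambda>k b. f (k # ys) b) i e"
  let ?C = "\<lambda>i ys c. chain R K N (?G i) ys c"
  let ?u = "inverse u"
  define k where "k = kp d (2 * t)"
  have 1: "R (\<lambda>k' b. Aop B d t u (f (k' # ys)) b + k b * Wch B d t (Suc N) (\<lambda>zs. f zs b) (k' # ys)) i e
     = cA B d 1 t 1 i * ?G (i + 1) ys e + cA B d (-1) t 1 i * ?G (i + -1) ys e
       + k i * (Aop B d t u (?G i ys) e + k e * Wch B d t N (\<lambda>zs. ?G i zs e) ys)" for i ys e
  proof -
    have "R (\<lambda>k' b. Aop B d t u (f (k' # ys)) b + k b * Wch B d t (Suc N) (\<lambda>zs. f zs b) (k' # ys)) i e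
      = R (\<lambda>k' b. 1 * (Aop B d t u (f (k' # ys)) b + k b * Aop B d t 1 (\<lambda>k'. f (k' # ys) b) k')
         + 1 * (k k' * k b * Wch B d t N (\<lambda>zs. f (k' # zs) b) ys)) i e"
      by (simp add: k_def algebra_simps)
    also have "\<dots> = (k i * Aop B d t u (?G i ys) e + Aop B d t 1 (\<lambda>i. ?G i ys e) i)
       + k i * k e * Wch B d t N (\<lambda>zs. ?G i zs e) ys"
      using R_move_in[OF R Rc u t, of B "\<lambda>k' b. f (k' # ys) b" i e]
      unfolding lin2D[OF R(1)] k_def R_weight2[OF R(2)] Wch_comm[OF R(1)] by simp
    finally show ?thesis unfolding Aop_eq[of _ _ _ 1] by (simp add: algebra_simps)
  qed
  have 2: "chain R K N (\<lambda>ys e. R (\<lambda>k' b. Aop B d t u (f (k' # ys)) b + k b * Wch B d t (Suc N) (\<lambda>zs. f zs b) (k' # ys)) i e) ys c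
     = (k i * Aop B d t ?u (?C i ys) c + Aop B d t 1 (\<lambda>i. ?C i ys c) i) + k i * k c * Wch B d t N (\<lambda>zs. ?C i zs c) ys" for i ys c
    unfolding 1 chain_lin3[OF R(1) K]
    unfolding k_def Suc.IH Aop_eq[of _ _ _ 1] by (simp add: algebra_simps)
  have 3: "chain R K (Suc N) (\<lambda>ys b. Aop B d t u (f ys) b + k b * Wch B d t (Suc N) (\<lambda>zs. f zs b) ys) xs a
     = R (\<lambda>i c. 1 * (k i * Aop B d t ?u (?C i (tl xs)) c + Aop B d t 1 (\<lambda>i. ?C i (tl xs) c) i)
         + 1 * (k i * k c * Wch B d t N (\<lambda>zs. ?C i zs c) (tl xs))) (hd xs) a"
    unfolding chain.simps 2 by simp
  have C: "chain R K (Suc N) f xs a = R (\<lambda>i c. ?C i (tl xs) c) (hd xs) a" for xs a by simp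
  have 4: "R (\<lambda>i c. k i * Aop B d t ?u (?C i (tl xs)) c + Aop B d t 1 (\<lambda>i. ?C i (tl xs) c) i) (hd xs) a
      = Aop B d t ?u (R (\<lambda>i c. ?C i (tl xs) c) (hd xs)) a + k a * Aop B d t 1 (\<lambda>i. R (\<lambda>i c. ?C i (tl xs) c) i a) (hd xs)"
    unfolding k_def by (rule R_move_out[OF R Rc u t])
  show ?case unfolding k_def[symmetric] 3
    unfolding lin2D[OF R(1)] 4 Wch.simps
    unfolding k_def R_weight2[OF R(2)] Wch_comm[OF R(1)]
    by (simp add: algebra_simps)
qed

end

section \<open>The trace over the auxiliary space\<close>

lemma sum_shift_int:
  fixes \<phi> :: "int \<Rightarrow> complex"
  assumes "\<And>a. (a \<in> {0..d}) \<noteq> (a + g \<in> {0..d}) \<Longrightarrow> \<phi> a = 0"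
  shows "(\<Sum>a\<in>{0..d}. \<phi> (a - g)) = (\<Sum>a\<in>{0..d}. \<phi> a)"
proof -
  let ?J = "{- g..d - g}"
  have "(\<Sum>a\<in>{0..d}. \<phi> (a - g)) = (\<Sum>a\<in>?J. \<phi> a)"
    by (rule sum.reindex_bij_witness[of _ "\<lambda>a. a + g" "\<lambda>a. a - g"]) auto
  also have "\<dots> = (\<Sum>a\<in>?J \<inter> {0..d}. \<phi> a)"
    by (rule sum.mono_neutral_right) (use assms in auto)
  also have "\<dots> = (\<Sum>a\<in>{0..d}. \<phi> a)"
    by (rule sum.mono_neutral_left) (use assms in auto)
  finally show ?thesis .
qed

text \<open>
  The partial trace over the auxiliary space of \<open>D\<^sub>a T\<close>, where \<open>D\<close> is a diagonal matrix.
\<close>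

definition trop where
  "trop D d T f xs = (\<Sum>a\<in>{0..int d}. D a * T (\<lambda>ys b. of_bool (b = a) * f ys) xs a)"

context generic_q begin

text \<open>
  After division by \<open>q\<^sup>t\<^sup>S\<^sup>3\<^sup>,\<^sup>a\<close>, the trace of \<open>chain_intertwines\<close> is the commutator with \<open>W\<close> plus sums over
  entries of \<open>T\<close> next to the diagonal, with coefficients \<open>?P t a\<close> and \<open>?M t a\<close>.  The condition on
  \<open>D\<close> says that these coefficients cancel in the given combination of \<open>t = 1\<close> and \<open>t = - 1\<close>.
\<close>

lemma trop_commutes:
  fixes D :: "int \<Rightarrow> complex" and be1 be2 :: complex
  assumes R: "lin2 R" "weighted R"
    and Rc: "\<And>g t f. g = 1 \<or> g = -1 \<Longrightarrow> t = 1 \<or> t = -1 \<Longrightarrow> R (cop g t (u powi (g * t)) d d f) = cop g (- t) (u powi (g * t)) d d (R f)"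
    and K: "lin1 K" and KV: "\<And>t f. t = 1 \<or> t = -1 \<Longrightarrow> K (Vop B d t u f) = Vop B d t (inverse u) (K f)"
    and u: "u \<noteq> 0"
    and D: "\<And>n. 0 \<le> n \<Longrightarrow> n < int d \<Longrightarrow>
       D n * (be1 * inverse u * inverse s * kp d (-1) n + be2 * u * s * kp d 1 n)
       = D (n + 1) * (be1 * u * s ^ 3 * kp d (-1) n + be2 * inverse u * inverse (s ^ 3) * kp d 1 n)"
  shows "trop D d (chain R K N) (\<lambda>zs. be1 * Wch B d 1 N f zs + be2 * Wch B d (-1) N f zs) xs
    = be1 * Wch B d 1 N (trop D d (chain R K N) f) xs + be2 * Wch B d (-1) N (trop D d (chain R K N) f) xs"
proof -
  define T where "T a = chain R K N (\<lambda>ys b. of_bool (b = a) * f ys) xs" for a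
  let ?u = "inverse u" and ?I = "{0..int d}"
  let ?P = "\<lambda>t a. D a * kp d (- (2 * t)) a * cA B d 1 t ?u a - D (a + 1) * kp d (- (2 * t)) (a + 1) * cA B d 1 t u a"
  let ?M = "\<lambda>t a. D a * kp d (- (2 * t)) a * cA B d (-1) t ?u a - D (a - 1) * kp d (- (2 * t)) (a - 1) * cA B d (-1) t u a"
  have main: "trop D d (chain R K N) (Wch B d t N f) xs = Wch B d t N (trop D d (chain R K N) f) xs
     + (\<Sum>a\<in>?I. ?P t a * T a (a + 1))
     + (\<Sum>a\<in>?I. ?M t a * T a (a - 1))"
    if t: "t = 1 \<or> t = -1" for t
  proof -
    have one: "D a * chain R K N (\<lambda>ys b. of_bool (b = a) * Wch B d t N f ys) xs a
       = D a * Wch B d t N (\<lambda>zs. chain R K N (\<lambda>ys b. of_bool (b = a) * f ys) zs a) xs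
        + D a * kp d (- (2 * t)) a * (cA B d 1 t ?u a * T a (a + 1) + cA B d (-1) t ?u a * T a (a - 1))
        - D a * kp d (- (2 * t)) a * (cA B d 1 t u (a - 1) * T (a - 1) a + cA B d (-1) t u (a + 1) * T (a + 1) a)" for a
    proof -
      let ?F = "\<lambda>ys b. of_bool (b = a) * f ys :: complex"
      have L: "(\<lambda>ys b. Aop B d t u (?F ys) b + kp d (2 * t) b * Wch B d t N (\<lambda>zs. ?F zs b) ys)
         = (\<lambda>ys b. cA B d 1 t u (a - 1) * (of_bool (b = a - 1) * f ys) + cA B d (-1) t u (a + 1) * (of_bool (b = a + 1) * f ys)
              + kp d (2 * t) a * (of_bool (b = a) * Wch B d t N f ys))"
        by (auto simp: fun_eq_iff Aop_eq Wch_scale)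
      have X: "cA B d 1 t u (a - 1) * T (a - 1) a + cA B d (-1) t u (a + 1) * T (a + 1) a
           + kp d (2 * t) a * chain R K N (\<lambda>ys b. of_bool (b = a) * Wch B d t N f ys) xs a
         = (cA B d 1 t ?u a * T a (a + 1) + cA B d (-1) t ?u a * T a (a - 1))
           + kp d (2 * t) a * Wch B d t N (\<lambda>zs. chain R K N ?F zs a) xs"
        using chain_intertwines[OF R Rc K KV[OF t] u t, of N ?F xs a]
        unfolding L chain_lin3[OF R(1) K] by (simp add: T_def Aop_eq)
      have "kp d (- (2 * t)) a * kp d (2 * t) a * chain R K N (\<lambda>ys b. of_bool (b = a) * Wch B d t N f ys) xs a
         = kp d (- (2 * t)) a * kp d (2 * t) a * Wch B d t N (\<lambda>zs. chain R K N ?F zs a) xs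
          + kp d (- (2 * t)) a * (cA B d 1 t ?u a * T a (a + 1) + cA B d (-1) t ?u a * T a (a - 1))
          - kp d (- (2 * t)) a * (cA B d 1 t u (a - 1) * T (a - 1) a + cA B d (-1) t u (a + 1) * T (a + 1) a)"
        using arg_cong[OF X, of "\<lambda>z. kp d (- (2 * t)) a * z"] by (simp add: algebra_simps)
      then have e: "chain R K N (\<lambda>ys b. of_bool (b = a) * Wch B d t N f ys) xs a
         = Wch B d t N (\<lambda>zs. chain R K N ?F zs a) xs
          + kp d (- (2 * t)) a * (cA B d 1 t ?u a * T a (a + 1) + cA B d (-1) t ?u a * T a (a - 1))
          - kp d (- (2 * t)) a * (cA B d 1 t u (a - 1) * T (a - 1) a + cA B d (-1) t u (a + 1) * T (a + 1) a)"
        unfolding kp_unit by simp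
      show ?thesis unfolding e by (simp add: algebra_simps)
    qed
    \<comment> \<open>A shift of the summation index brings the terms with \<open>X\<^sub>a(u)\<close> to the same entries of \<open>T\<close> as those with \<open>X\<^sub>a(1/u)\<close>.\<close>
    let ?p = "\<lambda>a. D (a + 1) * kp d (- (2 * t)) (a + 1) * cA B d 1 t u a * T a (a + 1)"
    let ?m = "\<lambda>a. D (a - 1) * kp d (- (2 * t)) (a - 1) * cA B d (-1) t u a * T a (a - 1)"
    have S1: "(\<Sum>a\<in>?I. ?p (a - 1)) = (\<Sum>a\<in>?I. ?p a)"
    proof (rule sum_shift_int)
      fix a assume "(a \<in> ?I) \<noteq> (a + 1 \<in> ?I)"
      then have "a = -1 \<or> a = int d" by auto
      then show "?p a = 0" by (auto simp: cA_def bs_def)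
    qed
    have S2: "(\<Sum>a\<in>?I. ?m (a - -1)) = (\<Sum>a\<in>?I. ?m a)"
    proof (rule sum_shift_int)
      fix a assume "(a \<in> ?I) \<noteq> (a + -1 \<in> ?I)"
      then have "a = 0 \<or> a = int d + 1" by auto
      then show "?m a = 0" by (auto simp: cA_def bs_def)
    qed
    have "trop D d (chain R K N) (Wch B d t N f) xs
      = (\<Sum>a\<in>?I. D a * Wch B d t N (\<lambda>zs. chain R K N (\<lambda>ys b. of_bool (b = a) * f ys) zs a) xs)
       + (\<Sum>a\<in>?I. D a * kp d (- (2 * t)) a * (cA B d 1 t ?u a * T a (a + 1)))
       + (\<Sum>a\<in>?I. D a * kp d (- (2 * t)) a * (cA B d (-1) t ?u a * T a (a - 1)))
       - (\<Sum>a\<in>?I. ?p (a - 1)) - (\<Sum>a\<in>?I. ?m (a - -1))"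
      unfolding trop_def one sum.distrib[symmetric] sum_subtractf[symmetric]
      by (intro sum.cong refl) (simp add: algebra_simps)
    also have "(\<Sum>a\<in>?I. D a * Wch B d t N (\<lambda>zs. chain R K N (\<lambda>ys b. of_bool (b = a) * f ys) zs a) xs)
       = Wch B d t N (trop D d (chain R K N) f) xs"
      unfolding trop_def[abs_def] Wch_sum ..
    finally show ?thesis unfolding S1 S2
      by (simp add: sum.distrib sum_subtractf algebra_simps)
  qed
  have vals: "kp d (- (2 * 1)) n = inverse (kp d 1 n * kp d 1 n)" "kp d (- (2 * -1)) n = kp d 1 n * kp d 1 n"
    "kp d (- (2 * 1)) (n + 1) = inverse (kp d 1 n * kp d 1 n) * s ^ 4" "kp d (- (2 * -1)) (n + 1) = kp d 1 n * kp d 1 n * inverse (s ^ 4)"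
    "kp d 1 (n + 1) = kp d 1 n * inverse (s ^ 2)" "kp d (-1) (n + 1) = inverse (kp d 1 n) * s ^ 2" "kp d (-1) n = inverse (kp d 1 n)" for n
  proof -
    have kk: "kp d t (n + 1) = kp d t n * s powi (- (2 * t))" for t n
      by (simp only: kp_def powi_add[symmetric]) (simp add: algebra_simps)
    have inv: "kp d (-1) n = inverse (kp d 1 n)" for n
      by (simp add: kp_def power_int_minus[symmetric])
    have dbl: "kp d (- (2 * 1)) n = kp d (-1) n * kp d (-1) n" "kp d (- (2 * -1)) n = kp d 1 n * kp d 1 n" for n
      using kp_double[of d "-1" n] kp_double[of d 1 n] by simp_all
    have k1: "kp d 1 (n + 1) = kp d 1 n * inverse (s ^ 2)" "kp d (-1) (n + 1) = inverse (kp d 1 n) * s ^ 2" for n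
      unfolding kk inv by (simp_all add: power_int_minus)
    show "kp d (- (2 * 1)) n = inverse (kp d 1 n * kp d 1 n)" "kp d (- (2 * -1)) n = kp d 1 n * kp d 1 n"
      "kp d (- (2 * 1)) (n + 1) = inverse (kp d 1 n * kp d 1 n) * s ^ 4" "kp d (- (2 * -1)) (n + 1) = kp d 1 n * kp d 1 n * inverse (s ^ 4)"
      "kp d 1 (n + 1) = kp d 1 n * inverse (s ^ 2)" "kp d (-1) (n + 1) = inverse (kp d 1 n) * s ^ 2" "kp d (-1) n = inverse (kp d 1 n)"
      unfolding dbl k1 inv by (simp_all add: power2_eq_square power4_eq_xxxx)
  qed
  have k0: "kp d 1 n \<noteq> 0" for n by (simp add: kp_def)
  have cp: "be1 * ?P 1 a
     + be2 * ?P (-1) a = 0"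
    if "a \<in> ?I" for a
  proof (cases "a = int d")
    case True then show ?thesis by (simp add: cA_def bs_def)
  next
    case False
    then have a: "0 \<le> a" "a < int d" using that by auto
    have "be1 * ?P 1 a
     + be2 * ?P (-1) a
     = kB B 1 * b d a * (D a * (be1 * inverse u * inverse s * kp d (-1) a + be2 * u * s * kp d 1 a)
       - D (a + 1) * (be1 * u * s ^ 3 * kp d (-1) a + be2 * inverse u * inverse (s ^ 3) * kp d 1 a))"
      unfolding cA_def vals using u k0[of a] by (simp add: bs_def power_int_minus field_simps power2_eq_square power3_eq_cube power4_eq_xxxx)
    then show ?thesis using D[OF a] by simp
  qed
  have cm: "be1 * ?M 1 a
     + be2 * ?M (-1) a = 0"
    if "a \<in> ?I" for a
  proof (cases "a = 0")
    case True then show ?thesis by (simp add: cA_def bs_def)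
  next
    case False
    define n where "n = a - 1"
    have a: "a = n + 1" "0 \<le> n" "n < int d" using that False by (auto simp: n_def)
    have "be1 * ?M 1 a
     + be2 * ?M (-1) a
     = - (kB B (-1) * b d n * (D n * (be1 * inverse u * inverse s * kp d (-1) n + be2 * u * s * kp d 1 n)
       - D (n + 1) * (be1 * u * s ^ 3 * kp d (-1) n + be2 * inverse u * inverse (s ^ 3) * kp d 1 n)))"
      unfolding cA_def a(1) vals using u k0[of n] by (simp add: bs_def power_int_minus vals(7) field_simps power2_eq_square power3_eq_cube power4_eq_xxxx)
    then show ?thesis using D[OF a(2,3)] by simp
  qed
  have lin: "trop D d (chain R K N) (\<lambda>zs. c * f1 zs + e * f2 zs) xs = c * trop D d (chain R K N) f1 xs + e * trop D d (chain R K N) f2 xs" for c e f1 f2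
  proof -
    have "chain R K N (\<lambda>ys b. of_bool (b = a) * (c * f1 ys + e * f2 ys)) xs a
       = c * chain R K N (\<lambda>ys b. of_bool (b = a) * f1 ys) xs a + e * chain R K N (\<lambda>ys b. of_bool (b = a) * f2 ys) xs a" for a
      unfolding chain_lin[OF R(1) K, symmetric] by (simp add: algebra_simps)
    then show ?thesis unfolding trop_def sum_distrib_left sum.distrib[symmetric]
      by (intro sum.cong refl) (simp add: algebra_simps)
  qed
  have "be1 * (\<Sum>a\<in>?I. ?P 1 a * T a (a + 1)) + be2 * (\<Sum>a\<in>?I. ?P (-1) a * T a (a + 1)) = (\<Sum>a\<in>?I. (be1 * ?P 1 a + be2 * ?P (-1) a) * T a (a + 1))"
    unfolding sum_distrib_left sum.distrib[symmetric] by (intro sum.cong refl) (simp only: algebra_simps)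
  also have "\<dots> = 0" by (rule sum.neutral) (use cp in simp)
  finally have z1: "be1 * (\<Sum>a\<in>?I. ?P 1 a * T a (a + 1)) + be2 * (\<Sum>a\<in>?I. ?P (-1) a * T a (a + 1)) = 0" .
  have "be1 * (\<Sum>a\<in>?I. ?M 1 a * T a (a - 1)) + be2 * (\<Sum>a\<in>?I. ?M (-1) a * T a (a - 1)) = (\<Sum>a\<in>?I. (be1 * ?M 1 a + be2 * ?M (-1) a) * T a (a - 1))"
    unfolding sum_distrib_left sum.distrib[symmetric] by (intro sum.cong refl) (simp only: algebra_simps)
  also have "\<dots> = 0" by (rule sum.neutral) (use cm in simp)
  finally have z2: "be1 * (\<Sum>a\<in>?I. ?M 1 a * T a (a - 1)) + be2 * (\<Sum>a\<in>?I. ?M (-1) a * T a (a - 1)) = 0" .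
  have "trop D d (chain R K N) (\<lambda>zs. be1 * Wch B d 1 N f zs + be2 * Wch B d (-1) N f zs) xs
    = be1 * Wch B d 1 N (trop D d (chain R K N) f) xs + be2 * Wch B d (-1) N (trop D d (chain R K N) f) xs
     + (be1 * (\<Sum>a\<in>?I. ?P 1 a * T a (a + 1)) + be2 * (\<Sum>a\<in>?I. ?P (-1) a * T a (a + 1)))
     + (be1 * (\<Sum>a\<in>?I. ?M 1 a * T a (a - 1)) + be2 * (\<Sum>a\<in>?I. ?M (-1) a * T a (a - 1)))"
    unfolding lin main[OF disjI1[OF refl]] main[OF disjI2[OF refl]] distrib_left by (simp only: add_ac)
  then show ?thesis unfolding z1 z2 by simp
qed

section \<open>Diagonal K-operators\<close>

text \<open>
  If \<open>k\<^sub>+ = k\<^sub>- = 0\<close>, the K-operator of spin \<open>d/2\<close> is diagonal.  Its entries are products of the factors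
  \<open>gg\<close> and \<open>hh\<close>, which are the two entries of the spin-1/2 K-matrix with arguments shifted by powers
  \<open>yy\<close> of \<open>q\<close>.
\<close>

definition yy :: "nat \<Rightarrow> nat \<Rightarrow> complex" where "yy d r = s powi (int d - 1 - 2 * int r)"

definition gg where "gg B d w r = eps_plus B * w * yy d r + eps_minus B * inverse (w * yy d r)"

definition hh where "hh B d w r = eps_plus B * yy d r * inverse w + eps_minus B * w * inverse (yy d r)"

text \<open>
  The diagonal entries of the K-operator with \<open>k\<^sub>+ = k\<^sub>- = 0\<close>, up to the common factor \<open>cc\<close>.
\<close>

definition Kd where "Kd B d w n = (\<Prod>r<n. hh B d w r) * (\<Prod>r\<in>{n..<d}. gg B d w r)"

definition cc where "cc d w = (\<Prod>n<d - 1. cfun (w\<^sup>2 * s powi (2 + 2 * int n)))"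

lemma gg_shift: "gg B (Suc e) (w * s) r = gg B (Suc (Suc e)) w r"
  by (simp add: gg_def yy_def power_int_diff power_int_add field_simps)

lemma hh_shift: "hh B (Suc e) (w * s) r = hh B (Suc (Suc e)) w (Suc r)"
  by (simp add: hh_def yy_def power_int_diff power_int_add powi_double power_int_minus field_simps power2_eq_square)

lemma cc_Suc: "cc (Suc (Suc e)) w = cfun (w\<^sup>2 * s\<^sup>2) * cc (Suc e) (w * s)"
proof -
  have "(w * s)\<^sup>2 * s powi (2 + 2 * int n) = w\<^sup>2 * s powi (2 + 2 * int (Suc n))" for n
    by (simp add: power_int_add power_mult_distrib power2_eq_square power4_eq_xxxx algebra_simps)
  then have "cc (Suc e) (w * s) = (\<Prod>n<e. cfun (w\<^sup>2 * s powi (2 + 2 * int (Suc n))))"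
    unfolding cc_def by simp
  moreover have "cc (Suc (Suc e)) w = cfun (w\<^sup>2 * s powi (2 + 2 * int 0)) * (\<Prod>n<e. cfun (w\<^sup>2 * s powi (2 + 2 * int (Suc n))))"
    unfolding cc_def diff_Suc_1 by (rule prod.lessThan_Suc_shift)
  ultimately show ?thesis by simp
qed

text \<open>
  The entries needed in one fusion step, with their common factor \<open>P\<close> taken out.
\<close>

lemma Kd_parts:
  assumes n: "1 \<le> n" "n \<le> Suc e"
  obtains P where "Kd B (Suc e) (w * s) (n - 1) = P * gg B (Suc (Suc e)) w (n - 1)"
    "Kd B (Suc e) (w * s) n = P * hh B (Suc (Suc e)) w n"
    "Kd B (Suc (Suc e)) w n = hh B (Suc (Suc e)) w 0 * P * gg B (Suc (Suc e)) w (Suc e)"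
proof
  let ?h = "hh B (Suc (Suc e)) w" and ?g = "gg B (Suc (Suc e)) w"
  define P where "P = (\<Prod>r\<in>{1..<n}. ?h r) * (\<Prod>r\<in>{n..<Suc e}. ?g r)"
  obtain m where m: "n = Suc m" using n by (cases n) auto
  have s1: "(\<Prod>r<k. hh B (Suc e) (w * s) r) = (\<Prod>r\<in>{1..<Suc k}. ?h r)" for k
    unfolding hh_shift One_nat_def prod.atLeast_Suc_lessThan_Suc_shift by (simp add: atLeast0LessThan)
  have s2: "(\<Prod>r\<in>{k..<Suc e}. gg B (Suc e) (w * s) r) = (\<Prod>r\<in>{k..<Suc e}. ?g r)" for k
    by (simp add: gg_shift)
  have g: "(\<Prod>r\<in>{m..<Suc e}. ?g r) = ?g m * (\<Prod>r\<in>{n..<Suc e}. ?g r)"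
    using n unfolding m by (intro prod.atLeast_Suc_lessThan) simp
  have h: "(\<Prod>r\<in>{1..<Suc n}. ?h r) = (\<Prod>r\<in>{1..<n}. ?h r) * ?h n"
    using n by simp
  show "Kd B (Suc e) (w * s) (n - 1) = P * ?g (n - 1)"
    unfolding Kd_def s1 s2 P_def using m g by simp
  show "Kd B (Suc e) (w * s) n = P * ?h n"
    unfolding Kd_def s1 s2 P_def h by simp
  have "(\<Prod>r<n. ?h r) = ?h 0 * (\<Prod>r\<in>{1..<n}. ?h r)"
    unfolding m prod.lessThan_Suc_shift One_nat_def prod.atLeast_Suc_lessThan_Suc_shift by (simp add: atLeast0LessThan)
  moreover have "(\<Prod>r\<in>{n..<Suc (Suc e)}. ?g r) = (\<Prod>r\<in>{n..<Suc e}. ?g r) * ?g (Suc e)"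
    using n by simp
  ultimately show "Kd B (Suc (Suc e)) w n = ?h 0 * P * ?g (Suc e)"
    unfolding Kd_def P_def by simp
qed

lemma Kd_0: "Kd B (Suc (Suc e)) w 0 = Kd B (Suc e) (w * s) 0 * gg B (Suc (Suc e)) w (Suc e)"
  by (simp add: Kd_def gg_shift)

lemma Kd_last: "Kd B (Suc (Suc e)) w (Suc (Suc e)) = Kd B (Suc e) (w * s) (Suc e) * hh B (Suc (Suc e)) w 0"
  unfolding Kd_def hh_shift prod.lessThan_Suc_shift[of _ "Suc e"] by simp

text \<open>
  This identity and the next one say that the two components of \<open>Y f\<close> of total index \<open>n\<close> are those of
  \<open>E f\<close> multiplied by the same number.
\<close>

lemma Kd_identity_upper:
  assumes w: "w \<noteq> 0" and that: "1 \<le> n"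
  shows "cfun (w\<^sup>2 * s powi (2 - 2 * int n)) * hh B d w n + (s powi (2 * int n) - s powi (- (2 * int n))) * gg B d w (n - 1)
     = cfun (w\<^sup>2 * s\<^sup>2) * hh B d w 0"
proof -
  define X where "X = s powi int n"
  define Z where "Z = s powi int d"
  have nz: "X \<noteq> 0" "Z \<noteq> 0" by (simp_all add: X_def Z_def)
  have 1: "s powi (2 - 2 * int n) = s ^ 2 / (X * X)" "s powi (2 * int n) = X * X" "s powi (- (2 * int n)) = 1 / (X * X)"
    by (simp_all only: X_def power_int_diff[OF disjI1, OF s_nz] powi_double power_int_minus) (simp_all add: field_simps)
  have 2: "yy d n = Z / (s * X * X)"
    by (simp only: yy_def X_def Z_def power_int_diff[OF disjI1, OF s_nz] powi_double) simp
  have 3: "yy d (n - 1) = Z * s / (X * X)"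
  proof -
    have "int d - 1 - 2 * int (n - 1) = int d + 1 - 2 * int n" using that by simp
    then show ?thesis
      by (simp only: yy_def X_def Z_def power_int_diff[OF disjI1, OF s_nz] powi_add powi_double) simp
  qed
  have 4: "yy d 0 = Z / s"
    by (simp only: yy_def Z_def power_int_diff[OF disjI1, OF s_nz]) simp
  show ?thesis unfolding cfun_def hh_def gg_def 1 2 3 4 using nz w
    by (simp add: divide_simps) (simp add: algebra_simps power_numeral_reduce)
qed

lemma Kd_identity_lower:
  assumes w: "w \<noteq> 0" and n: "1 \<le> n" "n \<le> Suc e"
  shows "cfun (w\<^sup>2 * s powi (2 * int n - 2 * int e - 2)) * gg B (Suc (Suc e)) w (n - 1)
      + (s powi (2 * (int e + 2 - int n)) - s powi (- (2 * (int e + 2 - int n)))) * hh B (Suc (Suc e)) w n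
     = cfun (w\<^sup>2 * s\<^sup>2) * gg B (Suc (Suc e)) w (Suc e)"
proof -
  define X where "X = s powi int n"
  define Z where "Z = s powi int e"
  have nz: "X \<noteq> 0" "Z \<noteq> 0" by (simp_all add: X_def Z_def)
  have 1: "s powi (2 * int n - 2 * int e - 2) = X * X / (Z * Z * s ^ 2)"
    by (simp only: X_def Z_def power_int_diff[OF disjI1, OF s_nz] powi_double power_int_minus) (simp add: field_simps)
  have 11: "s powi (2 * (int e + 2 - int n)) = Z * Z * s ^ 4 / (X * X)"
    by (simp only: X_def Z_def power_int_diff[OF disjI1, OF s_nz] powi_add powi_double) (simp add: field_simps)
  have 12: "s powi (- (2 * (int e + 2 - int n))) = X * X / (Z * Z * s ^ 4)"
    unfolding power_int_minus 11 by simp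
  have 2: "yy (Suc (Suc e)) n = Z * s / (X * X)"
  proof -
    have "int (Suc (Suc e)) - 1 - 2 * int n = int e + 1 - 2 * int n" by simp
    then show ?thesis
      by (simp only: yy_def X_def Z_def power_int_diff[OF disjI1, OF s_nz] powi_add powi_double) simp
  qed
  have 3: "yy (Suc (Suc e)) (n - 1) = Z * s ^ 3 / (X * X)"
  proof -
    have "int (Suc (Suc e)) - 1 - 2 * int (n - 1) = int e + 3 - 2 * int n" using n by simp
    then show ?thesis
      by (simp only: yy_def X_def Z_def power_int_diff[OF disjI1, OF s_nz] powi_add powi_double) simp
  qed
  have 4: "yy (Suc (Suc e)) (Suc e) = 1 / (Z * s)"
  proof -
    have "int (Suc (Suc e)) - 1 - 2 * int (Suc e) = - (int e + 1)" by simp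
    then show ?thesis
      by (simp only: yy_def Z_def power_int_minus powi_add) (simp add: field_simps)
  qed
  show ?thesis unfolding cfun_def hh_def gg_def 1 11 12 2 3 4 using nz w
    by (simp add: divide_simps) (simp add: algebra_simps power_numeral_reduce)
qed

lemma Khop_diag:
  assumes "k_plus B = 0" "k_minus B = 0"
  shows "Khop B u f 0 = (u * eps_plus B + inverse u * eps_minus B) * f 0"
    "Khop B u f 1 = (u * eps_minus B + inverse u * eps_plus B) * f 1"
  using assms by (simp_all add: Khop_def)

lemma Kop_diag:
  assumes B: "k_plus B = 0" "k_minus B = 0" and w: "w \<noteq> 0" and n: "n \<le> Suc e"
  shows "Kop B (Suc e) w f (int n) = cc (Suc e) w * Kd B (Suc e) w n * f (int n)"
  using w n
proof (induction e arbitrary: w n f)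
  case 0
  then consider "n = 0" | "n = 1" by linarith
  then show ?case
    by cases (simp_all add: Khop_diag[OF B] Khop_diag(2)[OF B, simplified] cc_def Kd_def gg_def hh_def yy_def algebra_simps)
next
  case (Suc e)
  let ?d = "Suc (Suc e)" and ?e = "Suc e"
  note w = Suc.prems(1)
  define v1 where "v1 = w * s powi (- int ?e)"
  define v2 where "v2 = w\<^sup>2 * s powi (- int e)"
  let ?h = "hh B ?d w" and ?g = "gg B ?d w"
  let ?Z = "\<lambda>p i. Kop B ?e (w * s) (\<lambda>i. Eop ?d f p i) i"
  define V where "V = Lop ?e v2 ?Z"
  have ws: "w * s \<noteq> 0" using w by simp
  have K: "Kop B ?d w f (int n) = f0 ?d (int n) * Khop B v1 (\<lambda>p. V p (int n)) 0 + f1 ?d (int n) * Khop B v1 (\<lambda>p. V p (int n - 1)) 1"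
    by (simp add: Fop_def YK_def V_def v1_def v2_def)
  have ge: "v1 * eps_plus B + inverse v1 * eps_minus B = ?g ?e" "v1 * eps_minus B + inverse v1 * eps_plus B = ?h 0"
  proof -
    have y: "yy ?d ?e = s powi (- int ?e)" "yy ?d 0 = inverse (s powi (- int ?e))"
      unfolding yy_def power_int_minus[symmetric] by (simp_all add: add.commute)
    show "v1 * eps_plus B + inverse v1 * eps_minus B = ?g ?e" "v1 * eps_minus B + inverse v1 * eps_plus B = ?h 0"
      unfolding gg_def hh_def y v1_def using w by (simp_all add: field_simps)
  qed
  let ?c = "cc ?e (w * s)" and ?C = "cfun (w\<^sup>2 * s\<^sup>2)"
  let ?k = "Kd B ?e (w * s)"
  let ?X = "?C * ?c * Kd B ?d w n"
  have Z0: "?Z 0 (int m) = ?c * ?k m * al ?d (int m) * f (int m)" if "m \<le> ?e" for m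
    using Suc.IH[OF ws that, of "Eop ?d f 0"] by (simp add: Eop_def)
  have Z1: "?Z 1 (int m) = ?c * ?k m * be ?d (int m + 1) * f (int m + 1)" if "m \<le> ?e" for m
    using Suc.IH[OF ws that, of "Eop ?d f 1"] by (simp add: Eop_def)
  have lam: "v2 * s * kp ?e 1 (int n) = w\<^sup>2 * s powi (2 - 2 * int n)"
    "v2 * s * kp ?e (-1) (int n - 1) = w\<^sup>2 * s powi (2 * int n - 2 * int e - 2)"
  proof -
    have "v2 * s * kp ?e 1 (int n) = w\<^sup>2 * (s powi (- int e) * s powi 1 * s powi (1 * (int ?e - 2 * int n)))"
      by (simp add: v2_def kp_def)
    then show "v2 * s * kp ?e 1 (int n) = w\<^sup>2 * s powi (2 - 2 * int n)"
      by (simp only: powi_add[symmetric]) (simp add: algebra_simps)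
    have "v2 * s * kp ?e (-1) (int n - 1) = w\<^sup>2 * (s powi (- int e) * s powi 1 * s powi ((-1) * (int ?e - 2 * (int n - 1))))"
      by (simp add: v2_def kp_def)
    then show "v2 * s * kp ?e (-1) (int n - 1) = w\<^sup>2 * s powi (2 * int n - 2 * int e - 2)"
      by (simp only: powi_add[symmetric]) (simp add: algebra_simps)
  qed
  have Qq: "Q * qint s m = s powi (2 * m) - s powi (- (2 * m))" for m
    using Q_nz by (simp add: qint_def)
  have Y0: "Khop B v1 (\<lambda>p. V p (int n)) 0 = al ?d (int n) * ?X * f (int n)" if ne: "n \<le> ?e"
  proof -
    have V0: "V 0 (int n) = cfun (w\<^sup>2 * s powi (2 - 2 * int n)) * ?Z 0 (int n) + Q * b ?e (int n - 1) * ?Z 1 (int n - 1)"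
      unfolding V_def Lop_def Lraw_def lam cfun_def using ne by (simp add: inr_def del: Kop.simps)
    show ?thesis
    proof (cases "n = 0")
      case True
      have "V 0 (int n) = ?C * ?c * ?k 0 * al ?d 0 * f 0"
        unfolding V0 using Z0[of 0] True by (simp del: Kop.simps)
      then show ?thesis unfolding Khop_diag[OF B] ge using True by (simp add: Kd_0)
    next
      case False
      then have n1: "1 \<le> n" by simp
      from Kd_parts[OF n1 ne, of B w] obtain P where P: "?k (n - 1) = P * ?g (n - 1)" "?k n = P * ?h n" "Kd B ?d w n = ?h 0 * P * ?g ?e" .
      have Z1': "?Z 1 (int n - 1) = ?c * ?k (n - 1) * be ?d (int n) * f (int n)"
        using Z1[of "n - 1"] n1 ne by (simp add: of_nat_diff del: Kop.simps)
      have bb: "b ?e (int n - 1) * be ?d (int n) = qint s (int n) * al ?d (int n)"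
        using be_al[of ?e "int n - 1"] by simp
      have "V 0 (int n) = (cfun (w\<^sup>2 * s powi (2 - 2 * int n)) * ?k n * al ?d (int n) + Q * (b ?e (int n - 1) * be ?d (int n)) * ?k (n - 1)) * ?c * f (int n)"
        unfolding V0 Z0[OF ne] Z1' by (simp add: algebra_simps)
      also have "\<dots> = (cfun (w\<^sup>2 * s powi (2 - 2 * int n)) * ?h n + (Q * qint s (int n)) * ?g (n - 1)) * P * ?c * al ?d (int n) * f (int n)"
        unfolding bb P by (simp add: algebra_simps)
      finally show ?thesis unfolding Khop_diag[OF B] ge Qq Kd_identity_upper[OF w n1] P by (simp add: algebra_simps)
    qed
  qed
  have Y1: "Khop B v1 (\<lambda>p. V p (int n - 1)) 1 = be ?d (int n) * ?X * f (int n)" if n1: "1 \<le> n"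
  proof -
    have V1: "V 1 (int n - 1) = cfun (w\<^sup>2 * s powi (2 * int n - 2 * int e - 2)) * ?Z 1 (int n - 1) + Q * b ?e (int n - 1) * ?Z 0 (int n)"
      unfolding V_def Lop_def Lraw_def lam cfun_def using n1 Suc.prems(2) by (simp add: inr_def del: Kop.simps)
    have Z1': "?Z 1 (int n - 1) = ?c * ?k (n - 1) * be ?d (int n) * f (int n)"
      using Z1[of "n - 1"] n1 Suc.prems(2) by (simp add: of_nat_diff del: Kop.simps)
    show ?thesis
    proof (cases "n = ?d")
      case True
      have "b ?e (int n - 1) = 0" using True b_top[of ?e] by simp
      then have "V 1 (int n - 1) = ?C * ?c * ?k ?e * be ?d (int n) * f (int n)"
        unfolding V1 Z1' using True by simp
      then show ?thesis unfolding Khop_diag[OF B] ge using True Kd_last[of B e w] by simp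
    next
      case False
      with Suc.prems(2) have ne: "n \<le> ?e" by simp
      from Kd_parts[OF n1 ne, of B w] obtain P where P: "?k (n - 1) = P * ?g (n - 1)" "?k n = P * ?h n" "Kd B ?d w n = ?h 0 * P * ?g ?e" .
      have bb: "b ?e (int n - 1) * al ?d (int n) = qint s (int e + 2 - int n) * be ?d (int n)"
      proof -
        have nz: "b ?d (int n - 1) \<noteq> 0" using b_nz n1 ne by simp
        have "b ?e (int n - 1) * al ?d (int n) * b ?d (int n - 1) = al ?d (int n - 1) * (b ?e (int n - 1) * b ?e (int n - 1))"
          using al_step[of ?e "int n - 1"] by (simp add: algebra_simps)
        also have "\<dots> = qint s (int e + 2 - int n) * (qint s (int n) * al ?d (int n - 1))"
          unfolding b_sq by (simp add: algebra_simps)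
        also have "qint s (int n) * al ?d (int n - 1) = be ?d (int n) * b ?d (int n - 1)"
          using be_step[of ?d "int n - 1"] by simp
        finally show ?thesis using nz by simp
      qed
      have "V 1 (int n - 1) = (cfun (w\<^sup>2 * s powi (2 * int n - 2 * int e - 2)) * ?k (n - 1) * be ?d (int n) + Q * (b ?e (int n - 1) * al ?d (int n)) * ?k n) * ?c * f (int n)"
        unfolding V1 Z0[OF ne] Z1' by (simp add: algebra_simps)
      also have "\<dots> = (cfun (w\<^sup>2 * s powi (2 * int n - 2 * int e - 2)) * ?g (n - 1) + (Q * qint s (int e + 2 - int n)) * ?h n) * P * ?c * be ?d (int n) * f (int n)"
        unfolding bb P by (simp add: algebra_simps)
      finally show ?thesis unfolding Khop_diag[OF B] ge Qq Kd_identity_lower[OF w n1 ne] P by (simp add: algebra_simps)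
    qed
  qed
  have a0: "f0 ?d (int n) * Khop B v1 (\<lambda>p. V p (int n)) 0 = f0 ?d (int n) * al ?d (int n) * (?X * f (int n))"
  proof (cases "n \<le> ?e")
    case True then show ?thesis using Y0 by simp
  next
    case False then show ?thesis by (simp add: f0_def)
  qed
  have a1: "f1 ?d (int n) * Khop B v1 (\<lambda>p. V p (int n - 1)) 1 = f1 ?d (int n) * be ?d (int n) * (?X * f (int n))"
  proof (cases "1 \<le> n")
    case True then show ?thesis using Y1 by simp
  next
    case False then show ?thesis by (simp add: f1_def)
  qed
  have "Kop B ?d w f (int n) = (f0 ?d (int n) * al ?d (int n) + f1 ?d (int n) * be ?d (int n)) * (?X * f (int n))"
    unfolding K a0 a1 by (simp add: algebra_simps)
  also have "f0 ?d (int n) * al ?d (int n) + f1 ?d (int n) * be ?d (int n) = 1"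
    by (rule f0_f1) (use Suc.prems in auto)
  finally show ?case unfolding cc_Suc by simp
qed

text \<open>
  The two entries differ only in the factor with \<open>r = n\<close>.
\<close>

lemma Kd_ratio: "n < d \<Longrightarrow> Kd B d w (Suc n) * gg B d w n = Kd B d w n * hh B d w n"
  by (simp add: Kd_def prod.atLeast_Suc_lessThan)

end

section \<open>Matrices acting on coordinate vectors\<close>

text \<open>
  The matrix \<open>A\<close> applied to the vector with coordinates \<open>F\<close>; the coordinates of \<open>F\<close> beyond the number of
  columns do not matter.
\<close>

definition act :: "complex mat \<Rightarrow> (nat \<Rightarrow> complex) \<Rightarrow> nat \<Rightarrow> complex" where
  "act A F i = (\<Sum>k<dim_col A. A $$ (i, k) * F k)"

lemma act_mult:
  assumes "dim_col A = dim_row B" "i < dim_row A"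
  shows "act (A * B) F i = act A (act B F) i"
proof -
  have "act (A * B) F i = (\<Sum>k<dim_col B. \<Sum>l<dim_row B. A $$ (i, l) * B $$ (l, k) * F k)"
    unfolding act_def using assms
    by (intro sum.cong) (auto simp: scalar_prod_def sum_distrib_right lessThan_atLeast0)
  also have "\<dots> = (\<Sum>l<dim_row B. \<Sum>k<dim_col B. A $$ (i, l) * B $$ (l, k) * F k)"
    by (rule sum.swap)
  also have "\<dots> = act A (act B F) i"
    unfolding act_def using assms by (simp add: sum_distrib_left mult.assoc)
  finally show ?thesis .
qed

lemma act_one: "i < n \<Longrightarrow> act (1\<^sub>m n) F i = F i"
  by (simp add: act_def if_distrib[of "\<lambda>x. x * _"] cong: if_cong)

lemma act_cong: "(\<And>k. k < dim_col A \<Longrightarrow> F k = G k) \<Longrightarrow> act A F i = act A G i"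
  by (simp add: act_def)

lemma sum_mult_nat: "(\<Sum>k<n * m. g k) = (\<Sum>i<n. \<Sum>j<m. g (i * m + j))" for g :: "nat \<Rightarrow> complex"
  by (simp add: sum_mult_product add.commute)

lemma index_less:
  assumes "i < n" "j < m" shows "i * m + j < n * (m::nat)"
proof -
  have "i * m + j < Suc i * m" using assms by simp
  also have "\<dots> \<le> n * m" using assms by (intro mult_le_mono1) simp
  finally show ?thesis .
qed

lemma act_kron:
  assumes "i < dim_row A" "j < dim_row B"
  shows "act (A \<otimes>\<^sub>K B) F (i * dim_row B + j) = act A (\<lambda>i'. act B (\<lambda>j'. F (i' * dim_col B + j')) j) i"
proof -
  have l: "i * dim_row B + j < dim_row A * dim_row B" using assms by (rule index_less)
  have "act (A \<otimes>\<^sub>K B) F (i * dim_row B + j)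
     = (\<Sum>i'<dim_col A. \<Sum>j'<dim_col B. (A \<otimes>\<^sub>K B) $$ (i * dim_row B + j, i' * dim_col B + j') * F (i' * dim_col B + j'))"
    unfolding act_def by (simp add: kron_def sum_mult_nat del: index_mat)
  also have "\<dots> = (\<Sum>i'<dim_col A. \<Sum>j'<dim_col B. A $$ (i, i') * B $$ (j, j') * F (i' * dim_col B + j'))"
  proof (intro sum.cong refl)
    fix i' j' assume "i' \<in> {..<dim_col A}" "j' \<in> {..<dim_col B}"
    then have "i' * dim_col B + j' < dim_col A * dim_col B" "j' < dim_col B" by (simp_all add: index_less)
    then show "(A \<otimes>\<^sub>K B) $$ (i * dim_row B + j, i' * dim_col B + j') * F (i' * dim_col B + j') = A $$ (i, i') * B $$ (j, j') * F (i' * dim_col B + j')"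
      using l assms by (simp add: kron_def)
  qed
  also have "\<dots> = act A (\<lambda>i'. act B (\<lambda>j'. F (i' * dim_col B + j')) j) i"
    by (simp add: act_def sum_distrib_left mult.assoc)
  finally show ?thesis .
qed

lemma dim_kron [simp]: "dim_row (A \<otimes>\<^sub>K B) = dim_row A * dim_row B" "dim_col (A \<otimes>\<^sub>K B) = dim_col A * dim_col B"
  by (simp_all add: kron_def)

text \<open>
  The index of the product basis vector with digits \<open>xs\<close> in factors of dimensions \<open>ds\<close>, leftmost factor
  most significant; inverse to \<open>digit\<close>.
\<close>

fun encd :: "nat list \<Rightarrow> nat list \<Rightarrow> nat" where
  "encd (d # ds) (x # xs) = x * prod_list ds + encd ds xs"
| "encd _ _ = 0"

text \<open>
  The list has one digit for each factor, within its dimension.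
\<close>

definition valid :: "nat list \<Rightarrow> nat list \<Rightarrow> bool" where
  "valid ds xs \<longleftrightarrow> list_all2 (\<lambda>d x. x < d) ds xs"

lemma valid_simps [simp]: "valid [] xs \<longleftrightarrow> xs = []" "valid (d # ds) (x # xs) \<longleftrightarrow> x < d \<and> valid ds xs"
  by (auto simp: valid_def)

lemma valid_Cons: "valid (d # ds) ys \<longleftrightarrow> (\<exists>x xs. ys = x # xs \<and> x < d \<and> valid ds xs)"
  by (auto simp: valid_def list_all2_Cons1)

lemma valid_length: "valid ds xs \<Longrightarrow> length xs = length ds"
  by (auto simp: valid_def list_all2_lengthD)

lemma valid_nth: "valid ds xs \<Longrightarrow> t < length ds \<Longrightarrow> xs ! t < ds ! t"
  by (simp add: valid_def list_all2_conv_all_nth)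

lemma encd_less: "valid ds xs \<Longrightarrow> encd ds xs < prod_list ds"
proof (induction ds arbitrary: xs)
  case (Cons d ds)
  then obtain x ys where "xs = x # ys" "x < d" "valid ds ys" by (auto simp: valid_Cons)
  with Cons.IH[of ys] show ?case by (simp add: index_less)
qed simp

lemma digit_encd: "valid ds xs \<Longrightarrow> t < length ds \<Longrightarrow> digit ds t (encd ds xs) = xs ! t"
proof (induction ds arbitrary: xs t)
  case (Cons d ds)
  then obtain x ys where x: "xs = x # ys" "x < d" "valid ds ys" by (auto simp: valid_Cons)
  note l = encd_less[OF x(3)]
  show ?case
  proof (cases t)
    case 0
    then show ?thesis using x l by (simp add: digit_def)
  next
    case (Suc k)
    then have k: "k < length ds" using Cons.prems by simp
    let ?q = "prod_list (drop (Suc k) ds)"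
    have p: "prod_list ds = prod_list (take k ds) * (ds ! k * ?q)"
      using arg_cong[OF id_take_nth_drop[OF k], of prod_list] by simp
    then have q: "?q \<noteq> 0" using l by (metis mult_0_right not_less0)
    have "digit (d # ds) (Suc k) (x * prod_list ds + encd ds ys) = ((x * prod_list (take k ds) * ds ! k) * ?q + encd ds ys) div ?q mod ds ! k"
      by (simp add: digit_def p mult_ac)
    also have "\<dots> = (x * prod_list (take k ds) * ds ! k + encd ds ys div ?q) mod ds ! k"
      using q by simp
    also have "\<dots> = digit ds k (encd ds ys)"
      by (simp add: digit_def)
    also have "\<dots> = ys ! k" by (rule Cons.IH[OF x(3) k])
    finally show ?thesis using Suc x by simp
  qed
qed simp

lemma encd_surj: "k < prod_list ds \<Longrightarrow> \<exists>xs. valid ds xs \<and> encd ds xs = k"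
proof (induction ds arbitrary: k)
  case Nil then show ?case by simp
next
  case (Cons d ds)
  then have P: "prod_list ds > 0" by (cases "prod_list ds = 0") auto
  then obtain ys where "valid ds ys" "encd ds ys = k mod prod_list ds" using Cons.IH[of "k mod prod_list ds"] by auto
  moreover have "k div prod_list ds < d" using Cons.prems P by (simp add: less_mult_imp_div_less)
  ultimately show ?case by (intro exI[of _ "(k div prod_list ds) # ys"]) simp
qed

lemma sum_encd: "(\<Sum>k<prod_list ds. G k) = (\<Sum>ys | valid ds ys. G (encd ds ys))" for G :: "nat \<Rightarrow> complex"
proof -
  have "bij_betw (encd ds) {ys. valid ds ys} {..<prod_list ds}"
  proof (intro bij_betwI')
    fix xs ys assume "xs \<in> {ys. valid ds ys}" "ys \<in> {ys. valid ds ys}"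
    then show "(encd ds xs = encd ds ys) = (xs = ys)"
      by (auto intro!: nth_equalityI simp: valid_length) (metis digit_encd valid_length)
  next
    fix xs assume "xs \<in> {ys. valid ds ys}"
    then show "encd ds xs \<in> {..<prod_list ds}" using encd_less by simp
  next
    fix k assume "k \<in> {..<prod_list ds}"
    then show "\<exists>xs\<in>{ys. valid ds ys}. k = encd ds xs" using encd_surj[of k ds] by auto
  qed
  then show ?thesis by (rule sum.reindex_bij_betw[symmetric])
qed

lemma act_two_leg:
  assumes xs: "valid ds xs" and p: "p < length ds" "r < length ds" "p \<noteq> r"
  shows "act (two_leg ds p r M) F (encd ds xs)
    = (\<Sum>a<ds ! p. \<Sum>c<ds ! r. M $$ (xs ! p * ds ! r + xs ! r, a * ds ! r + c) * F (encd ds (xs[p := a, r := c])))"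
proof -
  let ?S = "{ys. valid ds ys \<and> (\<forall>t<length ds. t \<noteq> p \<and> t \<noteq> r \<longrightarrow> xs ! t = ys ! t)}"
  let ?f = "\<lambda>ys. M $$ (xs ! p * ds ! r + xs ! r, ys ! p * ds ! r + ys ! r) * F (encd ds ys)"
  have fin: "finite {ys. valid ds ys}"
  proof -
    have "{ys. valid ds ys} \<subseteq> {ys. set ys \<subseteq> {..<Suc (sum_list ds)} \<and> length ys = length ds}"
    proof safe
      fix ys x assume v: "valid ds ys" and "x \<in> set ys"
      then obtain t where "t < length ys" "x = ys ! t" by (auto simp: in_set_conv_nth)
      with valid_nth[OF v, of t] valid_length[OF v] member_le_sum_list[of "ds ! t" ds] show "x < Suc (sum_list ds)" by auto
    qed (simp add: valid_length)
    then show ?thesis by (rule finite_subset) (simp add: finite_lists_length_eq)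
  qed
  have up: "valid ds (xs[p := a, r := c])" if "a < ds ! p" "c < ds ! r" for a c
    using xs that p unfolding valid_def list_all2_conv_all_nth by (auto simp: nth_list_update)
  have "act (two_leg ds p r M) F (encd ds xs) = (\<Sum>ys | valid ds ys. two_leg ds p r M $$ (encd ds xs, encd ds ys) * F (encd ds ys))"
    unfolding act_def by (simp add: two_leg_def sum_encd del: index_mat)
  also have "\<dots> = (\<Sum>ys | valid ds ys. if \<forall>t<length ds. t \<noteq> p \<and> t \<noteq> r \<longrightarrow> xs ! t = ys ! t then ?f ys else 0)"
    by (intro sum.cong refl) (use xs p in \<open>auto simp: two_leg_def encd_less digit_encd\<close>)
  also have "\<dots> = sum ?f ?S"
    by (rule sum.mono_neutral_cong_right) (use fin in auto)
  also have "\<dots> = (\<Sum>(a, c)\<in>{..<ds ! p} \<times> {..<ds ! r}. ?f (xs[p := a, r := c]))"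
  proof (rule sum.reindex_bij_witness[of _ "\<lambda>(a, c). xs[p := a, r := c]" "\<lambda>ys. (ys ! p, ys ! r)"])
    fix ys assume ys: "ys \<in> ?S"
    then have len: "length ys = length xs" using xs valid_length by auto
    have lx: "length xs = length ds" using xs by (rule valid_length)
    show e: "(case (ys ! p, ys ! r) of (a, c) \<Rightarrow> xs[p := a, r := c]) = ys"
      using ys len lx p by (auto intro!: nth_equalityI simp: nth_list_update)
    show "(ys ! p, ys ! r) \<in> {..<ds ! p} \<times> {..<ds ! r}" using ys p by (auto simp: valid_nth)
    show "(case (ys ! p, ys ! r) of (a, c) \<Rightarrow> ?f (xs[p := a, r := c])) = ?f ys" using e by simp
  next
    fix ac assume "ac \<in> {..<ds ! p} \<times> {..<ds ! r}"
    then obtain a c where ac: "ac = (a, c)" "a < ds ! p" "c < ds ! r" by auto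
    have lx: "length xs = length ds" using xs by (rule valid_length)
    show "(case ac of (a, c) \<Rightarrow> xs[p := a, r := c]) \<in> ?S" using ac up p lx by (auto simp: nth_list_update)
    show "((case ac of (a, c) \<Rightarrow> xs[p := a, r := c]) ! p, (case ac of (a, c) \<Rightarrow> xs[p := a, r := c]) ! r) = ac"
      using ac p lx by (auto simp: nth_list_update)
  qed
  also have "\<dots> = (\<Sum>a<ds ! p. \<Sum>c<ds ! r. ?f (xs[p := a, r := c]))"
    by (simp add: sum.cartesian_product)
  also have "\<dots> = (\<Sum>a<ds ! p. \<Sum>c<ds ! r. M $$ (xs ! p * ds ! r + xs ! r, a * ds ! r + c) * F (encd ds (xs[p := a, r := c])))"
    using p valid_length[OF xs] by (simp add: nth_list_update)
  finally show ?thesis .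
qed

section \<open>Fused matrices as operators\<close>

text \<open>
  A coordinate vector of a tensor product, the second factor having dimension \<open>m\<close>, as a function of two
  indices.
\<close>

definition lift2 :: "nat \<Rightarrow> (nat \<Rightarrow> complex) \<Rightarrow> int \<Rightarrow> int \<Rightarrow> complex" where
  "lift2 m F n a = F (nat n * m + nat a)"

lemma sum_sparse2:
  fixes f :: "nat \<Rightarrow> complex"
  assumes "\<And>k. k < n \<Longrightarrow> k \<noteq> i \<Longrightarrow> k \<noteq> j \<Longrightarrow> f k = 0" "i \<noteq> j"
  shows "(\<Sum>k<n. f k) = (if i < n then f i else 0) + (if j < n then f j else 0)"
proof -
  have "(\<Sum>k<n. f k) = (\<Sum>k<n. (if k = i then f i else 0) + (if k = j then f j else 0))"
    by (intro sum.cong refl) (use assms in auto)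
  then show ?thesis by (simp add: sum.distrib)
qed

lemma sum_sparse1:
  fixes f :: "nat \<Rightarrow> complex"
  assumes "\<And>k. k < n \<Longrightarrow> k \<noteq> i \<Longrightarrow> f k = 0"
  shows "(\<Sum>k<n. f k) = (if i < n then f i else 0)"
proof -
  have "(\<Sum>k<n. f k) = (\<Sum>k<n. (if k = i then f i else 0))"
    by (intro sum.cong refl) (use assms in auto)
  then show ?thesis by simp
qed

lemma dim_E_fus [simp]: "dim_row (E_fus s d) = 2 * d" "dim_col (E_fus s d) = d + 1"
  by (simp_all add: E_fus_def mat1_def)

lemma dim_F_fus [simp]: "dim_row (F_fus s d) = d + 1" "dim_col (F_fus s d) = 2 * d"
  by (simp_all add: F_fus_def mat1_def)

lemma dim_two_leg [simp]: "dim_row (two_leg ds p r M) = prod_list ds" "dim_col (two_leg ds p r M) = prod_list ds"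
  by (simp_all add: two_leg_def)

context generic_q begin

lemma act_E_fus:
  assumes d: "2 \<le> d" and p: "p < 2" and i: "i < d"
  shows "act (E_fus s d) F (p * d + i) = Eop d (\<lambda>k. F (nat k)) (int p) (int i)"
proof -
  have r: "p * d + i < 2 * d" using p i by (rule index_less)
  have ent: "E_fus s d $$ (p * d + i, k) = E_entry s d (p * d + i + 1) (k + 1)" if "k < d + 1" for k
    using r that by (simp add: E_fus_def mat1_def)
  consider "p = 0" | "p = 1" using p by linarith
  then show ?thesis
  proof cases
    case 1
    have "act (E_fus s d) F (p * d + i) = (\<Sum>k<d + 1. E_entry s d (i + 1) (k + 1) * F k)"
      unfolding act_def using ent 1 by (intro sum.cong) auto
    also have "\<dots> = E_entry s d (i + 1) (i + 1) * F i"
      using i d by (subst sum_sparse1[of _ i]) (auto simp: E_entry_def)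
    finally show ?thesis using 1 i E_entry_al[of i d] by (simp add: Eop_def)
  next
    case 2
    have "act (E_fus s d) F (p * d + i) = (\<Sum>k<d + 1. E_entry s d (d + i + 1) (k + 1) * F k)"
      unfolding act_def using ent 2 by (intro sum.cong) auto
    also have "\<dots> = E_entry s d (d + i + 1) (i + 1 + 1) * F (i + 1)"
      using i d by (subst sum_sparse1[of _ "i + 1"]) (auto simp: E_entry_def)
    also have "E_entry s d (d + i + 1) (i + 1 + 1) = be d (int (i + 1))"
      using E_entry_be[of "i + 1" d] i d by (simp add: add_ac)
    finally show ?thesis using 2 by (simp add: Eop_def nat_add_distrib add.commute)
  qed
qed

lemma act_F_fus:
  assumes d: "2 \<le> d" and n: "n \<le> d"
  shows "act (F_fus s d) G n = Fop d (\<lambda>p i. G (nat p * d + nat i)) (int n)"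
proof -
  have "act (F_fus s d) G n = (\<Sum>c<2 * d. F_entry s d (n + 1) (c + 1) * G c)"
    unfolding act_def using n by (intro sum.cong) (auto simp: F_fus_def mat1_def)
  also have "\<dots> = (if n < 2 * d then F_entry s d (n + 1) (n + 1) * G n else 0)
      + (if n + d - 1 < 2 * d then F_entry s d (n + 1) (n + d - 1 + 1) * G (n + d - 1) else 0)"
    by (rule sum_sparse2) (use d n in \<open>auto simp: F_entry_def\<close>)
  also have "\<dots> = F_entry s d (n + 1) (n + 1) * G n + F_entry s d (n + 1) (n + d) * G (n + d - 1)"
    using d n by auto
  also have "F_entry s d (n + 1) (n + 1) = f0 d (int n)"
    using d n by (auto simp: f0_def F_entry_def)
  also have "F_entry s d (n + 1) (n + d) = f1 d (int n)"
    using d n by (auto simp: f1_def F_entry_def)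
  also have "f1 d (int n) * G (n + d - 1) = f1 d (int n) * G (nat 1 * d + nat (int n - 1))"
  proof (cases n)
    case (Suc m)
    then show ?thesis using d by (simp add: add.commute)
  qed (simp add: f1_def)
  finally show ?thesis by (simp add: Fop_def)
qed

text \<open>
  The scalar prefactor of the R-matrix for spins 1/2 and \<open>d/2\<close>.
\<close>

definition hs :: "nat \<Rightarrow> complex \<Rightarrow> complex" where
  "hs d u = (\<Prod>k<d - 1. cfun (u * s powi (int d - 1 - 2 * int k)))"

lemma sigma_simps [simp]:
  "dim_row sigma_plus = 2" "dim_col sigma_plus = 2" "dim_row sigma_minus = 2" "dim_col sigma_minus = 2"
  "dim_row sigma_z = 2" "dim_col sigma_z = 2"
  "i < 2 \<Longrightarrow> k < 2 \<Longrightarrow> sigma_plus $$ (i, k) = of_bool (i = 0 \<and> k = 1)"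
  "i < 2 \<Longrightarrow> k < 2 \<Longrightarrow> sigma_minus $$ (i, k) = of_bool (i = 1 \<and> k = 0)"
  "i < 2 \<Longrightarrow> k < 2 \<Longrightarrow> sigma_z $$ (i, k) = (if i = k then 1 - 2 * int i else 0)"
  by (auto simp: sigma_plus_def sigma_minus_def sigma_z_def mat_of_rows_list_def less_2_cases_iff)

lemma S_simps [simp]:
  "dim_row (S_plus s d) = d + 1" "dim_col (S_plus s d) = d + 1" "dim_row (S_minus s d) = d + 1" "dim_col (S_minus s d) = d + 1"
  "dim_row (S_three d) = d + 1" "dim_col (S_three d) = d + 1"
  "i < d + 1 \<Longrightarrow> k < d + 1 \<Longrightarrow> S_plus s d $$ (i, k) = (if k = i + 1 then b d (int i) else 0)"
  "i < d + 1 \<Longrightarrow> k < d + 1 \<Longrightarrow> S_minus s d $$ (i, k) = (if i = k + 1 then b d (int k) else 0)"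
  "i < d + 1 \<Longrightarrow> k < d + 1 \<Longrightarrow> S_three d $$ (i, k) = (if i = k then int d - 2 * int i else 0)"
  by (auto simp: S_plus_def S_minus_def S_three_def mat1_def b_def algebra_simps)

lemma kron_entry:
  assumes "p < dim_row A" "a < dim_row B" "q < dim_col A" "c < dim_col B"
  shows "(A \<otimes>\<^sub>K B) $$ (p * dim_row B + a, q * dim_col B + c) = A $$ (p, q) * B $$ (a, c)"
proof -
  have "p * dim_row B + a < dim_row A * dim_row B" "q * dim_col B + c < dim_col A * dim_col B"
    using assms by (simp_all add: index_less)
  then show ?thesis using assms by (simp add: kron_def)
qed

lemma dim_qexp [simp]: "dim_row (qexp_half s A) = dim_row A" "dim_col (qexp_half s A) = dim_row A"
  by (simp_all add: qexp_half_def)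

lemma dim_R_half: "dim_row (R_half s d u) = 2 * (d + 1)" "dim_col (R_half s d u) = 2 * (d + 1)"
  by (auto simp: R_half_def)

lemma R_half_entry:
  assumes d: "1 \<le> d" and p: "p < 2" and a: "a \<le> d" and p': "p' < 2" and c: "c \<le> d"
  shows "R_half s d u $$ (p * (d + 1) + a, p' * (d + 1) + c) = hs d u *
     (if p = 0 \<and> p' = 0 \<and> a = c then u * s * kp d 1 (int a) - inverse (u * s * kp d 1 (int a))
      else if p = 1 \<and> p' = 1 \<and> a = c then u * s * kp d (-1) (int a) - inverse (u * s * kp d (-1) (int a))
      else if p = 0 \<and> p' = 1 \<and> a = c + 1 then Q * b d (int c)
      else if p = 1 \<and> p' = 0 \<and> c = a + 1 then Q * b d (int a) else 0)"
proof -
  define x where "x = p * (d + 1) + a"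
  define y where "y = p' * (d + 1) + c"
  have xl: "x < 2 * (d + 1)" and yl: "y < 2 * (d + 1)"
    unfolding x_def y_def using p p' a c by (simp_all only: index_less less_Suc_eq_le Suc_eq_plus1[symmetric])
  have xy: "x = y \<longleftrightarrow> p = p' \<and> a = c"
  proof
    assume "x = y"
    then have "x div (d + 1) = y div (d + 1)" "x mod (d + 1) = y mod (d + 1)" by simp_all
    then show "p = p' \<and> a = c" unfolding x_def y_def using a c by (simp del: mult_Suc_right mult_Suc add_Suc_right)
  qed (simp add: x_def y_def)
  have k1: "(sigma_plus \<otimes>\<^sub>K S_minus s d) $$ (x, y) = of_bool (p = 0 \<and> p' = 1) * (if a = c + 1 then b d (int c) else 0)"
    using kron_entry[of p sigma_plus a "S_minus s d" p' c] p p' a c by (simp add: x_def y_def)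
  have k2: "(sigma_minus \<otimes>\<^sub>K S_plus s d) $$ (x, y) = of_bool (p = 1 \<and> p' = 0) * (if c = a + 1 then b d (int a) else 0)"
    using kron_entry[of p sigma_minus a "S_plus s d" p' c] p p' a c by (simp add: x_def y_def)
  have k3: "(sigma_z \<otimes>\<^sub>K S_three d) $$ (x, x) = (1 - 2 * int p) * (int d - 2 * int a)"
    using kron_entry[of p sigma_z a "S_three d" p a] p a by (simp add: x_def)
  define A where "A = 1\<^sub>m (2 * (d + 1)) + sigma_z \<otimes>\<^sub>K S_three d"
  have dA: "dim_row A = 2 * (d + 1)" "dim_col A = 2 * (d + 1)" by (simp_all add: A_def)
  have Ax: "A $$ (x, x) = 1 + (1 - 2 * int p) * (int d - 2 * int a)"
    using xl k3 by (simp add: A_def del: mult_Suc_right)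
  have e: "qexp_half s A $$ (x, y) = (if x = y then s powi (1 + (1 - 2 * int p) * (int d - 2 * int a)) else 0)"
    "qexp_half s (- A) $$ (x, y) = (if x = y then s powi (- (1 + (1 - 2 * int p) * (int d - 2 * int a))) else 0)"
    using xl yl by (auto simp: qexp_half_def dA Ax[symmetric])
  have "R_half s d u $$ (x, y) = hs d u * (Q * (of_bool (p = 0 \<and> p' = 1) * (if a = c + 1 then b d (int c) else 0) + of_bool (p = 1 \<and> p' = 0) * (if c = a + 1 then b d (int a) else 0))
     + u * (if x = y then s powi (1 + (1 - 2 * int p) * (int d - 2 * int a)) else 0)
     - inverse u * (if x = y then s powi (- (1 + (1 - 2 * int p) * (int d - 2 * int a))) else 0))"
    unfolding e[symmetric] k1[symmetric] k2[symmetric]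
    unfolding R_half_def hs_def A_def[symmetric] using d xl yl
    by (simp add: dA del: mult_Suc_right)
  moreover have "s powi (1 + (int d - 2 * int a)) = s * kp d 1 (int a)" "s powi (1 - (int d - 2 * int a)) = s * kp d (-1) (int a)"
  proof -
    have "1 - (int d - 2 * int a) = 1 + (- (int d - 2 * int a))" by simp
    then show "s powi (1 - (int d - 2 * int a)) = s * kp d (-1) (int a)"
      by (simp only: powi_add kp_def power_int_1_right mult_minus1)
    show "s powi (1 + (int d - 2 * int a)) = s * kp d 1 (int a)"
      by (simp only: powi_add kp_def power_int_1_right mult_1)
  qed
  ultimately show ?thesis
    unfolding xy x_def[symmetric] y_def[symmetric] power_int_minus using p p'
    by (auto simp: less_2_cases_iff algebra_simps)
qed

lemma act_R_half:
  assumes d: "1 \<le> d" and p: "p < 2" and a: "a \<le> d"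
  shows "act (R_half s d u) F (p * (d + 1) + a) = hs d u * Lop d u (lift2 (d + 1) F) (int p) (int a)"
proof -
  let ?m = "d + 1"
  note ent = R_half_entry[OF d p a]
  have "act (R_half s d u) F (p * ?m + a) = (\<Sum>p'<2. \<Sum>c<?m. R_half s d u $$ (p * ?m + a, p' * ?m + c) * F (p' * ?m + c))"
    unfolding act_def dim_R_half sum_mult_nat ..
  also have "\<dots> = (\<Sum>c<?m. R_half s d u $$ (p * ?m + a, 0 * ?m + c) * F (0 * ?m + c)) + (\<Sum>c<?m. R_half s d u $$ (p * ?m + a, 1 * ?m + c) * F (1 * ?m + c))"
    by (simp add: numeral_2_eq_2)
  finally have A: "act (R_half s d u) F (p * ?m + a) = \<dots>" .
  consider "p = 0" | "p = 1" using p by linarith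
  then show ?thesis
  proof cases
    case 1
    have "(\<Sum>c<?m. R_half s d u $$ (p * ?m + a, 0 * ?m + c) * F (0 * ?m + c)) = hs d u * (u * s * kp d 1 (int a) - inverse (u * s * kp d 1 (int a))) * F a"
      by (subst sum_sparse1[of _ a]) (use ent[of 0] 1 a in auto)
    moreover have "(\<Sum>c<?m. R_half s d u $$ (p * ?m + a, 1 * ?m + c) * F (1 * ?m + c)) = hs d u * (Q * b d (int a - 1)) * F (?m + nat (int a - 1))"
    proof (cases a)
      case 0
      then show ?thesis by (subst sum.neutral) (use ent[of 1] 1 a in auto)
    next
      case (Suc k)
      then show ?thesis by (subst sum_sparse1[of _ k]) (use ent[of 1] 1 a in auto)
    qed
    ultimately show ?thesis unfolding A using 1 a by (simp add: Lop_def Lraw_def inr_def lift2_def algebra_simps)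
  next
    case 2
    have "(\<Sum>c<?m. R_half s d u $$ (p * ?m + a, 1 * ?m + c) * F (1 * ?m + c)) = hs d u * (u * s * kp d (-1) (int a) - inverse (u * s * kp d (-1) (int a))) * F (?m + a)"
      by (subst sum_sparse1[of _ a]) (use ent[of 1] 2 a in auto)
    moreover have "(\<Sum>c<?m. R_half s d u $$ (p * ?m + a, 0 * ?m + c) * F (0 * ?m + c)) = hs d u * (Q * b d (int a)) * F (a + 1)"
    proof (cases "a = d")
      case True
      then show ?thesis by (subst sum.neutral) (use ent[of 0] 2 a in auto)
    next
      case False
      then show ?thesis by (subst sum_sparse1[of _ "a + 1"]) (use ent[of 0] 2 a in auto)
    qed
    ultimately show ?thesis unfolding A using 2 a by (simp add: Lop_def Lraw_def inr_def lift2_def nat_add_distrib algebra_simps)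
  qed
qed

end

lemma encd3: "encd [l, d, m] [p, i, a] = (p * d + i) * m + a"
  by (simp add: algebra_simps)

lemma act_two_leg_02:
  assumes "p < l" "i < d" "a < m" "dim_col M = l * m"
  shows "act (two_leg [l, d, m] 0 2 M) H ((p * d + i) * m + a) = act M (\<lambda>k. H ((k div m * d + i) * m + k mod m)) (p * m + a)"
proof -
  have v: "valid [l, d, m] [p, i, a]" using assms by simp
  have "act (two_leg [l, d, m] 0 2 M) H (encd [l, d, m] [p, i, a])
     = (\<Sum>p'<l. \<Sum>c<m. M $$ (p * m + a, p' * m + c) * H (encd [l, d, m] [p', i, c]))"
    by (subst act_two_leg[OF v]) simp_all
  also have "\<dots> = (\<Sum>p'<l. \<Sum>c<m. M $$ (p * m + a, p' * m + c) * H (((p' * m + c) div m * d + i) * m + (p' * m + c) mod m))"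
    unfolding encd3 by (intro sum.cong refl) auto
  also have "\<dots> = act M (\<lambda>k. H ((k div m * d + i) * m + k mod m)) (p * m + a)"
    unfolding act_def assms(4) sum_mult_nat ..
  finally show ?thesis unfolding encd3 .
qed

lemma act_two_leg_12:
  assumes "p < l" "i < d" "a < m" "dim_col M = d * m"
  shows "act (two_leg [l, d, m] 1 2 M) H ((p * d + i) * m + a) = act M (\<lambda>k. H ((p * d + k div m) * m + k mod m)) (i * m + a)"
proof -
  have v: "valid [l, d, m] [p, i, a]" using assms by simp
  have "act (two_leg [l, d, m] 1 2 M) H (encd [l, d, m] [p, i, a])
     = (\<Sum>i'<d. \<Sum>c<m. M $$ (i * m + a, i' * m + c) * H (encd [l, d, m] [p, i', c]))"
    by (subst act_two_leg[OF v]) simp_all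
  also have "\<dots> = (\<Sum>i'<d. \<Sum>c<m. M $$ (i * m + a, i' * m + c) * H ((p * d + (i' * m + c) div m) * m + (i' * m + c) mod m))"
    unfolding encd3 by (intro sum.cong refl) auto
  also have "\<dots> = act M (\<lambda>k. H ((p * d + k div m) * m + k mod m)) (i * m + a)"
    unfolding act_def assms(4) sum_mult_nat ..
  finally show ?thesis unfolding encd3 .
qed

lemma act_kron_right_one:
  assumes "i < dim_row A" "j < m"
  shows "act (A \<otimes>\<^sub>K 1\<^sub>m m) F (i * m + j) = act A (\<lambda>i'. F (i' * m + j)) i"
  using act_kron[of i A j "1\<^sub>m m" F] assms by (simp add: act_one)

lemma act_kron_left_one:
  assumes "j < dim_row B" "i < m"
  shows "act (1\<^sub>m m \<otimes>\<^sub>K B) F (i * dim_row B + j) = act B (\<lambda>j'. F (i * dim_col B + j')) j"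
  using act_kron[of i "1\<^sub>m m" j B F] assms by (simp add: act_one)

context generic_q begin

text \<open>
  The scalar factors by which the matrices \<open>R_mat\<close> and \<open>K_mat\<close> differ from the operators \<open>Rop\<close> and
  \<open>Kop\<close>.
\<close>

fun rsc :: "nat \<Rightarrow> nat \<Rightarrow> complex \<Rightarrow> complex" where
  "rsc 0 d2 u = 1"
| "rsc (Suc 0) d2 u = hs d2 u"
| "rsc (Suc (Suc e)) d2 u = hs d2 (u * s powi (- int (Suc e))) * rsc (Suc e) d2 (u * s)"

fun ksc :: "nat \<Rightarrow> complex \<Rightarrow> complex" where
  "ksc 0 u = 1"
| "ksc (Suc 0) u = 1"
| "ksc (Suc (Suc e)) u = hs (Suc e) (u\<^sup>2 * s powi (- int e)) * ksc (Suc e) (u * s)"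

lemma Rop_cong:
  assumes "\<And>n a. 0 \<le> n \<Longrightarrow> n \<le> int (Suc e) \<Longrightarrow> 0 \<le> a \<Longrightarrow> a \<le> int d2 \<Longrightarrow> f n a = g n a"
  shows "Rop (Suc e) d2 u f n a = Rop (Suc e) d2 u g n a"
proof -
  have "(\<lambda>p a. inr (Suc e) p * inr d2 a * f p a) = (\<lambda>p a. inr (Suc e) p * inr d2 a * g p a)"
    by (intro ext) (use assms in \<open>auto simp: inr_def\<close>)
  then show ?thesis using Rop_in[of e d2 u f n a] Rop_in[of e d2 u g n a] by simp
qed

lemma Lop_cong:
  assumes "\<And>n a. 0 \<le> n \<Longrightarrow> n \<le> 1 \<Longrightarrow> 0 \<le> a \<Longrightarrow> a \<le> int d2 \<Longrightarrow> f n a = g n a"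
  shows "Lop d2 u f n a = Lop d2 u g n a"
  using Rop_cong[of 0 d2 f g u n a] assms by simp

lemma Fop_cong:
  assumes "\<And>p i. 0 \<le> p \<Longrightarrow> p \<le> 1 \<Longrightarrow> 0 \<le> i \<Longrightarrow> i < int d \<Longrightarrow> f p i = g p i"
  shows "Fop d f n = Fop d g n"
proof -
  have "f0 d n * f 0 n = f0 d n * g 0 n" using assms[of 0 n] by (auto simp: f0_def)
  moreover have "f1 d n * f 1 (n - 1) = f1 d n * g 1 (n - 1)" using assms[of 1 "n - 1"] by (auto simp: f1_def)
  ultimately show ?thesis unfolding Fop_def by (simp only:)
qed

lemma Lop_scale: "Lop d u (\<lambda>n a. c * f n a) n a = c * Lop d u f n a"
  by (rule lin2_scale[OF lin2_Lop])

lemma Fop_scale: "Fop d (\<lambda>p i. c * f p i) n = c * Fop d f n"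
  by (simp add: Fop_def algebra_simps)

lemma dim_R_mat: "dim_row (R_mat s (Suc e) d2 u) = (e + 2) * (d2 + 1)" "dim_col (R_mat s (Suc e) d2 u) = (e + 2) * (d2 + 1)"
  by (cases e; simp add: dim_R_half Let_def)+

lemma act_R_mat:
  assumes "1 \<le> d2" "n \<le> Suc e" "a \<le> d2"
  shows "act (R_mat s (Suc e) d2 u) F (n * (d2 + 1) + a) = rsc (Suc e) d2 u * Rop (Suc e) d2 u (lift2 (d2 + 1) F) (int n) (int a)"
  using assms
proof (induction e arbitrary: u n a F)
  case 0
  then show ?case using act_R_half[of d2 n a u F] by simp
next
  case (Suc e)
  let ?d = "Suc (Suc e)" and ?m = "d2 + 1"
  define v where "v = u * s powi (- int (Suc e))"
  define A1 where "A1 = F_fus s ?d \<otimes>\<^sub>K 1\<^sub>m ?m"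
  define A2 where "A2 = two_leg [2, ?d, ?m] 0 2 (R_half s d2 v)"
  define A3 where "A3 = two_leg [2, ?d, ?m] 1 2 (R_mat s (Suc e) d2 (u * s))"
  define A4 where "A4 = E_fus s ?d \<otimes>\<^sub>K 1\<^sub>m ?m"
  have R: "R_mat s ?d d2 u = A1 * A2 * A3 * A4"
    by (simp add: Let_def A1_def A2_def A3_def A4_def v_def)
  have dims: "dim_row A1 = (?d + 1) * ?m" "dim_col A1 = 2 * ?d * ?m" "dim_row A2 = 2 * ?d * ?m" "dim_col A2 = 2 * ?d * ?m"
    "dim_row A3 = 2 * ?d * ?m" "dim_col A3 = 2 * ?d * ?m" "dim_row A4 = 2 * ?d * ?m" "dim_col A4 = (?d + 1) * ?m"
    by (simp_all add: A1_def A2_def A3_def A4_def algebra_simps)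
  let ?l = "lift2 ?m F"
  let ?E = "\<lambda>p i a. Eop ?d (\<lambda>m. ?l m a) p i"
  let ?Z = "\<lambda>p i a. Rop (Suc e) d2 (u * s) (\<lambda>i a. ?E p i a) i a"
  let ?Y = "\<lambda>p i a. Lop d2 v (\<lambda>p a. ?Z p i a) p a"
  let ?r = "rsc (Suc e) d2 (u * s)"
  \<comment> \<open>\<open>G4\<close> to \<open>G1\<close> describe the vector after each of the four factors.\<close>
  have G4: "act A4 F ((p * ?d + i) * ?m + a) = ?E (int p) (int i) (int a)" if "p < 2" "i < ?d" "a \<le> d2" for p i a
  proof -
    have "p * ?d + i < 2 * ?d" using that by (intro index_less) auto
    then have "act A4 F ((p * ?d + i) * ?m + a) = act (E_fus s ?d) (\<lambda>k. F (k * ?m + a)) (p * ?d + i)"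
      unfolding A4_def using that by (intro act_kron_right_one) auto
    also have "\<dots> = ?E (int p) (int i) (int a)"
      using that by (subst act_E_fus) (simp_all add: lift2_def)
    finally show ?thesis .
  qed
  have G3: "act A3 (act A4 F) ((p * ?d + i) * ?m + a) = ?r * ?Z (int p) (int i) (int a)" if "p < 2" "i < ?d" "a \<le> d2" for p i a
  proof -
    have "act A3 (act A4 F) ((p * ?d + i) * ?m + a)
       = act (R_mat s (Suc e) d2 (u * s)) (\<lambda>k. act A4 F ((p * ?d + k div ?m) * ?m + k mod ?m)) (i * ?m + a)"
      unfolding A3_def using that by (intro act_two_leg_12) (auto simp: dim_R_mat)
    also have "\<dots> = ?r * Rop (Suc e) d2 (u * s) (lift2 ?m (\<lambda>k. act A4 F ((p * ?d + k div ?m) * ?m + k mod ?m))) (int i) (int a)"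
      using that Suc.prems by (intro Suc.IH) auto
    also have "Rop (Suc e) d2 (u * s) (lift2 ?m (\<lambda>k. act A4 F ((p * ?d + k div ?m) * ?m + k mod ?m))) (int i) (int a) = ?Z (int p) (int i) (int a)"
    proof (rule Rop_cong)
      fix n c :: int assume nc: "0 \<le> n" "n \<le> int (Suc e)" "0 \<le> c" "c \<le> int d2"
      then have "nat c < ?m" "nat n < ?d" "nat c \<le> d2" by auto
      then show "lift2 ?m (\<lambda>k. act A4 F ((p * ?d + k div ?m) * ?m + k mod ?m)) n c = ?E (int p) n c"
        using G4[of p "nat n" "nat c"] that nc unfolding lift2_def[of _ "\<lambda>k. act A4 F ((p * ?d + k div ?m) * ?m + k mod ?m)"]
        by (simp del: mult_Suc mult_Suc_right add: div_mult_self3 div_mult_self1)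
    qed
    finally show ?thesis .
  qed
  have G2: "act A2 (act A3 (act A4 F)) ((p * ?d + i) * ?m + a) = hs d2 v * ?r * ?Y (int p) (int i) (int a)" if "p < 2" "i < ?d" "a \<le> d2" for p i a
  proof -
    let ?G = "\<lambda>k. act A3 (act A4 F) ((k div ?m * ?d + i) * ?m + k mod ?m)"
    have "act A2 (act A3 (act A4 F)) ((p * ?d + i) * ?m + a) = act (R_half s d2 v) ?G (p * ?m + a)"
      unfolding A2_def using that by (intro act_two_leg_02) (auto simp: dim_R_half)
    also have "\<dots> = hs d2 v * Lop d2 v (lift2 ?m ?G) (int p) (int a)"
      using that Suc.prems by (intro act_R_half) auto
    also have "Lop d2 v (lift2 ?m ?G) (int p) (int a) = Lop d2 v (\<lambda>p a. ?r * ?Z p (int i) a) (int p) (int a)"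
    proof (rule Lop_cong)
      fix n c :: int assume nc: "0 \<le> n" "n \<le> 1" "0 \<le> c" "c \<le> int d2"
      then have "nat c < ?m" "nat n < 2" "nat c \<le> d2" by auto
      then show "lift2 ?m ?G n c = ?r * ?Z n (int i) c"
        using G3[of "nat n" i "nat c"] that nc unfolding lift2_def[of _ ?G]
        by (simp del: mult_Suc mult_Suc_right Rop.simps)
    qed
    finally show ?thesis unfolding Lop_scale by simp
  qed
  have G1: "act A1 (act A2 (act A3 (act A4 F))) (n * ?m + a) = hs d2 v * ?r * Fop ?d (\<lambda>p i. ?Y p i (int a)) (int n)"
  proof -
    let ?G = "\<lambda>k. act A2 (act A3 (act A4 F)) (k * ?m + a)"
    have "act A1 (act A2 (act A3 (act A4 F))) (n * ?m + a) = act (F_fus s ?d) ?G n"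
      unfolding A1_def using Suc.prems by (intro act_kron_right_one) auto
    also have "\<dots> = Fop ?d (\<lambda>p i. ?G (nat p * ?d + nat i)) (int n)"
      using Suc.prems by (intro act_F_fus) auto
    also have "\<dots> = Fop ?d (\<lambda>p i. (hs d2 v * ?r) * ?Y p i (int a)) (int n)"
    proof (rule Fop_cong)
      fix p i :: int assume pi: "0 \<le> p" "p \<le> 1" "0 \<le> i" "i < int ?d"
      then have "nat p < 2" "nat i < ?d" by auto
      then show "?G (nat p * ?d + nat i) = (hs d2 v * ?r) * ?Y p i (int a)"
        using G2[of "nat p" "nat i" a] pi Suc.prems by (simp del: mult_Suc mult_Suc_right Rop.simps)
    qed
    finally show ?thesis unfolding Fop_scale .
  qed
  have l: "n * ?m + a < (?d + 1) * ?m" using Suc.prems by (intro index_less) auto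
  have dd: "dim_row (A1 * A2 * A3) = (?d + 1) * ?m" "dim_row (A1 * A2) = (?d + 1) * ?m" using dims by simp_all
  have "act (R_mat s ?d d2 u) F (n * ?m + a) = act A1 (act A2 (act A3 (act A4 F))) (n * ?m + a)"
    unfolding R using l dims dd by (simp add: act_mult del: mult_Suc mult_Suc_right)
  then show ?case unfolding G1 by (simp add: v_def Yop_def)
qed

lemma Kop_cong:
  assumes "\<And>n. 0 \<le> n \<Longrightarrow> n \<le> int (Suc e) \<Longrightarrow> f n = g n"
  shows "Kop B (Suc e) u f n = Kop B (Suc e) u g n"
proof -
  have "(\<lambda>n. inr (Suc e) n * f n) = (\<lambda>n. inr (Suc e) n * g n)"
    by (intro ext) (use assms in \<open>auto simp: inr_def\<close>)
  then show ?thesis using Kop_in[of B e u f n] Kop_in[of B e u g n] by simp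
qed

lemma dim_K_half [simp]: "dim_row (K_half s B u) = 2" "dim_col (K_half s B u) = 2"
  by (simp_all add: K_half_def mat_of_rows_list_def)

lemma K_half_entries:
  "K_half s B u $$ (0, 0) = u * eps_plus B + inverse u * eps_minus B"
  "K_half s B u $$ (0, 1) = k_plus B * cfun (u\<^sup>2) / Q"
  "K_half s B u $$ (1, 0) = k_minus B * cfun (u\<^sup>2) / Q"
  "K_half s B u $$ (1, 1) = u * eps_minus B + inverse u * eps_plus B"
  by (simp_all add: K_half_def mat_of_rows_list_def)

lemma act_K_half:
  assumes "p < 2"
  shows "act (K_half s B u) F p = Khop B u (\<lambda>k. F (nat k)) (int p)"
proof -
  have A: "act (K_half s B u) F p = K_half s B u $$ (p, 0) * F 0 + K_half s B u $$ (p, 1) * F 1"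
    by (simp add: act_def numeral_2_eq_2)
  consider "p = 0" | "p = 1" using assms by linarith
  then show ?thesis
  proof cases
    case 1 then show ?thesis using A[unfolded 1 K_half_entries] by (simp add: Khop_def)
  next
    case 2 then show ?thesis using A[unfolded 2 K_half_entries] by (simp add: Khop_def)
  qed
qed

lemma Khop_cong: "f 0 = g 0 \<Longrightarrow> f 1 = g 1 \<Longrightarrow> Khop B u f p = Khop B u g p"
  by (simp add: Khop_def)

lemma Khop_scale: "Khop B u (\<lambda>n. c * f n) p = c * Khop B u f p"
  using Khop_lin[of B u c f 0 f] by simp

lemma dim_K_mat: "dim_row (K_mat s B (Suc e) u) = e + 2" "dim_col (K_mat s B (Suc e) u) = e + 2"
  by (cases e; simp add: Let_def)+

lemma act_K_mat:
  assumes "n \<le> Suc e"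
  shows "act (K_mat s B (Suc e) u) F n = ksc (Suc e) u * Kop B (Suc e) u (\<lambda>k. F (nat k)) (int n)"
  using assms
proof (induction e arbitrary: u n F)
  case 0
  then show ?case using act_K_half[of n B u F] by simp
next
  case (Suc e)
  let ?d = "Suc (Suc e)" and ?e = "Suc e"
  define v1 where "v1 = u * s powi (- int ?e)"
  define v2 where "v2 = u\<^sup>2 * s powi (- int e)"
  define A1 where "A1 = F_fus s ?d"
  define A2 where "A2 = K_half s B v1 \<otimes>\<^sub>K 1\<^sub>m ?d"
  define A3 where "A3 = R_half s ?e v2"
  define A4 where "A4 = 1\<^sub>m 2 \<otimes>\<^sub>K K_mat s B ?e (u * s)"
  define A5 where "A5 = E_fus s ?d"
  have R: "K_mat s B ?d u = A1 * A2 * A3 * A4 * A5"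
    by (simp add: Let_def A1_def A2_def A3_def A4_def A5_def v1_def v2_def)
  have dims: "dim_row A1 = ?d + 1" "dim_col A1 = 2 * ?d" "dim_row A2 = 2 * ?d" "dim_col A2 = 2 * ?d"
    "dim_row A3 = 2 * ?d" "dim_col A3 = 2 * ?d" "dim_row A4 = 2 * ?d" "dim_col A4 = 2 * ?d" "dim_row A5 = 2 * ?d" "dim_col A5 = ?d + 1"
    by (simp_all add: A1_def A2_def A3_def A4_def A5_def dim_R_half dim_K_mat)
  let ?E = "\<lambda>p i. Eop ?d (\<lambda>k. F (nat k)) p i"
  let ?Z = "\<lambda>p i. Kop B ?e (u * s) (\<lambda>i. ?E p i) i"
  let ?V = "\<lambda>p i. Lop ?e v2 (\<lambda>p i. ?Z p i) p i"
  let ?Y = "\<lambda>p i. Khop B v1 (\<lambda>p. ?V p i) p"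
  let ?r = "ksc ?e (u * s)"
  \<comment> \<open>\<open>G5\<close> to \<open>G1\<close> describe the vector after each of the five factors.\<close>
  have G5: "act A5 F (p * ?d + i) = ?E (int p) (int i)" if "p < 2" "i < ?d" for p i
    unfolding A5_def by (rule act_E_fus) (use that in auto)
  have G4: "act A4 (act A5 F) (p * ?d + i) = ?r * ?Z (int p) (int i)" if "p < 2" "i < ?d" for p i
  proof -
    have "act A4 (act A5 F) (p * ?d + i) = act (K_mat s B ?e (u * s)) (\<lambda>j. act A5 F (p * ?d + j)) i"
      using act_kron_left_one[of i "K_mat s B ?e (u * s)" p 2 "act A5 F"] that by (simp add: A4_def dim_K_mat)
    also have "\<dots> = ?r * Kop B ?e (u * s) (\<lambda>k. act A5 F (p * ?d + nat k)) (int i)"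
      using that by (intro Suc.IH) auto
    also have "Kop B ?e (u * s) (\<lambda>k. act A5 F (p * ?d + nat k)) (int i) = ?Z (int p) (int i)"
    proof (rule Kop_cong)
      fix n :: int assume "0 \<le> n" "n \<le> int ?e"
      then show "act A5 F (p * ?d + nat n) = ?E (int p) n" using G5[of p "nat n"] that by (simp add: nat_less_iff)
    qed
    finally show ?thesis .
  qed
  have G3: "act A3 (act A4 (act A5 F)) (p * ?d + i) = hs ?e v2 * ?r * ?V (int p) (int i)" if "p < 2" "i < ?d" for p i
  proof -
    let ?G = "act A4 (act A5 F)"
    have "act A3 ?G (p * ?d + i) = hs ?e v2 * Lop ?e v2 (lift2 ?d ?G) (int p) (int i)"
      using act_R_half[of ?e p i v2 ?G] that by (simp add: A3_def)
    also have "Lop ?e v2 (lift2 ?d ?G) (int p) (int i) = Lop ?e v2 (\<lambda>p i. ?r * ?Z p i) (int p) (int i)"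
    proof (rule Lop_cong)
      fix n c :: int assume nc: "0 \<le> n" "n \<le> 1" "0 \<le> c" "c \<le> int ?e"
      then have "nat n < 2" "nat c < ?d" by auto
      then show "lift2 ?d ?G n c = ?r * ?Z n c"
        using G4[of "nat n" "nat c"] nc unfolding lift2_def by (simp del: mult_Suc mult_Suc_right Kop.simps)
    qed
    finally show ?thesis unfolding Lop_scale by simp
  qed
  have G2: "act A2 (act A3 (act A4 (act A5 F))) (p * ?d + i) = hs ?e v2 * ?r * ?Y (int p) (int i)" if "p < 2" "i < ?d" for p i
  proof -
    let ?G = "act A3 (act A4 (act A5 F))"
    have "act A2 ?G (p * ?d + i) = act (K_half s B v1) (\<lambda>p. ?G (p * ?d + i)) p"
      unfolding A2_def using that by (intro act_kron_right_one) auto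
    also have "\<dots> = Khop B v1 (\<lambda>k. ?G (nat k * ?d + i)) (int p)"
      using that by (intro act_K_half)
    also have "\<dots> = Khop B v1 (\<lambda>k. (hs ?e v2 * ?r) * ?V k (int i)) (int p)"
      by (rule Khop_cong) (use G3[of 0 i] G3[of 1 i] that in \<open>simp_all del: Kop.simps\<close>)
    finally show ?thesis unfolding Khop_scale .
  qed
  have G1: "act A1 (act A2 (act A3 (act A4 (act A5 F)))) n = hs ?e v2 * ?r * Fop ?d (\<lambda>p i. ?Y p i) (int n)"
  proof -
    let ?G = "act A2 (act A3 (act A4 (act A5 F)))"
    have "act A1 ?G n = Fop ?d (\<lambda>p i. ?G (nat p * ?d + nat i)) (int n)"
      unfolding A1_def using Suc.prems by (intro act_F_fus) auto
    also have "\<dots> = Fop ?d (\<lambda>p i. (hs ?e v2 * ?r) * ?Y p i) (int n)"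
    proof (rule Fop_cong)
      fix p i :: int assume pi: "0 \<le> p" "p \<le> 1" "0 \<le> i" "i < int ?d"
      then have "nat p < 2" "nat i < ?d" by auto
      then show "?G (nat p * ?d + nat i) = (hs ?e v2 * ?r) * ?Y p i"
        using G2[of "nat p" "nat i"] pi by (simp del: mult_Suc mult_Suc_right Kop.simps)
    qed
    finally show ?thesis unfolding Fop_scale .
  qed
  have dd: "dim_row (A1 * A2 * A3 * A4) = ?d + 1" "dim_row (A1 * A2 * A3) = ?d + 1" "dim_row (A1 * A2) = ?d + 1" using dims by simp_all
  have "act (K_mat s B ?d u) F n = act A1 (act A2 (act A3 (act A4 (act A5 F)))) n"
    unfolding R using Suc.prems dims dd by (simp add: act_mult del: mult_Suc mult_Suc_right)
  moreover have "(\<lambda>p i. ?Y p i) = YK B (Kop B ?e (u * s)) ?e v1 v2 (\<lambda>k. F (nat k))"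
    by (simp add: YK_def fun_eq_iff)
  ultimately show ?case unfolding G1 by (simp add: v1_def v2_def)
qed

end

section \<open>The transfer matrix and the operators W as operators\<close>

text \<open>
  The operator \<open>R\<close> acting on the site at position \<open>p\<close> and the auxiliary space.
\<close>

definition site :: "((int \<Rightarrow> int \<Rightarrow> complex) \<Rightarrow> int \<Rightarrow> int \<Rightarrow> complex) \<Rightarrow> nat \<Rightarrow> (int list \<Rightarrow> int \<Rightarrow> complex) \<Rightarrow> int list \<Rightarrow> int \<Rightarrow> complex" where
  "site R p f xs a = R (\<lambda>k c. f (xs[p := k]) c) (xs ! p) a"

lemma site_Cons: "site R (Suc p) h (x # xs) a = site R p (\<lambda>ys. h (x # ys)) xs a"
  by (simp add: site_def)

lemma foldr_site_Cons:
  assumes "\<And>n. n \<in> set ns \<Longrightarrow> n \<le> N"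
  shows "foldr (\<lambda>n. site R (Suc N - n)) ns g (x # xs) a = foldr (\<lambda>n. site R (N - n)) ns (\<lambda>ys. g (x # ys)) xs a"
  using assms
proof (induction ns arbitrary: xs a)
  case (Cons n ns)
  then have e: "Suc N - n = Suc (N - n)" by (simp add: Suc_diff_le)
  have IH: "(\<lambda>ys. foldr (\<lambda>n. site R (Suc N - n)) ns g (x # ys)) = foldr (\<lambda>n. site R (N - n)) ns (\<lambda>ys. g (x # ys))"
    by (intro ext Cons.IH) (use Cons.prems in simp)
  show ?case unfolding foldr.simps o_apply e site_Cons IH ..
qed simp

text \<open>
  The recursive double row as a product of R-operators; site \<open>n\<close> has position \<open>N - n\<close>.
\<close>

lemma chain_foldr:
  "length xs = N \<Longrightarrow> chain R K N f xs a
    = foldr (\<lambda>n. site R (N - n)) (rev [1..<N + 1]) (\<lambda>ys b. K (foldr (\<lambda>n. site R (N - n)) [1..<N + 1] f ys) b) xs a"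
proof (induction N arbitrary: f xs a)
  case 0 then show ?case by simp
next
  case (Suc N)
  then obtain x zs where xs: "xs = x # zs" "length zs = N" by (cases xs) auto
  have u: "[1..<Suc N + 1] = [1..<N + 1] @ [Suc N]" by simp
  have s0: "site R 0 g (i # ys) = (\<lambda>e. R (\<lambda>k c. g (k # ys) c) i e)" for g i ys
    by (simp add: site_def fun_eq_iff)
  have f1: "foldr (\<lambda>n. site R (Suc N - n)) [1..<N + 1] g (i # ys) = foldr (\<lambda>n. site R (N - n)) [1..<N + 1] (\<lambda>ys. g (i # ys)) ys" for g i ys
    by (intro ext foldr_site_Cons) auto
  have f2: "foldr (\<lambda>n. site R (Suc N - n)) (rev [1..<N + 1]) g (i # ys) c = foldr (\<lambda>n. site R (N - n)) (rev [1..<N + 1]) (\<lambda>ys. g (i # ys)) ys c" for g i ys c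
    by (rule foldr_site_Cons) auto
  have "foldr (\<lambda>n. site R (Suc N - n)) (rev [1..<Suc N + 1]) (\<lambda>ys b. K (foldr (\<lambda>n. site R (Suc N - n)) [1..<Suc N + 1] f ys) b) xs a
    = site R 0 (foldr (\<lambda>n. site R (Suc N - n)) (rev [1..<N + 1]) (\<lambda>ys b. K (foldr (\<lambda>n. site R (Suc N - n)) [1..<N + 1] (site R 0 f) ys) b)) (x # zs) a"
    unfolding u xs by simp
  also have "\<dots> = chain R K (Suc N) f xs a"
    unfolding s0 f2 f1 chain.simps xs list.sel Suc.IH[OF xs(2)] ..
  finally show ?case ..
qed

lemma encd_snoc: "length xs = N \<Longrightarrow> encd (replicate (N + 1) D) (xs @ [a]) = encd (replicate N D) xs * D + a"
proof (induction N arbitrary: xs)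
  case (Suc N)
  then obtain x ys where "xs = x # ys" "length ys = N" by (cases xs) auto
  with Suc.IH[of ys] show ?case by (simp add: algebra_simps)
qed simp

lemma valid_snoc: "length xs = N \<Longrightarrow> valid (replicate (N + 1) D) (xs @ [a]) \<longleftrightarrow> valid (replicate N D) xs \<and> a < D"
proof (induction N arbitrary: xs)
  case (Suc N)
  then obtain x ys where "xs = x # ys" "length ys = N" by (cases xs) auto
  with Suc.IH[of ys] show ?case by simp
qed simp

text \<open>
  A coordinate vector and a function of lists of digits represent the same vector; in \<open>agree2\<close>
  there is in addition the auxiliary space as the last factor.
\<close>

definition agree1 :: "nat \<Rightarrow> nat \<Rightarrow> (nat \<Rightarrow> complex) \<Rightarrow> (int list \<Rightarrow> complex) \<Rightarrow> bool" where
  "agree1 D N F f \<longleftrightarrow> (\<forall>xs. valid (replicate N D) xs \<longrightarrow> F (encd (replicate N D) xs) = f (map int xs))"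

definition agree2 :: "nat \<Rightarrow> nat \<Rightarrow> (nat \<Rightarrow> complex) \<Rightarrow> (int list \<Rightarrow> int \<Rightarrow> complex) \<Rightarrow> bool" where
  "agree2 D N F f \<longleftrightarrow> (\<forall>xs a. valid (replicate N D) xs \<longrightarrow> a < D \<longrightarrow> F (encd (replicate N D) xs * D + a) = f (map int xs) (int a))"

lemma agree2D: "agree2 D N F f \<Longrightarrow> valid (replicate N D) xs \<Longrightarrow> a < D \<Longrightarrow> F (encd (replicate N D) xs * D + a) = f (map int xs) (int a)"
  by (simp add: agree2_def)

lemma site_agree:
  assumes M: "\<And>F n a. n < D \<Longrightarrow> a < D \<Longrightarrow> act M F (n * D + a) = R (lift2 D F) (int n) (int a)"
    and cM: "dim_col M = D * D"
    and cong: "\<And>f g n a. (\<And>n a. 0 \<le> n \<Longrightarrow> n < int D \<Longrightarrow> 0 \<le> a \<Longrightarrow> a < int D \<Longrightarrow> f n a = g n a) \<Longrightarrow> R f n a = R g n a"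
    and p: "p < N" and F: "agree2 D N F f"
  shows "agree2 D N (act (two_leg (replicate (N + 1) D) p N M) F) (site R p f)"
  unfolding agree2_def
proof (intro allI impI)
  fix xs a assume xs: "valid (replicate N D) xs" and a: "a < D"
  have len: "length xs = N" using valid_length[OF xs] by simp
  let ?ds = "replicate (N + 1) D"
  have v: "valid ?ds (xs @ [a])" using valid_snoc[OF len] xs a by simp
  have up: "valid (replicate N D) (xs[p := k])" if "k < D" for k
    using xs that p len unfolding valid_def list_all2_conv_all_nth by (auto simp: nth_list_update)
  have upd: "(xs @ [a])[p := k, N := c] = xs[p := k] @ [c]" for k c
    using p len by (simp add: list_update_append)
  have "act (two_leg ?ds p N M) F (encd (replicate N D) xs * D + a) = act (two_leg ?ds p N M) F (encd ?ds (xs @ [a]))"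
    using encd_snoc[OF len] by simp
  also have "\<dots> = (\<Sum>k<D. \<Sum>c<D. M $$ (xs ! p * D + a, k * D + c) * F (encd ?ds ((xs @ [a])[p := k, N := c])))"
    using p len by (subst act_two_leg[OF v]) (simp_all add: nth_append del: replicate_Suc)
  also have "\<dots> = (\<Sum>k<D. \<Sum>c<D. M $$ (xs ! p * D + a, k * D + c) * F (encd (replicate N D) (xs[p := k]) * D + c))"
    unfolding upd using encd_snoc[of "xs[p := k]" N D for k] len by simp
  also have "\<dots> = (\<Sum>k<D. \<Sum>c<D. M $$ (xs ! p * D + a, k * D + c) * f ((map int xs)[p := int ((k * D + c) div D)]) (int ((k * D + c) mod D)))"
    by (intro sum.cong refl arg_cong2[where f = times]) (use agree2D[OF F up] in \<open>auto simp: map_update\<close>)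
  also have "\<dots> = act M (\<lambda>k. f ((map int xs)[p := int (k div D)]) (int (k mod D))) (xs ! p * D + a)"
    unfolding act_def cM sum_mult_nat ..
  also have "\<dots> = R (lift2 D (\<lambda>k. f ((map int xs)[p := int (k div D)]) (int (k mod D)))) (int (xs ! p)) (int a)"
    using valid_nth[OF xs, of p] p a by (intro M) auto
  also have "\<dots> = R (\<lambda>k c. f ((map int xs)[p := k]) c) (int (xs ! p)) (int a)"
  proof (rule cong)
    fix n c :: int assume nc: "0 \<le> n" "n < int D" "0 \<le> c" "c < int D"
    then have "nat c < D" by auto
    then have "(nat n * D + nat c) div D = nat n" "(nat n * D + nat c) mod D = nat c" by auto
    then show "lift2 D (\<lambda>k. f ((map int xs)[p := int (k div D)]) (int (k mod D))) n c = f ((map int xs)[p := n]) c"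
      unfolding lift2_def using nc by simp
  qed
  finally show "act (two_leg ?ds p N M) F (encd (replicate N D) xs * D + a) = site R p f (map int xs) (int a)"
    using p len by (simp add: site_def)
qed

lemma act_add:
  assumes "dim_row A = dim_row B" "dim_col A = dim_col B" "i < dim_row A"
  shows "act (A + B) F i = act A F i + act B F i"
  unfolding act_def using assms by (simp add: sum.distrib[symmetric] algebra_simps)

lemma act_smult: "i < dim_row A \<Longrightarrow> act (c \<cdot>\<^sub>m A) F i = c * act A F i"
  by (simp add: act_def sum_distrib_left algebra_simps)

lemma dim_foldr_mult:
  assumes "\<And>n. n \<in> set ns \<Longrightarrow> dim_row (A n) = m \<and> dim_col (A n) = m"
  shows "dim_row (foldr (\<lambda>n M. A n * M) ns (1\<^sub>m m)) = m \<and> dim_col (foldr (\<lambda>n M. A n * M) ns (1\<^sub>m m)) = m"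
  using assms by (induction ns) auto

lemma act_foldr:
  assumes "\<And>n. n \<in> set ns \<Longrightarrow> dim_row (A n) = m \<and> dim_col (A n) = m" "i < m"
  shows "act (foldr (\<lambda>n M. A n * M) ns (1\<^sub>m m)) F i = foldr (\<lambda>n. act (A n)) ns F i"
  using assms
proof (induction ns arbitrary: i)
  case Nil then show ?case by (simp add: act_one)
next
  case (Cons n ns)
  have dim: "dim_row (A n) = m" "dim_col (A n) = m" using Cons.prems by auto
  have df: "dim_row (foldr (\<lambda>n M. A n * M) ns (1\<^sub>m m)) = m"
    using dim_foldr_mult[of ns A m] Cons.prems by simp
  have "act (A n * foldr (\<lambda>n M. A n * M) ns (1\<^sub>m m)) F i = act (A n) (act (foldr (\<lambda>n M. A n * M) ns (1\<^sub>m m)) F) i"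
    using dim df Cons.prems(2) by (intro act_mult) simp_all
  also have "\<dots> = act (A n) (foldr (\<lambda>n. act (A n)) ns F) i"
    by (rule act_cong) (use dim Cons.IH Cons.prems in simp)
  finally show ?case by simp
qed

lemma encd_lt: "valid (replicate N D) xs \<Longrightarrow> encd (replicate N D) xs < D ^ N"
  using encd_less[of "replicate N D" xs] by (simp add: prod_list_replicate)

lemma act_ptrace:
  assumes "x < n" "dim_col T = n * m"
  shows "act (ptrace_last n m T) G x = (\<Sum>a<m. act T (\<lambda>k. of_bool (k mod m = a) * G (k div m)) (x * m + a))"
proof -
  have 1: "act T (\<lambda>k. of_bool (k mod m = a) * G (k div m)) (x * m + a) = (\<Sum>y<n. T $$ (x * m + a, y * m + a) * G y)" if "a < m" for a
  proof -
    have "act T (\<lambda>k. of_bool (k mod m = a) * G (k div m)) (x * m + a)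
      = (\<Sum>y<n. \<Sum>c<m. T $$ (x * m + a, y * m + c) * (of_bool ((y * m + c) mod m = a) * G ((y * m + c) div m)))"
      unfolding act_def assms(2) sum_mult_nat ..
    also have "\<dots> = (\<Sum>y<n. \<Sum>c<m. if c = a then T $$ (x * m + a, y * m + a) * G y else 0)"
      by (intro sum.cong refl) auto
    finally show ?thesis using that by simp
  qed
  have "act (ptrace_last n m T) G x = (\<Sum>y<n. (\<Sum>a<m. T $$ (x * m + a, y * m + a)) * G y)"
    unfolding act_def using assms(1) by (simp add: ptrace_last_def)
  also have "\<dots> = (\<Sum>a<m. \<Sum>y<n. T $$ (x * m + a, y * m + a) * G y)"
    unfolding sum_distrib_right by (rule sum.swap)
  also have "\<dots> = (\<Sum>a<m. act T (\<lambda>k. of_bool (k mod m = a) * G (k div m)) (x * m + a))"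
    by (intro sum.cong refl) (simp add: 1)
  finally show ?thesis .
qed

text \<open>
  The transfer matrix acts as the partial trace of the double row, for any operators \<open>R\<close>, \<open>K\<close> and
  \<open>Dg\<close> that represent its constituents.  The congruence conditions say that \<open>R\<close> and \<open>K\<close> ignore values outside
  the index range.
\<close>

lemma act_transfer:
  fixes d N :: nat
  defines "D \<equiv> d + 1"
  assumes M: "\<And>F n a. n < D \<Longrightarrow> a < D \<Longrightarrow> act (R_tilde s d d u) F (n * D + a) = R (lift2 D F) (int n) (int a)"
    and congR: "\<And>f g n a. (\<And>n a. 0 \<le> n \<Longrightarrow> n < int D \<Longrightarrow> 0 \<le> a \<Longrightarrow> a < int D \<Longrightarrow> f n a = g n a) \<Longrightarrow> R f n a = R g n a"
    and K: "\<And>F n. n < D \<Longrightarrow> act (K_tilde \<nu> s B d u) F n = K (\<lambda>k. F (nat k)) (int n)"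
    and congK: "\<And>f g n. (\<And>n. 0 \<le> n \<Longrightarrow> n < int D \<Longrightarrow> f n = g n) \<Longrightarrow> K f n = K g n"
    and Kp: "\<And>F a. a < D \<Longrightarrow> act (K_plus_tilde \<nu> s bb d u) F a = Dg (int a) * F a"
    and G: "agree1 D N G g" and xs: "valid (replicate N D) xs"
  shows "act (transfer \<nu> s d N B bb u) G (encd (replicate N D) xs) = trop Dg d (chain R K N) g (map int xs)"
proof -
  let ?A = "\<lambda>n. R_site s d N n u" and ?m = "D ^ (N + 1)" and ?e = "encd (replicate N D)"
  have len: "length xs = N" using valid_length[OF xs] by simp
  have dA: "dim_row (?A n) = ?m \<and> dim_col (?A n) = ?m" for n
    by (simp add: R_site_def prod_list_replicate D_def del: replicate_Suc)
  have cM: "dim_col (R_tilde s d d u) = D * D" by (simp add: R_tilde_def D_def)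
  have dK: "dim_row (K_tilde \<nu> s B d u) = D" "dim_col (K_tilde \<nu> s B d u) = D"
    "dim_row (K_plus_tilde \<nu> s bb d u) = D" "dim_col (K_plus_tilde \<nu> s bb d u) = D"
    by (simp_all add: K_tilde_def K_plus_tilde_def D_def)
  define F1 where "F1 ns = foldr (\<lambda>n M. ?A n * M) ns (1\<^sub>m ?m)" for ns
  have dF: "dim_row (F1 ns) = ?m" "dim_col (F1 ns) = ?m" for ns
    unfolding F1_def using dim_foldr_mult[of ns ?A ?m] dA by simp_all
  have eq: "x * D + a < ?m" if "x < D ^ N" "a < D" for x a
    using index_less[OF that] by (simp add: mult.commute)
  have agF: "agree2 D N (act (F1 ns) F) (foldr (\<lambda>n. site R (N - n)) ns f)"
    if "agree2 D N F f" "\<And>n. n \<in> set ns \<Longrightarrow> 1 \<le> n \<and> n \<le> N" for ns F f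
  proof -
    have "agree2 D N (foldr (\<lambda>n. act (?A n)) ns F) (foldr (\<lambda>n. site R (N - n)) ns f)"
      using that(2)
    proof (induction ns)
      case (Cons n ns)
      then have n: "1 \<le> n" "n \<le> N" by simp_all
      then have lt: "N - n < N" by simp
      have "agree2 D N (act (two_leg (replicate (N + 1) D) (N - n) N (R_tilde s d d u)) (foldr (\<lambda>n. act (?A n)) ns F)) (site R (N - n) (foldr (\<lambda>n. site R (N - n)) ns f))"
        by (rule site_agree[OF M cM congR]) (use Cons lt in auto)
      then show ?case by (simp add: R_site_def D_def del: replicate_Suc)
    qed (use that in simp)
    then show ?thesis unfolding agree2_def F1_def
      using act_foldr[of ns ?A ?m] dA eq[OF encd_lt] by simp
  qed
  have agK: "agree2 D N (act (1\<^sub>m (D ^ N) \<otimes>\<^sub>K K_tilde \<nu> s B d u) F) (\<lambda>ys b. K (f ys) b)" if F: "agree2 D N F f" for F f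
    unfolding agree2_def
  proof (intro allI impI)
    fix ys a assume ys: "valid (replicate N D) ys" and a: "a < D"
    have "act (1\<^sub>m (D ^ N) \<otimes>\<^sub>K K_tilde \<nu> s B d u) F (?e ys * D + a) = act (K_tilde \<nu> s B d u) (\<lambda>j. F (?e ys * D + j)) a"
      using act_kron_left_one[of a "K_tilde \<nu> s B d u" "?e ys" "D ^ N" F] a encd_lt[OF ys] unfolding dK by simp
    also have "\<dots> = K (\<lambda>k. F (?e ys * D + nat k)) (int a)" by (rule K[OF a])
    also have "\<dots> = K (f (map int ys)) (int a)"
    proof (rule congK)
      fix n :: int assume "0 \<le> n" "n < int D"
      then show "F (?e ys * D + nat n) = f (map int ys) n" using agree2D[OF F ys, of "nat n"] by (simp add: nat_less_iff)
    qed
    finally show "act (1\<^sub>m (D ^ N) \<otimes>\<^sub>K K_tilde \<nu> s B d u) F (?e ys * D + a) = K (f (map int ys)) (int a)" .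
  qed
  define P where "P = 1\<^sub>m (D ^ N) \<otimes>\<^sub>K K_plus_tilde \<nu> s bb d u"
  define S where "S = 1\<^sub>m (D ^ N) \<otimes>\<^sub>K K_tilde \<nu> s B d u"
  have dPS: "dim_row P = ?m" "dim_col P = ?m" "dim_row S = ?m" "dim_col S = ?m"
    by (simp_all add: P_def S_def dK)
  define T where "T = P * F1 (rev [1..<N + 1]) * S * F1 [1..<N + 1]"
  have tr: "transfer \<nu> s d N B bb u = ptrace_last (D ^ N) D T"
    by (simp add: transfer_def Let_def T_def P_def S_def F1_def D_def)
  have aT: "act T H (?e xs * D + a) = Dg (int a) * chain R K N h (map int xs) (int a)" if H: "agree2 D N H h" and a: "a < D" for H h a
  proof -
    have l: "?e xs * D + a < ?m" by (rule eq[OF encd_lt[OF xs] a])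
    let ?Y = "act (F1 (rev [1..<N + 1])) (act S (act (F1 [1..<N + 1]) H))"
    have "act T H (?e xs * D + a) = act P ?Y (?e xs * D + a)"
      unfolding T_def using l dPS dF by (simp add: act_mult)
    also have "\<dots> = act (K_plus_tilde \<nu> s bb d u) (\<lambda>j. ?Y (?e xs * D + j)) a"
      using act_kron_left_one[of a "K_plus_tilde \<nu> s bb d u" "?e xs" "D ^ N" ?Y] a encd_lt[OF xs] unfolding dK P_def by simp
    also have "\<dots> = Dg (int a) * ?Y (?e xs * D + a)" by (rule Kp[OF a])
    also have "?Y (?e xs * D + a) = chain R K N h (map int xs) (int a)"
    proof -
      have "agree2 D N ?Y (foldr (\<lambda>n. site R (N - n)) (rev [1..<N + 1]) (\<lambda>ys b. K (foldr (\<lambda>n. site R (N - n)) [1..<N + 1] h ys) b))"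
        unfolding S_def by (intro agF agK H) auto
      then show ?thesis using agree2D[OF _ xs a] chain_foldr[of "map int xs" N R K h] len by simp
    qed
    finally show ?thesis .
  qed
  have dT: "dim_col T = D ^ N * D" by (simp add: T_def dF)
  have "act (transfer \<nu> s d N B bb u) G (?e xs) = (\<Sum>a<D. act T (\<lambda>k. of_bool (k mod D = a) * G (k div D)) (?e xs * D + a))"
    unfolding tr by (rule act_ptrace[OF encd_lt[OF xs] dT])
  also have "\<dots> = (\<Sum>a<D. Dg (int a) * chain R K N (\<lambda>ys b. of_bool (b = int a) * g ys) (map int xs) (int a))"
  proof (intro sum.cong refl aT)
    fix a assume "a \<in> {..<D}"
    show "agree2 D N (\<lambda>k. of_bool (k mod D = a) * G (k div D)) (\<lambda>ys b. of_bool (b = int a) * g ys)"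
      using G unfolding agree1_def agree2_def by auto
  qed auto
  also have "\<dots> = trop Dg d (chain R K N) g (map int xs)"
    unfolding trop_def
    by (rule sum.reindex_bij_witness[of _ nat int]) (auto simp: D_def)
  finally show ?thesis .
qed

context generic_q begin

lemma act_S_plus: "i \<le> d \<Longrightarrow> act (S_plus s d) F i = b d (int i) * F (i + 1)"
proof -
  assume i: "i \<le> d"
  have "act (S_plus s d) F i = (\<Sum>k<d + 1. if k = i + 1 then b d (int i) * F (i + 1) else 0)"
    unfolding act_def using i by (intro sum.cong) auto
  then show ?thesis using i by (cases "i = d") auto
qed

lemma act_S_minus:
  assumes i: "i \<le> d"
  shows "act (S_minus s d) F i = b d (int i - 1) * F (i - 1)"
proof (cases i)
  case 0
  have "act (S_minus s d) F i = 0"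
    unfolding act_def using 0 by (intro sum.neutral) auto
  with 0 show ?thesis by simp
next
  case (Suc m)
  have "act (S_minus s d) F i = (\<Sum>k<d + 1. if k = m then b d (int m) * F m else 0)"
    unfolding act_def using i Suc by (intro sum.cong) auto
  with i Suc show ?thesis by simp
qed

lemma act_qexp_half: "i < dim_row A \<Longrightarrow> act (qexp_half s A) F i = s powi (A $$ (i, i)) * F i"
  by (simp add: act_def qexp_half_def if_distrib[of "\<lambda>x. x * _"] cong: if_cong)

lemma act_W_ladder:
  assumes i: "i \<le> d" and A: "dim_row A = d + 1" "dim_col A = d + 1" and At: "\<And>k. k \<le> d \<Longrightarrow> A $$ (k, k) = t * (int d - 2 * int k)"
    and t: "t = 1 \<or> t = - 1"
  shows "act ((k_plus B * s powi t) \<cdot>\<^sub>m (S_plus s d * qexp_half s A) + (k_minus B * s powi (- t)) \<cdot>\<^sub>m (S_minus s d * qexp_half s A)) F i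
     = Aop B d t 1 (\<lambda>k. F (nat k)) (int i)"
proof -
  have q: "act (qexp_half s A) F k = kp d t (int k) * F k" if "k \<le> d" for k
    using act_qexp_half[of k A F] A At[OF that] that by (simp add: kp_def)
  have p: "b d (int i) * act (qexp_half s A) F (i + 1) = b d (int i) * (kp d t (int i + 1) * F (i + 1))"
    using q[of "i + 1"] i by (cases "i = d") (auto simp: add.commute)
  have m: "b d (int i - 1) * act (qexp_half s A) F (i - 1) = b d (int i - 1) * (kp d t (int i - 1) * F (i - 1))"
    using q[of "i - 1"] i by (cases "i = 0") (auto simp: of_nat_diff)
  have "act ((k_plus B * s powi t) \<cdot>\<^sub>m (S_plus s d * qexp_half s A) + (k_minus B * s powi (- t)) \<cdot>\<^sub>m (S_minus s d * qexp_half s A)) F i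
     = (k_plus B * s powi t) * (b d (int i) * act (qexp_half s A) F (i + 1)) + (k_minus B * s powi (- t)) * (b d (int i - 1) * act (qexp_half s A) F (i - 1))"
    using i A by (simp add: act_add act_smult act_mult act_S_plus act_S_minus)
  also have "\<dots> = Aop B d t 1 (\<lambda>k. F (nat k)) (int i)"
  proof -
    have "nat (int i - 1) = i - 1" by simp
    then show ?thesis
      unfolding p m by (simp add: Aop_eq cA_def kB_def bs_def nat_add_distrib)
  qed
  finally show ?thesis .
qed

text \<open>
  A family of matrices with the recursion of \<open>W\<^sub>0\<close> and \<open>W\<^sub>1\<close> acts as \<open>Wch\<close>.
\<close>

lemma act_kron_recursion:
  fixes W :: "nat \<Rightarrow> complex mat"
  assumes W0: "W 0 = c \<cdot>\<^sub>m 1\<^sub>m 1" and c: "c = epB B t"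
    and WS: "\<And>n. W (Suc n) = X \<otimes>\<^sub>K 1\<^sub>m (D ^ n) + Z \<otimes>\<^sub>K W n"
    and dim: "dim_row X = D" "dim_col X = D" "dim_row Z = D" "dim_col Z = D"
    and X: "\<And>F i. i < D \<Longrightarrow> act X F i = Aop B d t 1 (\<lambda>k. F (nat k)) (int i)"
    and Z: "\<And>F i. i < D \<Longrightarrow> act Z F i = kp d (2 * t) (int i) * F i"
    and D: "D = d + 1"
  shows "dim_row (W N) = D ^ N \<and> dim_col (W N) = D ^ N"
    and "valid (replicate N D) xs \<Longrightarrow> agree1 D N G g \<Longrightarrow> act (W N) G (encd (replicate N D) xs) = Wch B d t N g (map int xs)"
proof -
  have dW: "dim_row (W N) = D ^ N \<and> dim_col (W N) = D ^ N" for N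
    by (induction N) (simp_all add: W0 WS dim)
  then show "dim_row (W N) = D ^ N \<and> dim_col (W N) = D ^ N" .
  show "valid (replicate N D) xs \<Longrightarrow> agree1 D N G g \<Longrightarrow> act (W N) G (encd (replicate N D) xs) = Wch B d t N g (map int xs)"
  proof (induction N arbitrary: xs G g)
    case 0
    then show ?case by (simp add: W0 c act_def agree1_def)
  next
    case (Suc N)
    then obtain x ys where x: "xs = x # ys" "x < D" "valid (replicate N D) ys" by (auto simp: valid_Cons)
    let ?e = "encd (replicate N D)"
    have e: "encd (replicate (Suc N) D) (k # zs) = k * D ^ N + encd (replicate N D) zs" for k zs
      by (simp add: prod_list_replicate)
    have l: "x * D ^ N + ?e ys < D * D ^ N" using x encd_lt[OF x(3)] by (intro index_less)
    have ag: "agree1 D N (\<lambda>j. G (x * D ^ N + j)) (\<lambda>zs. g (int x # zs))"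
      unfolding agree1_def
    proof (intro allI impI)
      fix zs assume "valid (replicate N D) zs"
      then show "G (x * D ^ N + encd (replicate N D) zs) = g (int x # map int zs)"
        using Suc.prems(2)[unfolded agree1_def, rule_format, of "x # zs"] x e by simp
    qed
    have "act (W (Suc N)) G (x * D ^ N + ?e ys) = act (X \<otimes>\<^sub>K 1\<^sub>m (D ^ N)) G (x * D ^ N + ?e ys) + act (Z \<otimes>\<^sub>K W N) G (x * D ^ N + ?e ys)"
      unfolding WS using l dim dW by (intro act_add) simp_all
    also have "act (X \<otimes>\<^sub>K 1\<^sub>m (D ^ N)) G (x * D ^ N + ?e ys) = act X (\<lambda>k. G (k * D ^ N + ?e ys)) x"
      using x dim encd_lt[OF x(3)] by (intro act_kron_right_one) simp_all
    also have "\<dots> = Aop B d t 1 (\<lambda>k. G (nat k * D ^ N + ?e ys)) (int x)" by (rule X[OF x(2)])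
    also have "\<dots> = Aop B d t 1 (\<lambda>k. g (k # map int ys)) (int x)"
    proof -
      have gg: "G (nat k * D ^ N + ?e ys) = g (k # map int ys)" if "0 \<le> k" "k \<le> int d" for k
        using Suc.prems(2)[unfolded agree1_def, rule_format, of "nat k # ys"] x e[of "nat k" ys] that D by (simp add: nat_less_iff)
      have "cA B d 1 t 1 (int x) * G (nat (int x + 1) * D ^ N + ?e ys) = cA B d 1 t 1 (int x) * g ((int x + 1) # map int ys)"
        using gg[of "int x + 1"] x D by (cases "x = d") (auto simp: cA_def bs_def)
      moreover have "cA B d (-1) t 1 (int x) * G (nat (int x + -1) * D ^ N + ?e ys) = cA B d (-1) t 1 (int x) * g ((int x + -1) # map int ys)"
        using gg[of "int x + -1"] x D by (cases "x = 0") (auto simp: cA_def bs_def)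
      ultimately show ?thesis unfolding Aop_eq by (simp only:)
    qed
    also have "act (Z \<otimes>\<^sub>K W N) G (x * D ^ N + ?e ys) = act Z (\<lambda>i'. act (W N) (\<lambda>j'. G (i' * D ^ N + j')) (?e ys)) x"
      using act_kron[of x Z "?e ys" "W N" G] dim dW x encd_lt[OF x(3)] by simp
    also have "\<dots> = kp d (2 * t) (int x) * act (W N) (\<lambda>j'. G (x * D ^ N + j')) (?e ys)" by (rule Z[OF x(2)])
    also have "act (W N) (\<lambda>j'. G (x * D ^ N + j')) (?e ys) = Wch B d t N (\<lambda>zs. g (int x # zs)) (map int ys)"
      by (rule Suc.IH[OF x(3) ag])
    finally show ?case using x e by simp
  qed
qed

lemma act_W_weight:
  assumes "i < d + 1" "dim_row A = d + 1" "A $$ (i, i) = 2 * (t * (int d - 2 * int i))"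
  shows "act (qexp_half s A) F i = kp d (2 * t) (int i) * F i"
  using act_qexp_half[of i A F] assms by (simp add: kp_def mult.assoc)

lemma act_W0:
  "dim_row (W0 s d B N) = (d + 1) ^ N \<and> dim_col (W0 s d B N) = (d + 1) ^ N"
  "valid (replicate N (d + 1)) xs \<Longrightarrow> agree1 (d + 1) N G g \<Longrightarrow> act (W0 s d B N) G (encd (replicate N (d + 1)) xs) = Wch B d 1 N g (map int xs)"
proof -
  let ?X = "(k_plus B * s powi 1) \<cdot>\<^sub>m (S_plus s d * qexp_half s (S_three d)) + (k_minus B * s powi (- 1)) \<cdot>\<^sub>m (S_minus s d * qexp_half s (S_three d))"
  note G = act_kron_recursion[of "W0 s d B" "eps_plus B" B 1 ?X "d + 1" "qexp_half s (2 \<cdot>\<^sub>m S_three d)" d]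
  have WS: "W0 s d B (Suc n) = ?X \<otimes>\<^sub>K 1\<^sub>m ((d + 1) ^ n) + qexp_half s (2 \<cdot>\<^sub>m S_three d) \<otimes>\<^sub>K W0 s d B n" for n
    by (simp add: power_int_minus)
  have X: "act ?X F i = Aop B d 1 1 (\<lambda>k. F (nat k)) (int i)" if "i < d + 1" for F i
    using that by (intro act_W_ladder) auto
  have Z: "act (qexp_half s (2 \<cdot>\<^sub>m S_three d)) F i = kp d (2 * 1) (int i) * F i" if "i < d + 1" for F i
    using that by (intro act_W_weight) auto
  show "dim_row (W0 s d B N) = (d + 1) ^ N \<and> dim_col (W0 s d B N) = (d + 1) ^ N"
    by (rule G(1)[OF _ _ WS _ _ _ _ X Z]) (simp_all add: epB_def)
  show "valid (replicate N (d + 1)) xs \<Longrightarrow> agree1 (d + 1) N G g \<Longrightarrow> act (W0 s d B N) G (encd (replicate N (d + 1)) xs) = Wch B d 1 N g (map int xs)"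
    by (rule G(2)[OF _ _ WS _ _ _ _ X Z]) (simp_all add: epB_def)
qed

lemma act_W1:
  "dim_row (W1 s d B N) = (d + 1) ^ N \<and> dim_col (W1 s d B N) = (d + 1) ^ N"
  "valid (replicate N (d + 1)) xs \<Longrightarrow> agree1 (d + 1) N G g \<Longrightarrow> act (W1 s d B N) G (encd (replicate N (d + 1)) xs) = Wch B d (- 1) N g (map int xs)"
proof -
  let ?X = "(k_plus B * s powi (- 1)) \<cdot>\<^sub>m (S_plus s d * qexp_half s (- S_three d)) + (k_minus B * s powi (- (- 1))) \<cdot>\<^sub>m (S_minus s d * qexp_half s (- S_three d))"
  note G = act_kron_recursion[of "W1 s d B" "eps_minus B" B "- 1" ?X "d + 1" "qexp_half s (- (2 \<cdot>\<^sub>m S_three d))" d]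
  have WS: "W1 s d B (Suc n) = ?X \<otimes>\<^sub>K 1\<^sub>m ((d + 1) ^ n) + qexp_half s (- (2 \<cdot>\<^sub>m S_three d)) \<otimes>\<^sub>K W1 s d B n" for n
    by (simp add: power_int_minus)
  have X: "act ?X F i = Aop B d (- 1) 1 (\<lambda>k. F (nat k)) (int i)" if "i < d + 1" for F i
    using that by (intro act_W_ladder) auto
  have Z: "act (qexp_half s (- (2 \<cdot>\<^sub>m S_three d))) F i = kp d (2 * (- 1)) (int i) * F i" if "i < d + 1" for F i
    using that by (intro act_W_weight) auto
  show "dim_row (W1 s d B N) = (d + 1) ^ N \<and> dim_col (W1 s d B N) = (d + 1) ^ N"
    by (rule G(1)[OF _ _ WS _ _ _ _ X Z]) (simp_all add: epB_def)
  show "valid (replicate N (d + 1)) xs \<Longrightarrow> agree1 (d + 1) N G g \<Longrightarrow> act (W1 s d B N) G (encd (replicate N (d + 1)) xs) = Wch B d (- 1) N g (map int xs)"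
    by (rule G(2)[OF _ _ WS _ _ _ _ X Z]) (simp_all add: epB_def)
qed

end

section \<open>Normalizations and removable singularities\<close>

lemma eventually_notin_finite:
  assumes "finite S" shows "\<forall>\<^sub>F v in at (w::complex). v \<notin> S"
proof -
  have "open (- (S - {w}))" using assms by (intro open_Compl finite_imp_closed) simp
  then show ?thesis unfolding eventually_at_topological by (intro exI[of _ "- (S - {w})"]) auto
qed

lemma ev_nonzero: "\<forall>\<^sub>F v in at (w::complex). v \<noteq> 0"
  using eventually_notin_finite[of "{0}" w] by simp

lemma cfun_zero: "cfun x = 0 \<Longrightarrow> x \<noteq> 0 \<Longrightarrow> x * x = 1"
  by (simp add: cfun_def field_simps)

lemma ev_cfun1:
  assumes "c \<noteq> 0" shows "\<forall>\<^sub>F v in at (w::complex). cfun (v * c) \<noteq> 0"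
proof -
  let ?p = "[:-1, 0, c * c:]"
  have "finite {v. poly ?p v = 0}" using assms by (intro poly_roots_finite) simp
  from eventually_notin_finite[OF this, of w] ev_nonzero[of w] show ?thesis
  proof eventually_elim
    case (elim v)
    then show ?case using cfun_zero[of "v * c"] assms by (auto simp: algebra_simps)
  qed
qed

lemma ev_cfun2:
  assumes "c \<noteq> 0" shows "\<forall>\<^sub>F v in at (w::complex). cfun (v\<^sup>2 * c) \<noteq> 0"
proof -
  let ?p = "[:-1, 0, 0, 0, c * c:]"
  have "finite {v. poly ?p v = 0}" using assms by (intro poly_roots_finite) simp
  from eventually_notin_finite[OF this, of w] ev_nonzero[of w] show ?thesis
  proof eventually_elim
    case (elim v)
    then show ?case using cfun_zero[of "v\<^sup>2 * c"] assms by (auto simp: algebra_simps power2_eq_square)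
  qed
qed

lemma ev_prod:
  fixes f :: "nat \<Rightarrow> complex \<Rightarrow> complex"
  assumes "\<And>k. k < n \<Longrightarrow> \<forall>\<^sub>F v in F. f k v \<noteq> 0"
  shows "\<forall>\<^sub>F v in F. (\<Prod>k<n. f k v) \<noteq> 0"
proof -
  have "\<forall>\<^sub>F v in F. \<forall>k\<in>{..<n}. f k v \<noteq> 0"
    by (rule eventually_ball_finite) (use assms in auto)
  then show ?thesis by eventually_elim simp
qed

lemma laur_field_differentiable:
  assumes "laur f" "w \<noteq> 0" shows "f field_differentiable (at w)"
proof -
  from assms obtain p k where 1: "\<forall>u. u \<noteq> 0 \<longrightarrow> f u * u ^ k = poly p u" unfolding laur_def by blast
  have "(\<lambda>u. poly p u / u ^ k) field_differentiable (at w)"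
    using assms(2) by (intro field_differentiable_divide field_differentiable_power)
      (auto intro: field_differentiable_ident simp: field_differentiable_def intro!: exI poly_DERIV)
  then obtain D where D: "((\<lambda>u. poly p u / u ^ k) has_field_derivative D) (at w)"
    unfolding field_differentiable_def by blast
  have "(f has_field_derivative D) (at w)"
  proof (rule has_field_derivative_transform_within_open[OF D])
    show "open (- {0::complex})" by (simp add: open_Compl)
    show "poly p u / u ^ k = f u" if "u \<in> - {0}" for u
      using 1[rule_format, of u] that by (simp add: field_simps)
  qed (use assms in simp)
  then show ?thesis unfolding field_differentiable_def by blast
qed

lemma laur_tendsto:
  assumes "laur f" "w \<noteq> 0" shows "f \<midarrow>w\<rightarrow> f w"
  using field_differentiable_imp_continuous_at[OF laur_field_differentiable[OF assms]]
  by (simp add: isCont_def)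

lemma laur_cfun1: "c \<noteq> 0 \<Longrightarrow> laur (\<lambda>u. cfun (u * c))"
  unfolding cfun_def using laur_mult[OF laur_inverse laur_const[of "inverse c"]]
  by (intro laur_diff laur_mult laur_id laur_const) simp

lemma laur_cfun2: "c \<noteq> 0 \<Longrightarrow> laur (\<lambda>u. cfun (u\<^sup>2 * c))"
  by (rule laur_compose_sq[OF laur_cfun1])

context generic_q begin

text \<open>
  What remains of the normalizing denominator of the R-matrix with two equal spins after
  cancellation against \<open>rsc\<close>.  It does not vanish at 1.
\<close>

definition rho :: "nat \<Rightarrow> complex \<Rightarrow> complex" where
  "rho d u = (\<Prod>m<d. cfun (u * s powi (2 + 2 * int m)))"

lemma cfun_powi_nz: "k \<noteq> 0 \<Longrightarrow> cfun (s powi k) \<noteq> 0"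
  using cfun_zero[of "s powi k"] not_root[of "2 * k"] by (auto simp: powi_double)

lemma rho_1: "rho d 1 \<noteq> 0"
proof -
  have "cfun (s powi (2 + 2 * int m)) \<noteq> 0" for m by (rule cfun_powi_nz) simp
  then show ?thesis by (simp add: rho_def)
qed

lemma cc_1: "cc d 1 \<noteq> 0"
proof -
  have "cfun (s powi (2 + 2 * int m)) \<noteq> 0" for m by (rule cfun_powi_nz) simp
  then show ?thesis by (simp add: cc_def)
qed

lemma laur_rho: "laur (rho d)"
  unfolding rho_def[abs_def] by (intro laur_prod laur_cfun1) simp

lemma laur_cc: "laur (cc d)"
  unfolding cc_def[abs_def] by (intro laur_prod laur_cfun2) simp

lemma rsc_prod: "rsc (Suc e) d2 u = (\<Prod>m<Suc e. hs d2 (u * s powi (2 * int m - int e)))"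
proof (induction e arbitrary: u)
  case 0 then show ?case by simp
next
  case (Suc e)
  have eq: "u * s * s powi (2 * int m - int e) = u * s powi (2 * int (Suc m) - int (Suc e))" for m
  proof -
    have "s * s powi (2 * int m - int e) = s powi (1 + (2 * int m - int e))"
      by (simp only: powi_add power_int_1_right)
    also have "1 + (2 * int m - int e) = 2 * int (Suc m) - int (Suc e)" by simp
    finally show ?thesis by (simp only: mult.assoc)
  qed
  have "(\<Prod>m<Suc (Suc e). hs d2 (u * s powi (2 * int m - int (Suc e))))
    = hs d2 (u * s powi (2 * int 0 - int (Suc e))) * (\<Prod>m<Suc e. hs d2 (u * s powi (2 * int (Suc m) - int (Suc e))))"
    by (rule prod.lessThan_Suc_shift)
  then show ?case unfolding rsc.simps Suc eq by (simp only: of_nat_0 mult_zero_right diff_0)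
qed

lemma R_denominator:
  "(\<Prod>m<Suc e. \<Prod>l<Suc e. cfun (v * s powi (int (Suc e) + int (Suc e) - 2 * int m - 2 * int l)))
    = rsc (Suc e) (Suc e) v * rho (Suc e) v"
proof -
  let ?g = "\<lambda>m. \<Prod>l<Suc e. cfun (v * s powi (2 + 2 * int m - 2 * int l))"
  have "(\<Prod>m<Suc e. \<Prod>l<Suc e. cfun (v * s powi (int (Suc e) + int (Suc e) - 2 * int m - 2 * int l))) = (\<Prod>m<Suc e. ?g (Suc e - Suc m))"
  proof (intro prod.cong refl)
    fix m l assume "m \<in> {..<Suc e}"
    then have "int (Suc e) + int (Suc e) - 2 * int m - 2 * int l = 2 + 2 * int (Suc e - Suc m) - 2 * int l"
      by (simp add: of_nat_diff)
    then show "cfun (v * s powi (int (Suc e) + int (Suc e) - 2 * int m - 2 * int l)) = cfun (v * s powi (2 + 2 * int (Suc e - Suc m) - 2 * int l))"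
      by (simp only:)
  qed
  also have "\<dots> = (\<Prod>m<Suc e. ?g m)" by (rule prod.nat_diff_reindex)
  also have "\<dots> = (\<Prod>m<Suc e. cfun (v * s powi (2 + 2 * int m)) * hs (Suc e) (v * s powi (2 * int m - int e)))"
  proof (intro prod.cong refl)
    fix m
    have "?g m = cfun (v * s powi (2 + 2 * int m - 2 * int 0)) * (\<Prod>l<e. cfun (v * s powi (2 + 2 * int m - 2 * int (Suc l))))"
      by (rule prod.lessThan_Suc_shift)
    moreover have "v * s powi (2 + 2 * int m - 2 * int (Suc l)) = v * s powi (2 * int m - int e) * s powi (int (Suc e) - 1 - 2 * int l)" for l
    proof -
      have "2 + 2 * int m - 2 * int (Suc l) = (2 * int m - int e) + (int (Suc e) - 1 - 2 * int l)" by simp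
      then show ?thesis by (simp only: powi_add mult.assoc)
    qed
    ultimately show "?g m = cfun (v * s powi (2 + 2 * int m)) * hs (Suc e) (v * s powi (2 * int m - int e))"
      unfolding hs_def diff_Suc_1 by (simp only: of_nat_0 mult_zero_right diff_zero)
  qed
  also have "\<dots> = rsc (Suc e) (Suc e) v * rho (Suc e) v"
    unfolding prod.distrib rsc_prod rho_def by (rule mult.commute)
  finally show ?thesis .
qed

lemma act_delta: "k < dim_col A \<Longrightarrow> act A (\<lambda>l. of_bool (l = k)) i = A $$ (i, k)"
  by (simp add: act_def of_bool_def if_distrib cong: if_cong)

lemma lift2_expand:
  assumes "n < D" "a < D"
  shows "lift2 D F (int n) (int a) = (\<Sum>k<D * D. F k * lift2 D (\<lambda>l. of_bool (l = k)) (int n) (int a))"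
proof -
  have "n * D + a < D * D" using assms by (rule index_less)
  moreover have "(\<Sum>k<D * D. F k * lift2 D (\<lambda>l. of_bool (l = k)) (int n) (int a)) = (\<Sum>k<D * D. if k = n * D + a then F (n * D + a) else 0)"
    by (intro sum.cong refl) (auto simp: lift2_def)
  ultimately show ?thesis by (simp add: lift2_def)
qed

text \<open>
  The matrix and its normalizing denominator share the factor \<open>rsc\<close>.  Removing the singularity amounts
  to cancelling it.
\<close>

lemma act_R_tilde:
  fixes e :: nat
  defines "d \<equiv> Suc e"
  assumes u: "u \<noteq> 0" and r: "rho d u \<noteq> 0" and n: "n < d + 1" and a: "a < d + 1"
  shows "act (R_tilde s d d u) F (n * (d + 1) + a) = inverse (rho d u) * Rop d d u (lift2 (d + 1) F) (int n) (int a)"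
proof -
  let ?D = "d + 1"
  let ?q = "\<lambda>k v. Rop d d v (lift2 ?D (\<lambda>l. of_bool (l = k))) (int n) (int a)"
  have l: "n * ?D + a < ?D * ?D" using n a by (rule index_less)
  have dn: "(\<Prod>m<d. \<Prod>l<d. cfun (v * s powi (int d + int d - 2 * int m - 2 * int l))) = rsc d d v * rho d v" for v
    unfolding d_def by (rule R_denominator)
  have ent: "R_tilde s d d u $$ (n * ?D + a, k) = inverse (rho d u) * ?q k u" if k: "k < ?D * ?D" for k
  proof -
    have R: "R_mat s d d v $$ (n * ?D + a, k) = rsc d d v * ?q k v" for v
    proof -
      have "R_mat s d d v $$ (n * ?D + a, k) = act (R_mat s d d v) (\<lambda>l. of_bool (l = k)) (n * ?D + a)"
        using k by (subst act_delta) (simp_all add: d_def dim_R_mat)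
      also have "\<dots> = rsc d d v * ?q k v"
        unfolding d_def using n a by (intro act_R_mat) (simp_all add: d_def)
      finally show ?thesis .
    qed
    have lq: "laur (?q k)"
      using laur_Rop[of "\<lambda>u. lift2 ?D (\<lambda>l. of_bool (l = k))" 1 e d "int n" "int a"] by (simp add: d_def)
    have lim: "(\<lambda>v. inverse (rho d v) * ?q k v) \<midarrow>u\<rightarrow> inverse (rho d u) * ?q k u"
      by (intro tendsto_mult tendsto_inverse laur_tendsto lq laur_rho u r)
    have ev: "\<forall>\<^sub>F v in at u. rsc d d v * rho d v \<noteq> 0"
      unfolding dn[symmetric] by (intro ev_prod ev_cfun1) simp
    have "(\<lambda>v. inverse (\<Prod>m<d. \<Prod>l<d. cfun (v * s powi (int d + int d - 2 * int m - 2 * int l))) * R_mat s d d v $$ (n * ?D + a, k)) \<midarrow>u\<rightarrow> inverse (rho d u) * ?q k u"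
    proof (rule Lim_transform_eventually[OF lim])
      show "\<forall>\<^sub>F v in at u. inverse (rho d v) * ?q k v = inverse (\<Prod>m<d. \<Prod>l<d. cfun (v * s powi (int d + int d - 2 * int m - 2 * int l))) * R_mat s d d v $$ (n * ?D + a, k)"
        using ev unfolding dn R by eventually_elim simp
    qed
    from remove_sings_eqI[OF this] show ?thesis
      unfolding R_tilde_def using l k by simp
  qed
  have "act (R_tilde s d d u) F (n * ?D + a) = (\<Sum>k<?D * ?D. inverse (rho d u) * ?q k u * F k)"
  proof -
    have "dim_col (R_tilde s d d u) = ?D * ?D" by (simp add: R_tilde_def)
    then show ?thesis unfolding act_def by (intro sum.cong) (simp_all only: ent lessThan_iff)
  qed
  also have "\<dots> = inverse (rho d u) * (\<Sum>k<?D * ?D. F k * ?q k u)"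
    by (simp add: sum_distrib_left algebra_simps)
  also have "(\<Sum>k<?D * ?D. F k * ?q k u) = Rop d d u (\<lambda>n a. \<Sum>k<?D * ?D. F k * lift2 ?D (\<lambda>l. of_bool (l = k)) n a) (int n) (int a)"
    unfolding d_def by (rule lin2_sum[OF lin2_Rop, symmetric])
  also have "\<dots> = Rop d d u (lift2 ?D F) (int n) (int a)"
    unfolding d_def
  proof (rule Rop_cong)
    fix n a :: int assume na: "0 \<le> n" "n \<le> int (Suc e)" "0 \<le> a" "a \<le> int (Suc e)"
    then have "nat n < Suc e + 1" "nat a < Suc e + 1" by auto
    from lift2_expand[OF this, of F] na
    show "(\<Sum>k<(Suc e + 1) * (Suc e + 1). F k * lift2 (Suc e + 1) (\<lambda>l. of_bool (l = k)) n a) = lift2 (Suc e + 1) F n a"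
      by (simp del: mult_Suc mult_Suc_right)
  qed
  finally show ?thesis .
qed

lemma K_norm_Suc_Suc: "K_norm s (Suc (Suc e)) u = cfun (u\<^sup>2 * s\<^sup>2) * hs (Suc e) (u\<^sup>2 * s powi (- int e))"
proof -
  have "K_norm s (Suc (Suc e)) u = cfun (u\<^sup>2 * s powi (2 * (1 - int 0))) * (\<Prod>l<e. cfun (u\<^sup>2 * s powi (2 * (1 - int (Suc l)))))"
    unfolding K_norm_def diff_Suc_1 by (rule prod.lessThan_Suc_shift)
  moreover have "u\<^sup>2 * s powi (2 * (1 - int (Suc l))) = u\<^sup>2 * s powi (- int e) * s powi (int (Suc e) - 1 - 2 * int l)" for l
  proof -
    have "2 * (1 - int (Suc l)) = - int e + (int (Suc e) - 1 - 2 * int l)" by simp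
    then show ?thesis by (simp only: powi_add mult.assoc)
  qed
  moreover have "s powi (2 * (1 - int 0)) = s\<^sup>2" by simp
  ultimately show ?thesis unfolding hs_def diff_Suc_1 by (simp only:)
qed

text \<open>
  The full normalization collects one \<open>K_norm\<close> from each fusion step.
\<close>

lemma K_norm_full_Suc: "K_norm_full s (Suc d) u = K_norm s (Suc d) u * K_norm_full s d (u * s)"
proof -
  have "K_norm_full s (Suc d) u = K_norm s (Suc d - 0) (u * s ^ 0) * (\<Prod>n<d. K_norm s (Suc d - Suc n) (u * s ^ Suc n))"
    unfolding K_norm_full_def by (rule prod.lessThan_Suc_shift)
  then show ?thesis by (simp add: K_norm_full_def mult.assoc)
qed

lemma ksc_cc_norm_full: "ksc (Suc e) u * cc (Suc e) u = K_norm_full s (Suc e) u"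
proof (induction e arbitrary: u)
  case 0 then show ?case by (simp add: cc_def K_norm_full_def K_norm_def)
next
  case (Suc e)
  show ?case unfolding K_norm_full_Suc[of "Suc e"] Suc[symmetric] K_norm_Suc_Suc cc_Suc ksc.simps by simp
qed

text \<open>
  The factor by which the K-operator divided by \<open>cc\<close> has to be multiplied in order to get the
  K-matrix normalized by \<open>\<nu>\<close>; a Laurent polynomial for both normalizations.
\<close>

definition phi :: "(complex \<Rightarrow> nat \<Rightarrow> complex \<Rightarrow> complex) \<Rightarrow> nat \<Rightarrow> complex \<Rightarrow> complex" where
  "phi \<nu> d u = (if \<nu> = K_norm_full then 1 else K_norm_full s (d - 1) (u * s))"

lemma laur_K_norm: "laur (\<lambda>u. K_norm s d (u * c))" if "c \<noteq> 0"
proof -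
  have "laur (\<lambda>u. cfun (u\<^sup>2 * (c\<^sup>2 * s powi k)))" for k using that by (intro laur_cfun2) simp
  then have "laur (\<lambda>u. cfun ((u * c)\<^sup>2 * s powi k))" for k by (simp only: power_mult_distrib mult.assoc)
  then show ?thesis unfolding K_norm_def by (intro laur_prod)
qed

lemma laur_phi: "laur (phi \<nu> d)"
proof -
  have "laur (\<lambda>u. K_norm s k (u * (s * s ^ n)))" for k n by (rule laur_K_norm) simp
  then have "laur (\<lambda>u. K_norm_full s (d - 1) (u * s))"
    unfolding K_norm_full_def by (intro laur_prod) (simp only: mult.assoc)
  then show ?thesis unfolding phi_def[abs_def] by (cases "\<nu> = K_norm_full") simp_all
qed

lemma ev_K_norm: "c \<noteq> 0 \<Longrightarrow> \<forall>\<^sub>F v in at w. K_norm s d (v * c) \<noteq> 0"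
  unfolding K_norm_def power_mult_distrib mult.assoc by (intro ev_prod ev_cfun2) simp

lemma ev_nu:
  assumes "\<nu> = K_norm \<or> \<nu> = K_norm_full"
  shows "\<forall>\<^sub>F v in at w. \<nu> s d v \<noteq> 0"
  using assms
proof
  assume "\<nu> = K_norm" then show ?thesis using ev_K_norm[of 1] by simp
next
  assume nu: "\<nu> = K_norm_full"
  have "\<forall>\<^sub>F v in at w. (\<Prod>n<d. K_norm s (d - n) (v * s ^ n)) \<noteq> 0"
    by (intro ev_prod ev_K_norm) simp
  then show ?thesis unfolding nu K_norm_full_def .
qed

lemma ksc_normalization:
  assumes "\<nu> = K_norm \<or> \<nu> = K_norm_full"
  shows "ksc (Suc e) u * cc (Suc e) u = \<nu> s (Suc e) u * phi \<nu> (Suc e) u"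
  using assms unfolding ksc_cc_norm_full phi_def by (auto simp: K_norm_full_Suc)

lemma act_K_tilde:
  fixes e :: nat
  defines "d \<equiv> Suc e"
  assumes nu: "\<nu> = K_norm \<or> \<nu> = K_norm_full" and u: "u \<noteq> 0" and c: "cc d u \<noteq> 0" and n: "n < d + 1"
  shows "act (K_tilde \<nu> s B d u) F n = (inverse (cc d u) * phi \<nu> d u) * Kop B d u (\<lambda>k. F (nat k)) (int n)"
proof -
  let ?q = "\<lambda>k v. Kop B d v (\<lambda>l. of_bool (nat l = k)) (int n)"
  have ent: "K_tilde \<nu> s B d u $$ (n, k) = inverse (cc d u) * phi \<nu> d u * ?q k u" if k: "k < d + 1" for k
  proof -
    have R: "K_mat s B d v $$ (n, k) = ksc d v * ?q k v" for v
    proof -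
      have "K_mat s B d v $$ (n, k) = act (K_mat s B d v) (\<lambda>l. of_bool (l = k)) n"
        using k by (subst act_delta) (simp_all add: d_def dim_K_mat)
      also have "\<dots> = ksc d v * ?q k v"
        unfolding d_def using n by (intro act_K_mat) (simp_all add: d_def)
      finally show ?thesis .
    qed
    have lq: "laur (?q k)"
      using laur_Kop[of "\<lambda>u l. of_bool (nat l = k)" 1 B e "int n"] by (simp add: d_def)
    have lim: "(\<lambda>v. inverse (cc d v) * phi \<nu> d v * ?q k v) \<midarrow>u\<rightarrow> inverse (cc d u) * phi \<nu> d u * ?q k u"
      by (intro tendsto_mult tendsto_inverse laur_tendsto lq laur_cc laur_phi u c)
    have ev: "\<forall>\<^sub>F v in at u. cc d v \<noteq> 0"
      unfolding cc_def by (intro ev_prod ev_cfun2) simp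
    have "(\<lambda>v. inverse (\<nu> s d v) * K_mat s B d v $$ (n, k)) \<midarrow>u\<rightarrow> inverse (cc d u) * phi \<nu> d u * ?q k u"
    proof (rule Lim_transform_eventually[OF lim])
      show "\<forall>\<^sub>F v in at u. inverse (cc d v) * phi \<nu> d v * ?q k v = inverse (\<nu> s d v) * K_mat s B d v $$ (n, k)"
        using ev ev_nu[OF nu, of d u]
      proof eventually_elim
        case (elim v)
        have "ksc d v = \<nu> s d v * phi \<nu> d v / cc d v"
          using ksc_normalization[OF nu, of e v] elim by (simp add: d_def field_simps)
        then show ?case unfolding R using elim by (simp add: field_simps)
      qed
    qed
    from remove_sings_eqI[OF this] show ?thesis
      unfolding K_tilde_def using n k by simp
  qed
  have "act (K_tilde \<nu> s B d u) F n = (\<Sum>k<d + 1. inverse (cc d u) * phi \<nu> d u * ?q k u * F k)"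
  proof -
    have "dim_col (K_tilde \<nu> s B d u) = d + 1" by (simp add: K_tilde_def)
    then show ?thesis unfolding act_def by (intro sum.cong) (simp_all only: ent lessThan_iff)
  qed
  also have "\<dots> = (inverse (cc d u) * phi \<nu> d u) * (\<Sum>k<d + 1. F k * ?q k u)"
    by (simp add: sum_distrib_left algebra_simps)
  also have "(\<Sum>k<d + 1. F k * ?q k u) = Kop B d u (\<lambda>l. \<Sum>k<d + 1. F k * of_bool (nat l = k)) (int n)"
    unfolding d_def by (rule lin1_sum[OF lin1_Kop, symmetric])
  also have "\<dots> = Kop B d u (\<lambda>k. F (nat k)) (int n)"
    unfolding d_def
  proof (rule Kop_cong)
    fix n :: int assume "0 \<le> n" "n \<le> int (Suc e)"
    then have "nat n < Suc e + 1" by auto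
    then show "(\<Sum>k<Suc e + 1. F k * of_bool (nat n = k)) = F (nat n)"
      by (simp add: of_bool_def if_distrib cong: if_cong)
  qed
  finally show ?thesis .
qed

lemma laur_Kd: "laur (\<lambda>w. Kd B d w n)"
proof -
  have 1: "laur (\<lambda>w. inverse (w * k))" for k
    using laur_mult[OF laur_inverse laur_const[of "inverse k"]] by simp
  have "laur (\<lambda>w. gg B d w r)" "laur (\<lambda>w. hh B d w r)" for r
    unfolding gg_def hh_def by (intro laur_add laur_mult laur_const laur_id laur_inverse 1)+
  then show ?thesis unfolding Kd_def by (intro laur_mult laur_prod)
qed

lemma K_tilde_diag:
  fixes e :: nat
  defines "d \<equiv> Suc e"
  assumes nu: "\<nu> = K_norm \<or> \<nu> = K_norm_full" and B: "k_plus B = 0" "k_minus B = 0"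
    and w: "w \<noteq> 0" and n: "n < d + 1" and k: "k < d + 1"
  shows "K_tilde \<nu> s B d w $$ (n, k) = of_bool (n = k) * (phi \<nu> d w * Kd B d w n)"
proof -
  have R: "K_mat s B d v $$ (n, k) = of_bool (n = k) * (\<nu> s d v * (phi \<nu> d v * Kd B d v n))" if v: "v \<noteq> 0" for v
  proof -
    have "K_mat s B d v $$ (n, k) = act (K_mat s B d v) (\<lambda>l. of_bool (l = k)) n"
      using k by (subst act_delta) (simp_all add: d_def dim_K_mat)
    also have "\<dots> = ksc d v * Kop B d v (\<lambda>l. of_bool (nat l = k)) (int n)"
      unfolding d_def using n by (intro act_K_mat) (simp_all add: d_def)
    also have "Kop B d v (\<lambda>l. of_bool (nat l = k)) (int n) = cc d v * Kd B d v n * of_bool (n = k)"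
      unfolding d_def using Kop_diag[OF B v, of n e "\<lambda>l. of_bool (nat l = k)"] n by (simp add: d_def del: Kop.simps)
    also have "ksc d v * (cc d v * Kd B d v n * of_bool (n = k)) = of_bool (n = k) * ((ksc d v * cc d v) * Kd B d v n)"
      by (simp add: algebra_simps)
    finally show ?thesis unfolding d_def ksc_normalization[OF nu] by simp
  qed
  have lim: "(\<lambda>v. of_bool (n = k) * (phi \<nu> d v * Kd B d v n)) \<midarrow>w\<rightarrow> of_bool (n = k) * (phi \<nu> d w * Kd B d w n)"
    by (intro tendsto_mult tendsto_const laur_tendsto laur_phi laur_Kd w)
  have "(\<lambda>v. inverse (\<nu> s d v) * K_mat s B d v $$ (n, k)) \<midarrow>w\<rightarrow> of_bool (n = k) * (phi \<nu> d w * Kd B d w n)"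
  proof (rule Lim_transform_eventually[OF lim])
    show "\<forall>\<^sub>F v in at w. of_bool (n = k) * (phi \<nu> d v * Kd B d v n) = inverse (\<nu> s d v) * K_mat s B d v $$ (n, k)"
      using ev_nonzero[of w] ev_nu[OF nu, of d w]
      by eventually_elim (simp add: R)
  qed
  from remove_sings_eqI[OF this] show ?thesis
    unfolding K_tilde_def using n k by simp
qed

text \<open>
  The parameters substituted into the dual K-matrix.
\<close>

definition dualB :: "boundary \<Rightarrow> boundary" where
  "dualB bb = \<lparr>k_plus = - k_minus bb, k_minus = - k_plus bb, eps_plus = eps_minus bb, eps_minus = eps_plus bb\<rparr>"

text \<open>
  The diagonal entries of the normalized dual K-matrix when the barred \<open>k\<^sub>\<plusminus>\<close> vanish.
\<close>

definition Dg where "Dg \<nu> bb d u a = phi \<nu> d (inverse u * s powi (- 2)) * Kd (dualB bb) d (inverse u * s powi (- 2)) (nat a)"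

lemma act_K_plus_tilde:
  fixes e :: nat
  defines "d \<equiv> Suc e"
  assumes nu: "\<nu> = K_norm \<or> \<nu> = K_norm_full" and B: "k_plus bb = 0" "k_minus bb = 0"
    and u: "u \<noteq> 0" and a: "a < d + 1"
  shows "act (K_plus_tilde \<nu> s bb d u) F a = Dg \<nu> bb d u (int a) * F a"
proof -
  let ?w = "inverse u * s powi (- 2)"
  have w: "?w \<noteq> 0" using u by simp
  have B': "k_plus (dualB bb) = 0" "k_minus (dualB bb) = 0" using B by (simp_all add: dualB_def)
  have K: "K_plus_tilde \<nu> s bb d u = transpose_mat (K_tilde \<nu> s (dualB bb) d ?w)"
    by (simp add: K_plus_tilde_def dualB_def)
  have ent: "K_plus_tilde \<nu> s bb d u $$ (a, k) = of_bool (k = a) * Dg \<nu> bb d u (int a)" if k: "k < d + 1" for k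
  proof -
    have "K_plus_tilde \<nu> s bb d u $$ (a, k) = K_tilde \<nu> s (dualB bb) d ?w $$ (k, a)"
      unfolding K using a k by (simp add: K_tilde_def)
    also have "\<dots> = of_bool (k = a) * (phi \<nu> d ?w * Kd (dualB bb) d ?w k)"
      unfolding d_def using k a by (intro K_tilde_diag nu B' w) (simp_all add: d_def)
    finally show ?thesis by (auto simp: Dg_def)
  qed
  have "act (K_plus_tilde \<nu> s bb d u) F a = (\<Sum>k<d + 1. of_bool (k = a) * Dg \<nu> bb d u (int a) * F k)"
  proof -
    have "dim_col (K_plus_tilde \<nu> s bb d u) = d + 1" by (simp add: K K_tilde_def)
    then show ?thesis unfolding act_def by (intro sum.cong) (simp_all only: ent lessThan_iff)
  qed
  also have "\<dots> = (\<Sum>k<d + 1. if k = a then Dg \<nu> bb d u (int a) * F a else 0)"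
    by (intro sum.cong) auto
  finally show ?thesis using a by simp
qed

text \<open>
  The condition on the diagonal matrix under which the trace commutes with the combination of \<open>W\<^sub>0\<close> and
  \<open>W\<^sub>1\<close>.
\<close>

lemma Dg_ratio:
  assumes u: "u \<noteq> 0" and n: "0 \<le> n" "n < int d"
  shows "Dg \<nu> bb d u n * (eps_plus bb * inverse u * inverse s * kp d (-1) n + eps_minus bb * u * s * kp d 1 n)
     = Dg \<nu> bb d u (n + 1) * (eps_plus bb * u * s ^ 3 * kp d (-1) n + eps_minus bb * inverse u * inverse (s ^ 3) * kp d 1 n)"
proof -
  let ?w = "inverse u * s powi (- 2)"
  obtain m where m: "n = int m" using n(1) nonneg_int_cases by blast
  have kp: "kp d 1 n = s * yy d m" "kp d (-1) n = inverse (s * yy d m)"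
  proof -
    have "s powi 1 * yy d m = s powi (1 + (int d - 1 - 2 * int m))"
      unfolding yy_def by (rule powi_add[symmetric])
    then show 1: "kp d 1 n = s * yy d m" by (simp add: kp_def m)
    have "kp d (-1) n = inverse (kp d 1 n)" by (simp add: kp_def power_int_minus[symmetric])
    then show "kp d (-1) n = inverse (s * yy d m)" unfolding 1 .
  qed
  have y: "yy d m \<noteq> 0" by (simp add: yy_def)
  have h: "eps_plus bb * inverse u * inverse s * kp d (-1) n + eps_minus bb * u * s * kp d 1 n = hh (dualB bb) d ?w m"
    unfolding kp hh_def dualB_def using u y by (simp add: power_int_minus field_simps power2_eq_square)
  have g: "eps_plus bb * u * s ^ 3 * kp d (-1) n + eps_minus bb * inverse u * inverse (s ^ 3) * kp d 1 n = gg (dualB bb) d ?w m"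
    unfolding kp gg_def dualB_def using u y by (simp add: power_int_minus field_simps power2_eq_square power3_eq_cube)
  have "nat n = m" "nat (n + 1) = Suc m" using m by simp_all
  then show ?thesis unfolding h g Dg_def using Kd_ratio[of m d "dualB bb" ?w] m n by simp
qed

section \<open>The transfer matrix commutes\<close>

lemma transfer_dims: "transfer \<nu> s d N B bb u \<in> carrier_mat ((d + 1) ^ N) ((d + 1) ^ N)"
  by (simp add: transfer_def Let_def ptrace_last_def)

text \<open>
  The normalized R- and K-matrices as operators.
\<close>

definition Rhat where "Rhat d u f n a = inverse (rho d u) * Rop d d u f n a"

definition Khat where "Khat \<nu> B d u f n = inverse (cc d u) * phi \<nu> d u * Kop B d u f n"

lemma transfer_act:
  fixes e :: nat
  defines "d \<equiv> Suc e"
  assumes nu: "\<nu> = K_norm \<or> \<nu> = K_norm_full" and bb: "k_plus bb = 0" "k_minus bb = 0"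
    and u: "u \<noteq> 0" "rho d u \<noteq> 0" "cc d u \<noteq> 0"
    and G: "agree1 (d + 1) N G g" and xs: "valid (replicate N (d + 1)) xs"
  shows "act (transfer \<nu> s d N B bb u) G (encd (replicate N (d + 1)) xs) = trop (Dg \<nu> bb d u) d (chain (Rhat d u) (Khat \<nu> B d u) N) g (map int xs)"
proof (rule act_transfer[OF _ _ _ _ _ G xs])
  show "act (R_tilde s d d u) F (n * (d + 1) + a) = Rhat d u (lift2 (d + 1) F) (int n) (int a)" if "n < d + 1" "a < d + 1" for F n a
    unfolding Rhat_def using act_R_tilde[of u e n a F] u that by (simp add: d_def)
  show "Rhat d u f n a = Rhat d u g n a" if "\<And>n a. 0 \<le> n \<Longrightarrow> n < int (d + 1) \<Longrightarrow> 0 \<le> a \<Longrightarrow> a < int (d + 1) \<Longrightarrow> f n a = g n a" for f g n a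
  proof -
    have "Rop d d u f n a = Rop d d u g n a" unfolding d_def by (rule Rop_cong) (use that d_def in auto)
    then show ?thesis by (simp add: Rhat_def)
  qed
  show "act (K_tilde \<nu> s B d u) F n = Khat \<nu> B d u (\<lambda>k. F (nat k)) (int n)" if "n < d + 1" for F n
    unfolding Khat_def using act_K_tilde[OF nu u(1), of e n B F] u that by (simp add: d_def)
  show "Khat \<nu> B d u f n = Khat \<nu> B d u g n" if "\<And>n. 0 \<le> n \<Longrightarrow> n < int (d + 1) \<Longrightarrow> f n = g n" for f g n
  proof -
    have "Kop B d u f n = Kop B d u g n" unfolding d_def by (rule Kop_cong) (use that d_def in auto)
    then show ?thesis by (simp add: Khat_def)
  qed
  show "act (K_plus_tilde \<nu> s bb d u) F a = Dg \<nu> bb d u (int a) * F a" if "a < d + 1" for F a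
    using act_K_plus_tilde[OF nu bb u(1), of a e F] that by (simp add: d_def)
qed

text \<open>
  A matrix is determined by its action on coordinate vectors.
\<close>

lemma mat_eqI_act:
  assumes "dim_row A = n" "dim_col A = n" "dim_row B = n" "dim_col B = n"
    and "\<And>F i. i < n \<Longrightarrow> act A F i = act B F i"
  shows "A = B"
proof (rule eq_matI)
  fix i k assume ik: "i < dim_row B" "k < dim_col B"
  then have "act A (\<lambda>l. of_bool (l = k)) i = act B (\<lambda>l. of_bool (l = k)) i" using assms by simp
  then show "A $$ (i, k) = B $$ (i, k)" using ik assms by (simp add: act_delta)
qed (use assms in simp_all)

lemma agree1_exists:
  obtains g where "agree1 D N G g"
  by (rule that[of "\<lambda>ys. G (encd (replicate N D) (map nat ys))"]) (simp add: agree1_def comp_def)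

lemma transfer_commutes:
  fixes e :: nat
  defines "d \<equiv> Suc e"
  defines "W \<equiv> \<lambda>N B bb. eps_plus bb \<cdot>\<^sub>m W0 s d B N + eps_minus bb \<cdot>\<^sub>m W1 s d B N"
  assumes nu: "\<nu> = K_norm \<or> \<nu> = K_norm_full" and bb: "k_plus bb = 0" "k_minus bb = 0"
    and B: "k_plus B \<noteq> 0" "k_minus B \<noteq> 0"
    and u: "u \<noteq> 0" "rho d u \<noteq> 0" "cc d u \<noteq> 0"
  shows "transfer \<nu> s d N B bb u * W N B bb = W N B bb * transfer \<nu> s d N B bb u"
proof -
  let ?T = "transfer \<nu> s d N B bb u" and ?W = "W N B bb" and ?n = "(d + 1) ^ N" and ?e = "encd (replicate N (d + 1))"
  have dT: "dim_row ?T = ?n" "dim_col ?T = ?n" using transfer_dims[of \<nu> d N B bb u] by auto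
  have dW: "dim_row ?W = ?n" "dim_col ?W = ?n" using act_W0(1)[of d B N] act_W1(1)[of d B N] by (simp_all add: W_def)
  let ?w = "\<lambda>g zs. eps_plus bb * Wch B d 1 N g zs + eps_minus bb * Wch B d (- 1) N g zs"
  have aW: "act ?W G (?e xs) = ?w g (map int xs)" if "agree1 (d + 1) N G g" "valid (replicate N (d + 1)) xs" for G g xs
  proof -
    have l: "?e xs < ?n" by (rule encd_lt[OF that(2)])
    show ?thesis unfolding W_def using l act_W0(1)[of d B N] act_W1(1)[of d B N] act_W0(2)[OF that(2,1), of B] act_W1(2)[OF that(2,1), of B]
      by (simp add: act_add act_smult)
  qed
  let ?R = "Rhat d u" and ?K = "Khat \<nu> B d u"
  have R: "lin2 ?R" "weighted ?R" "?R (cop g t (u powi (g * t)) d d f) = cop g (- t) (u powi (g * t)) d d (?R f)"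
    if "g = 1 \<or> g = -1" "t = 1 \<or> t = -1" for g t f
  proof -
    show "lin2 ?R" unfolding lin2_def Rhat_def d_def lin2D[OF lin2_Rop] by (simp add: algebra_simps)
    show "weighted ?R" using weighted_Rop[of e d u] unfolding weighted_def Rhat_def d_def by simp
    show "?R (cop g t (u powi (g * t)) d d f) = cop g (- t) (u powi (g * t)) d d (?R f)"
      unfolding Rhat_def[abs_def] using Rop_intertwines[OF u(1) that, of e d f] by (simp add: d_def cop_def fun_eq_iff algebra_simps)
  qed
  have K: "lin1 ?K" "t = 1 \<or> t = -1 \<Longrightarrow> ?K (Vop B d t u f) = Vop B d t (inverse u) (?K f)" for t f
  proof -
    show "lin1 ?K" unfolding lin1_def Khat_def d_def lin1D[OF lin1_Kop] by (simp add: algebra_simps)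
    assume t: "t = 1 \<or> t = -1"
    show "?K (Vop B d t u f) = Vop B d t (inverse u) (?K f)"
      unfolding Khat_def[abs_def] using Kop_intertwines[OF u(1) t B, of e f] by (simp add: d_def Vop_def Xop_def fun_eq_iff algebra_simps)
  qed
  let ?t = "trop (Dg \<nu> bb d u) d (chain ?R ?K N)"
  have aT: "act ?T G (?e xs) = ?t g (map int xs)" if "agree1 (d + 1) N G g" "valid (replicate N (d + 1)) xs" for G g xs
    unfolding d_def by (rule transfer_act) (use nu bb u that in \<open>simp_all add: d_def\<close>)
  have comm: "?t (?w g) xs = ?w (?t g) xs" for g xs
    by (rule trop_commutes[OF R(1) R(2) R(3) K(1) K(2) u(1)]) (use Dg_ratio[OF u(1)] in auto)
  show ?thesis
  proof (rule mat_eqI_act[where n = ?n])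
    fix G i assume i: "i < ?n"
    then obtain xs where xs: "valid (replicate N (d + 1)) xs" "?e xs = i"
      using encd_surj[of i "replicate N (d + 1)"] by (auto simp: prod_list_replicate)
    obtain g where g: "agree1 (d + 1) N G g" by (rule agree1_exists)
    have ag: "agree1 (d + 1) N (act ?W G) (?w g)" "agree1 (d + 1) N (act ?T G) (?t g)"
      using aW[OF g] aT[OF g] by (simp_all add: agree1_def)
    have "act ?T (act ?W G) i = act ?W (act ?T G) i"
      using aT[OF ag(1) xs(1)] aW[OF ag(2) xs(1)] comm[of g "map int xs"] unfolding xs(2) by simp
    then show "act (?T * ?W) G i = act (?W * ?T) G i"
      using i dT dW by (simp add: act_mult)
  qed (use dT dW in simp_all)
qed

end

section \<open>The Hamiltonian commutes\<close>

lemma chain_differentiable: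
  assumes R: "\<And>g n a. (\<And>m c. (\<lambda>u. g u m c) field_differentiable at z) \<Longrightarrow> (\<lambda>u. R u (g u) n a) field_differentiable at z"
    and K: "\<And>g n. (\<And>m. (\<lambda>u. g u m) field_differentiable at z) \<Longrightarrow> (\<lambda>u. K u (g u) n) field_differentiable at z"
    and g: "\<And>xs a. (\<lambda>u. g u xs a) field_differentiable at z"
  shows "(\<lambda>u. chain (R u) (K u) N (g u) xs a) field_differentiable at (z :: complex)"
  using g
proof (induction N arbitrary: g xs a)
  case 0 then show ?case by (simp add: K)
next
  case (Suc N)
  show ?case unfolding chain.simps by (intro R Suc)
qed

lemma mult_entry:
  assumes "A \<in> carrier_mat n n" "B \<in> carrier_mat n n" "i < n" "k < n"
  shows "(A * B) $$ (i, k) = (\<Sum>l<n. A $$ (i, l) * B $$ (l, k))"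
  using assms by (simp add: scalar_prod_def lessThan_atLeast0)

text \<open>
  Commutation on a neighbourhood is inherited by the entrywise derivative.
\<close>

lemma deriv_commute:
  fixes T :: "complex \<Rightarrow> complex mat"
  assumes T: "\<And>u. T u \<in> carrier_mat n n" and W: "W \<in> carrier_mat n n"
    and ev: "\<forall>\<^sub>F u in nhds z. T u * W = W * T u"
    and d: "\<And>i k. i < n \<Longrightarrow> k < n \<Longrightarrow> (\<lambda>u. T u $$ (i, k)) field_differentiable at z"
  defines "T' \<equiv> mat n n (\<lambda>(i, k). deriv (\<lambda>u. T u $$ (i, k)) z)"
  shows "T' * W = W * T'"
proof (rule eq_matI)
  have T': "T' \<in> carrier_mat n n" by (simp add: T'_def)
  fix i k assume "i < dim_row (W * T')" "k < dim_col (W * T')"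
  then have ik: "i < n" "k < n" using W T' by auto
  have D: "((\<lambda>u. T u $$ (i, k)) has_field_derivative T' $$ (i, k)) (at z)" if "i < n" "k < n" for i k
    using DERIV_deriv_iff_field_differentiable[THEN iffD2, OF d[OF that]] that by (simp add: T'_def)
  let ?f = "\<lambda>u. \<Sum>l<n. T u $$ (i, l) * W $$ (l, k)" and ?g = "\<lambda>u. \<Sum>l<n. W $$ (i, l) * T u $$ (l, k)"
  have Df: "(?f has_field_derivative (\<Sum>l<n. T' $$ (i, l) * W $$ (l, k))) (at z)"
    by (intro DERIV_sum DERIV_cmult_right D ik) auto
  have Dg: "(?g has_field_derivative (\<Sum>l<n. W $$ (i, l) * T' $$ (l, k))) (at z)"
    by (intro DERIV_sum DERIV_cmult D ik) auto
  have "\<forall>\<^sub>F u in nhds z. ?f u = ?g u"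
    using ev
  proof eventually_elim
    case (elim u)
    then have "(T u * W) $$ (i, k) = (W * T u) $$ (i, k)" by simp
    then show ?case unfolding mult_entry[OF T W ik] mult_entry[OF W T ik] .
  qed
  then have "(?f has_field_derivative (\<Sum>l<n. W $$ (i, l) * T' $$ (l, k))) (at z)"
    using Dg DERIV_cong_ev[of z z ?f ?g] by blast
  with Df have "(\<Sum>l<n. T' $$ (i, l) * W $$ (l, k)) = (\<Sum>l<n. W $$ (i, l) * T' $$ (l, k))"
    by (rule DERIV_unique)
  then show "(T' * W) $$ (i, k) = (W * T') $$ (i, k)"
    unfolding mult_entry[OF T' W ik] mult_entry[OF W T' ik] .
qed (use W in \<open>auto simp: T'_def\<close>)

lemma mat_inverse_invertible:
  fixes T :: "complex mat"
  assumes T: "T \<in> carrier_mat n n" and inv: "invertible_mat T"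
  shows "\<exists>I. mat_inverse T = Some I \<and> T * I = 1\<^sub>m n \<and> I * T = 1\<^sub>m n \<and> I \<in> carrier_mat n n"
proof -
  obtain S where S: "inverts_mat T S" "inverts_mat S T" using inv unfolding invertible_mat_def by blast
  have "T * S = 1\<^sub>m n" "S * T = 1\<^sub>m (dim_row S)" using S T unfolding inverts_mat_def by auto
  then have "S \<in> carrier_mat n n"
    using T by (metis carrier_matD carrier_matI index_mult_mat(2,3) index_one_mat(2,3))
  then have "T \<in> Units (ring_mat TYPE(complex) n ())"
    using \<open>T * S = 1\<^sub>m n\<close> \<open>S * T = 1\<^sub>m (dim_row S)\<close> T unfolding Units_def by (auto simp: ring_mat_def)
  then obtain I where I0: "mat_inverse T = Some I" using mat_inverse(1)[OF T, of "()"] by fastforce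
  then show ?thesis using mat_inverse(2)[OF T] by blast
qed

lemma commutator_inverse_mult:
  fixes T T' W :: "complex mat"
  assumes T: "T \<in> carrier_mat n n" and T': "T' \<in> carrier_mat n n" and W: "W \<in> carrier_mat n n"
    and inv: "invertible_mat T" and c: "T * W = W * T" "T' * W = W * T'"
  shows "commutator (the (mat_inverse T) * T') W = 0\<^sub>m n n"
proof -
  obtain I where I0: "mat_inverse T = Some I" and I: "T * I = 1\<^sub>m n" "I * T = 1\<^sub>m n" "I \<in> carrier_mat n n"
    using mat_inverse_invertible[OF T inv] by blast
  have "I * W = I * W * (T * I)" using I W by simp
  also have "\<dots> = I * (W * T) * I" using I W T by (simp add: assoc_mult_mat[of _ n n _ n _ n])
  also have "\<dots> = I * (T * W) * I" by (simp add: c)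
  also have "\<dots> = I * T * (W * I)"
    using assoc_mult_mat[OF I(3) T W] assoc_mult_mat[OF mult_carrier_mat[OF I(3) T] W I(3)] by simp
  also have "\<dots> = W * I" using I W by simp
  finally have IW: "I * W = W * I" .
  have "I * T' * W = I * (W * T')" using I W T' c(2) by (simp add: assoc_mult_mat[of _ n n _ n _ n])
  also have "\<dots> = (I * W) * T'" using I W T' by (simp add: assoc_mult_mat[of _ n n _ n _ n])
  also have "\<dots> = W * (I * T')" unfolding IW using I W T' by (simp add: assoc_mult_mat[of _ n n _ n _ n])
  finally have "I * T' * W = W * (I * T')" .
  then show ?thesis unfolding commutator_def I0 option.sel using I W T' by simp
qed

context generic_q begin

text \<open>
  Near 1 none of the denominators in \<open>transfer_commutes\<close> vanishes.
\<close>

lemma ev_good: "\<forall>\<^sub>F u in nhds 1. u \<noteq> 0 \<and> rho d u \<noteq> 0 \<and> cc d u \<noteq> 0"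
proof -
  have 1: "\<forall>\<^sub>F u in nhds 1. f u \<noteq> 0" if "f \<midarrow>1\<rightarrow> f 1" "f 1 \<noteq> 0" for f :: "complex \<Rightarrow> complex"
    using tendsto_imp_eventually_ne[OF that] that(2) by (simp add: eventually_nhds_conv_at)
  show ?thesis
    by (intro eventually_conj 1[of "\<lambda>u. u"] 1[of "rho d"] 1[of "cc d"] laur_tendsto laur_rho laur_cc rho_1 cc_1) auto
qed

lemma Rop_differentiable:
  assumes g: "\<And>m c. (\<lambda>u. g u m c) field_differentiable at z" and z: "z \<noteq> 0"
  shows "(\<lambda>u. Rop (Suc e) d2 u (g u) n a) field_differentiable at z"
proof -
  let ?I = "{0..int (Suc e)} \<times> {0..int d2}"
  have "Rop (Suc e) d2 u (g u) n a = (\<Sum>x\<in>?I. g u (fst x) (snd x) * Rop (Suc e) d2 u (delta2 (fst x) (snd x)) n a)" for u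
  proof -
    have "Rop (Suc e) d2 u (g u) n a = Rop (Suc e) d2 u (\<lambda>n a. \<Sum>x\<in>?I. g u (fst x) (snd x) * delta2 (fst x) (snd x) n a) n a"
      unfolding delta2_expand[OF finite_atLeastAtMost_int finite_atLeastAtMost_int] inr_mem[symmetric] Rop_in ..
    then show ?thesis unfolding lin2_sum[OF lin2_Rop] .
  qed
  note ex = this
  have la: "laur (\<lambda>u. Rop (Suc e) d2 u (delta2 m c) n a)" for m c
    using laur_Rop[of "\<lambda>u. delta2 m c" 1 e d2 n a] by simp
  show ?thesis unfolding ex
    by (intro field_differentiable_sum field_differentiable_mult g laur_field_differentiable[OF la z])
qed

lemma Kop_differentiable:
  assumes g: "\<And>m. (\<lambda>u. g u m) field_differentiable at z" and z: "z \<noteq> 0"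
  shows "(\<lambda>u. Kop B (Suc e) u (g u) n) field_differentiable at z"
proof -
  let ?I = "{0..int (Suc e)}"
  have "Kop B (Suc e) u (g u) n = (\<Sum>x\<in>?I. g u x * Kop B (Suc e) u (delta1 x) n)" for u
  proof -
    have "(\<lambda>n. inr (Suc e) n * g u n) = (\<lambda>n. \<Sum>x\<in>?I. g u x * delta1 x n)"
      unfolding delta1_expand[OF finite_atLeastAtMost_int] by (auto simp: inr_def fun_eq_iff)
    then have "Kop B (Suc e) u (g u) n = Kop B (Suc e) u (\<lambda>n. \<Sum>x\<in>?I. g u x * delta1 x n) n"
      using Kop_in[of B e u "g u" n] by simp
    then show ?thesis unfolding lin1_sum[OF lin1_Kop] .
  qed
  note ex = this
  have la: "laur (\<lambda>u. Kop B (Suc e) u (delta1 m) n)" for m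
    using laur_Kop[of "\<lambda>u. delta1 m" 1 B e n] by simp
  show ?thesis unfolding ex
    by (intro field_differentiable_sum field_differentiable_mult g laur_field_differentiable[OF la z])
qed

lemma transfer_differentiable:
  fixes e :: nat
  defines "d \<equiv> Suc e"
  assumes nu: "\<nu> = K_norm \<or> \<nu> = K_norm_full" and bb: "k_plus bb = 0" "k_minus bb = 0"
    and i: "i < (d + 1) ^ N" and k: "k < (d + 1) ^ N"
  shows "(\<lambda>u. transfer \<nu> s d N B bb u $$ (i, k)) field_differentiable at 1"
proof -
  let ?e = "encd (replicate N (d + 1))"
  obtain xs where xs: "valid (replicate N (d + 1)) xs" "?e xs = i"
    using encd_surj[of i "replicate N (d + 1)"] i by (auto simp: prod_list_replicate)
  obtain g where g: "agree1 (d + 1) N (\<lambda>l. of_bool (l = k)) g" by (rule agree1_exists)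
  let ?t = "\<lambda>u. trop (Dg \<nu> bb d u) d (chain (Rhat d u) (Khat \<nu> B d u) N) g (map int xs)"
  have eq: "\<forall>\<^sub>F u in nhds 1. transfer \<nu> s d N B bb u $$ (i, k) = ?t u"
    using ev_good[of d]
  proof eventually_elim
    case (elim u)
    have "transfer \<nu> s d N B bb u $$ (i, k) = act (transfer \<nu> s d N B bb u) (\<lambda>l. of_bool (l = k)) i"
      using k transfer_dims[of \<nu> d N B bb u] by (subst act_delta) auto
    also have "\<dots> = ?t u"
      using transfer_act[OF nu bb, of u e N "\<lambda>l. of_bool (l = k)" g xs B] elim g xs by (simp add: d_def)
    finally show ?case .
  qed
  have one: "(1 :: complex) \<noteq> 0" by simp
  have Ri: "(\<lambda>u. inverse (rho d u)) field_differentiable at 1"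
    by (intro field_differentiable_inverse laur_field_differentiable laur_rho one rho_1)
  have Ci: "(\<lambda>u. inverse (cc d u)) field_differentiable at 1"
    by (intro field_differentiable_inverse laur_field_differentiable laur_cc one cc_1)
  have ch: "(\<lambda>u. chain (Rhat d u) (Khat \<nu> B d u) N (\<lambda>ys b. h ys b) xs' a) field_differentiable at 1" for h xs' a
  proof (rule chain_differentiable)
    show "(\<lambda>u. Rhat d u (g u) n a) field_differentiable at 1" if "\<And>m c. (\<lambda>u. g u m c) field_differentiable at 1" for g n a
      unfolding Rhat_def d_def by (intro field_differentiable_mult Ri[unfolded d_def] Rop_differentiable that one)
    show "(\<lambda>u. Khat \<nu> B d u (g u) n) field_differentiable at 1" if "\<And>m. (\<lambda>u. g u m) field_differentiable at 1" for g n
      unfolding Khat_def d_def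
      by (intro field_differentiable_mult Ci[unfolded d_def] Kop_differentiable laur_field_differentiable laur_phi that one)
  qed (rule field_differentiable_const)
  have Dd: "(\<lambda>u. Dg \<nu> bb d u a) field_differentiable at 1" for a
  proof -
    have l: "laur (\<lambda>w. phi \<nu> d w * Kd (dualB bb) d w (nat a))" by (intro laur_mult laur_phi laur_Kd)
    have w: "(\<lambda>u. inverse u * s powi (- 2)) field_differentiable at 1"
      by (intro field_differentiable_mult field_differentiable_const laur_field_differentiable laur_inverse one)
    have "((\<lambda>w. phi \<nu> d w * Kd (dualB bb) d w (nat a)) \<circ> (\<lambda>u. inverse u * s powi (- 2))) field_differentiable at 1"
      by (rule field_differentiable_compose[OF w]) (intro laur_field_differentiable l, simp)
    then show ?thesis by (simp add: Dg_def comp_def)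
  qed
  have "?t field_differentiable at 1"
    unfolding trop_def by (intro field_differentiable_sum field_differentiable_mult Dd ch)
  then obtain D where "(?t has_field_derivative D) (at 1)" unfolding field_differentiable_def by blast
  then have "((\<lambda>u. transfer \<nu> s d N B bb u $$ (i, k)) has_field_derivative D) (at 1)"
    using DERIV_cong_ev[OF refl eq refl] by blast
  then show ?thesis unfolding field_differentiable_def by blast
qed

lemma H_commutes:
  assumes d: "d \<ge> 1" and nu: "\<nu> = K_norm \<or> \<nu> = K_norm_full" and bb: "k_plus bb = 0" "k_minus bb = 0"
    and B: "k_plus B \<noteq> 0" "k_minus B \<noteq> 0"
    and inv: "invertible_mat (transfer \<nu> s d N B bb 1)"
  shows "commutator (H_XXZ \<nu> s d N B bb) (eps_plus bb \<cdot>\<^sub>m W0 s d B N + eps_minus bb \<cdot>\<^sub>m W1 s d B N)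
     = 0\<^sub>m ((d + 1) ^ N) ((d + 1) ^ N)"
proof -
  obtain e where e: "d = Suc e" using d by (cases d) auto
  let ?T = "transfer \<nu> s d N B bb" and ?n = "(d + 1) ^ N"
  let ?W = "eps_plus bb \<cdot>\<^sub>m W0 s d B N + eps_minus bb \<cdot>\<^sub>m W1 s d B N"
  have W: "?W \<in> carrier_mat ?n ?n" using act_W0(1)[of d B N] act_W1(1)[of d B N] by (intro carrier_matI) simp_all
  have c: "?T u * ?W = ?W * ?T u" if "u \<noteq> 0" "rho d u \<noteq> 0" "cc d u \<noteq> 0" for u
    using transfer_commutes[OF nu bb B, of u e N] that unfolding e by blast
  have "?T 1 * ?W = ?W * ?T 1" by (rule c) (simp_all add: rho_1 cc_1)
  moreover have "mat ?n ?n (\<lambda>(i, k). deriv (\<lambda>u. ?T u $$ (i, k)) 1) * ?W = ?W * mat ?n ?n (\<lambda>(i, k). deriv (\<lambda>u. ?T u $$ (i, k)) 1)"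
  proof (rule deriv_commute[OF transfer_dims W])
    show "\<forall>\<^sub>F u in nhds 1. ?T u * ?W = ?W * ?T u"
      using ev_good[of d] by eventually_elim (use c in blast)
    show "(\<lambda>u. ?T u $$ (i, k)) field_differentiable at 1" if "i < ?n" "k < ?n" for i k
      using transfer_differentiable[OF nu bb, of i e N k B] that unfolding e by blast
  qed
  ultimately show ?thesis unfolding H_XXZ_def
    by (intro commutator_inverse_mult transfer_dims W inv) simp_all
qed

end

lemma commutator_smult_zero:
  fixes H W :: "complex mat"
  assumes 0: "commutator H (c \<cdot>\<^sub>m W) = 0\<^sub>m n n" and c: "c \<noteq> 0"
    and H: "H \<in> carrier_mat n n" and W: "W \<in> carrier_mat n n"
  shows "commutator H W = 0\<^sub>m n n"
proof (rule eq_matI)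
  fix i k assume "i < dim_row (0\<^sub>m n n :: complex mat)" "k < dim_col (0\<^sub>m n n :: complex mat)"
  then have ik: "i < n" "k < n" by auto
  have "commutator H (c \<cdot>\<^sub>m W) = c \<cdot>\<^sub>m (H * W) - c \<cdot>\<^sub>m (W * H)"
    unfolding commutator_def mult_smult_distrib[OF H W] mult_smult_assoc_mat[OF W H] ..
  then have "(c \<cdot>\<^sub>m (H * W) - c \<cdot>\<^sub>m (W * H)) $$ (i, k) = (0\<^sub>m n n :: complex mat) $$ (i, k)" using 0 by simp
  then have "(c \<cdot>\<^sub>m (H * W) - c \<cdot>\<^sub>m (W * H)) $$ (i, k) = 0" using ik by simp
  then have "c * ((H * W) $$ (i, k) - (W * H) $$ (i, k)) = 0"
    using ik H W by (simp add: right_diff_distrib del: index_mult_mat(1))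
  then show "commutator H W $$ (i, k) = 0\<^sub>m n n $$ (i, k)"
    using c ik H W by (simp add: commutator_def del: index_mult_mat(1))
qed (use H W in \<open>auto simp: commutator_def\<close>)

context generic_q begin

lemma H_XXZ_carrier:
  assumes "invertible_mat (transfer \<nu> s d N B bb 1)"
  shows "H_XXZ \<nu> s d N B bb \<in> carrier_mat ((d + 1) ^ N) ((d + 1) ^ N)"
proof -
  obtain I where "mat_inverse (transfer \<nu> s d N B bb 1) = Some I" "I \<in> carrier_mat ((d + 1) ^ N) ((d + 1) ^ N)"
    using mat_inverse_invertible[OF transfer_dims assms] by blast
  then show ?thesis unfolding H_XXZ_def option.sel by (intro mult_carrier_mat[where n = "(d + 1) ^ N"]) auto
qed

end

theorem proposition6p8:
  fixes q s hp hm hz :: complex and d N :: nat and b :: boundary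
    and \<nu> :: "complex \<Rightarrow> nat \<Rightarrow> complex \<Rightarrow> complex"
  assumes "q \<noteq> 0" and "\<And>n :: nat. n > 0 \<Longrightarrow> q ^ n \<noteq> 1" and "s\<^sup>2 = q"
    and "N \<ge> 1" and "d \<ge> 1"
    and "hp \<noteq> 0" and "hm \<noteq> 0" and "reduced_params b hp hm hz"
    and "\<nu> = K_norm \<or> \<nu> = K_norm_full"
  shows "(\<forall>bb. reduced_params bb 0 0 1 \<longrightarrow> invertible_mat (transfer \<nu> s d N b bb 1) \<longrightarrow>
            commutator (H_XXZ \<nu> s d N b bb) (W0 s d b N) = 0\<^sub>m ((d + 1) ^ N) ((d + 1) ^ N))
       \<and> (\<forall>bb. reduced_params bb 0 0 (- 1) \<longrightarrow> invertible_mat (transfer \<nu> s d N b bb 1) \<longrightarrow>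
            commutator (H_XXZ \<nu> s d N b bb) (W1 s d b N) = 0\<^sub>m ((d + 1) ^ N) ((d + 1) ^ N))
       \<and> (\<forall>bb hbz. reduced_params bb 0 0 hbz \<longrightarrow> invertible_mat (transfer \<nu> s d N b bb 1) \<longrightarrow>
            commutator (H_XXZ \<nu> s d N b bb)
              (eps_plus bb \<cdot>\<^sub>m W0 s d b N + eps_minus bb \<cdot>\<^sub>m W1 s d b N)
            = 0\<^sub>m ((d + 1) ^ N) ((d + 1) ^ N))"
proof -
  have s0: "s \<noteq> 0" using assms(1,3) by auto
  interpret generic_q s
  proof
    show "s powi k \<noteq> 1" if "k \<noteq> 0" for k
    proof
      assume "s powi k = 1"
      then have "s ^ nat \<bar>k\<bar> = 1" by (auto simp: power_int_def power_inverse split: if_splits)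
      then have "q ^ nat \<bar>k\<bar> = 1"
        unfolding assms(3)[symmetric] by (simp add: power_mult[symmetric] mult.commute power_mult)
      then show False using assms(2)[of "nat \<bar>k\<bar>"] that by simp
    qed
  qed (rule s0)
  have kb: "k_plus b \<noteq> 0" "k_minus b \<noteq> 0" using assms(6-8) unfolding reduced_params_def by auto
  let ?n = "(d + 1) ^ N"
  have W: "W0 s d b N \<in> carrier_mat ?n ?n" "W1 s d b N \<in> carrier_mat ?n ?n"
    using act_W0(1)[of d b N] act_W1(1)[of d b N] by (auto intro: carrier_matI)
  have main: "commutator (H_XXZ \<nu> s d N b bb) (eps_plus bb \<cdot>\<^sub>m W0 s d b N + eps_minus bb \<cdot>\<^sub>m W1 s d b N) = 0\<^sub>m ?n ?n"
    if "reduced_params bb 0 0 z" "invertible_mat (transfer \<nu> s d N b bb 1)" for bb z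
  proof (rule H_commutes[OF assms(5,9) _ _ kb that(2)])
    show "k_plus bb = 0" "k_minus bb = 0" using that(1) unfolding reduced_params_def by auto
  qed
  have A: "commutator (H_XXZ \<nu> s d N b bb) (W0 s d b N) = 0\<^sub>m ?n ?n"
    if r: "reduced_params bb 0 0 1" and i: "invertible_mat (transfer \<nu> s d N b bb 1)" for bb
  proof -
    have e: "eps_plus bb \<noteq> 0" "eps_minus bb = 0" using r unfolding reduced_params_def by (auto simp: field_simps)
    have "eps_plus bb \<cdot>\<^sub>m W0 s d b N + eps_minus bb \<cdot>\<^sub>m W1 s d b N = eps_plus bb \<cdot>\<^sub>m W0 s d b N"
      using W e by (intro eq_matI) auto
    then show ?thesis using main[OF r i] e(1) W(1) H_XXZ_carrier[OF i] by (auto intro: commutator_smult_zero)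
  qed
  have C: "commutator (H_XXZ \<nu> s d N b bb) (W1 s d b N) = 0\<^sub>m ?n ?n"
    if r: "reduced_params bb 0 0 (- 1)" and i: "invertible_mat (transfer \<nu> s d N b bb 1)" for bb
  proof -
    have e: "eps_minus bb \<noteq> 0" "eps_plus bb = 0" using r unfolding reduced_params_def by (auto simp: field_simps)
    have "eps_plus bb \<cdot>\<^sub>m W0 s d b N + eps_minus bb \<cdot>\<^sub>m W1 s d b N = eps_minus bb \<cdot>\<^sub>m W1 s d b N"
      using W e by (intro eq_matI) auto
    then show ?thesis using main[OF r i] e(1) W(2) H_XXZ_carrier[OF i] by (auto intro: commutator_smult_zero)
  qed
  show ?thesis using A C main by blast
qed

end
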